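(* The syntactic cwf $\mathcal T$ (with its type $o\in\mathrm{Ty}_{\mathcal T}(1)$) is a bifree cwf on one base type, that is, $(\mathcal T,o)$ is bi-initial in the 2-category $\mathbf{CwF}^o$.
   Context: **Cwf.** A category with families (cwf) $\mathcal C$ consists of: a category with set of objects $\mathrm{Ctx}_{\mathcal C}$ (contexts) and hom-sets $\mathrm{Sub}_{\mathcal C}(\Gamma,\Delta)$ (substitutions); for each context $\Gamma$ a set $\mathrm{Ty}_{\mathcal C}(\Gamma)$ of types and for each $A\in\mathrm{Ty}_{\mathcal C}(\Gamma)$ a set $\mathrm{Tm}_{\mathcal C}(\Gamma,A)$ of terms; for $\gamma\in\mathrm{Sub}_{\mathcal C}(\Gamma,\Delta)$ maps $A\mapsto A[\gamma]$, $\mathrm{Ty}(\Delta)\to\mathrm{Ty}(\Gamma)$, and $a\mapsto a[\gamma]$, $\mathrm{Tm}(\Delta,A)\to\mathrm{Tm}(\Gamma,A[\gamma])$, functorial in $\gamma$; a chosen terminal object $1$; for each $\Delta$ and $A\in\mathrm{Ty}(\Delta)$ a chosen context $\Delta.A$ with $\mathrm p_A\in\mathrm{Sub}(\Delta.A,\Delta)$ and $\mathrm q_A\in\mathrm{Tm}(\Delta.A,A[\mathrm p_A])$ such that for all $\gamma\in\mathrm{Sub}(\Gamma,\Delta)$, $a\in\mathrm{Tm}(\Gamma,A[\gamma])$ there is a unique $\langle\gamma,a\rangle\in\mathrm{Sub}(\Gamma,\Delta.A)$ with $\mathrm p_A\circ\langle\gamma,a\rangle=\gamma$ and $\mathrm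 q_A[\langle\gamma,a\rangle]=a$. Subscripts of $\mathrm p,\mathrm q$ are often omitted. For $\gamma:\Delta\to\Gamma$ and $A\in\mathrm{Ty}(\Gamma)$, $\gamma^+=\langle\gamma\circ\mathrm p,\mathrm q\rangle:\Delta.A[\gamma]\to\Gamma.A$. **Indexed category.** $\mathbf T(\Gamma)$ is the category with objects $\mathrm{Ty}(\Gamma)$ and morphisms $A\to B$ the substitutions $f:\Gamma.A\to\Gamma.B$ with $\mathrm p\circ f=\mathrm p$. For $\gamma:\Delta\to\Gamma$, $\mathbf T(\gamma):\mathbf T(\Gamma)\to\mathbf T(\Delta)$ sends $A$ to $A[\gamma]$ and $f$ to $\langle\mathrm p,\mathrm q[f\circ\gamma^+]\rangle$. $A\cong_\Gamma B$ denotes isomorphism in $\mathbf T(\Gamma)$. For $f:A\to B$ in $\mathbf T(\Gamma)$ and $a\in\mathrm{Tm}(\Gamma,A)$, $\{f\}(a)=\mathrm q[f\circ\langle\mathrm{id},a\rangle]\in\mathrm{Tm}(\Gamma,B)$. **Pseudo cwf-morphism** $F:\mathcal C\to\mathcal C'$: a functor $F$; maps $A\mapsto FA$, $\mathrm{Ty}_{\mathcal C}(\Gamma)\to\mathrm{Ty}_{\mathcal C'}(F\Gamma)$, and $a\mapsto Fa$, $\mathrm{Tm}_{\mathcal C}(\Gamma,A)\to\mathrm{Tm}_{\mathcal C'}(F\Gamma,FA)$; for $\gamma:\Gamma\to\Delta$ and $A\in\mathrm{Ty}_{\mathcal C}(\Delta)$ an isomorphism $\theta_{A,\gamma}:FA[F\gamma]\cong_{F\Gamma}F(A[\gamma])$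 with $F(a[\gamma])=\{\theta_{A,\gamma}\}(Fa[F\gamma])$; such that $F1$ is terminal (with $!_F:1\to F1$ the isomorphism) and $F(\Gamma.A)$ with $F(\mathrm p_A)$ and $\{\theta_{A,\mathrm p}^{-1}\}(F\mathrm q_A)$ is a context comprehension of $F\Gamma$ and $FA$, which yields a unique isomorphism $\rho_{\Gamma,A}:F(\Gamma.A)\to F\Gamma.FA$ with $F(\mathrm p_A)=\mathrm p\circ\rho_{\Gamma,A}$ and $F(\mathrm q_A)=\{\theta_{A,\mathrm p}\}(\mathrm q[\rho_{\Gamma,A}])$. Put $F_\Gamma(f)=\rho_{\Gamma,B}\circ F(f)\circ\rho_{\Gamma,A}^{-1}$ for $f:A\to B$ in $\mathbf T(\Gamma)$. Laws: $\theta_{A,\mathrm{id}}=\mathrm{id}$; $\theta_{A,\gamma\circ\delta}=\theta_{A[\gamma],\delta}\circ\mathbf T'(F\delta)(\theta_{A,\gamma})$; $F_\Delta(\mathbf T(\delta)(f))\circ\theta_{A,\delta}=\theta_{B,\delta}\circ\mathbf T'(F\delta)(F_\Gamma(f))$ for $\delta:\Delta\to\Gamma$, $f:A\to B$ in $\mathbf T(\Gamma)$. **Pseudo cwf-transformation** $F\to G$: a pair $(\varphi,\psi)$ with $\varphi:F\Rightarrow G$ a natural transformation and, for each $\Gamma$ and $A\in\mathrm{Ty}_{\mathcal C}(\Gamma)$, an isomorphism $\psi_A:FA\cong_{F\Gamma}GA[\varphi_\Gamma]$ such that $\varphi_{\Gamma.A}=(\rho^G_{\Gamma,A})^{-1}\circ\varphi_\Gamma^+\circ\psi_A\circ\rho^F_{\Gamma,A}$.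 **The 2-category $\mathbf{CwF}^o$**: objects are pairs $(\mathcal C,o_{\mathcal C})$ with $\mathcal C$ a cwf and $o_{\mathcal C}\in\mathrm{Ty}_{\mathcal C}(1)$; morphisms $(\mathcal C,o_{\mathcal C})\to(\mathcal D,o_{\mathcal D})$ are pairs $(F,\alpha_F)$ of a pseudo cwf-morphism $F$ and an isomorphism $\alpha_F:F(o_{\mathcal C})[!_F]\cong_1 o_{\mathcal D}$; 2-cells $(F,\alpha_F)\to(G,\alpha_G)$ are pseudo cwf-transformations $(\varphi,\psi)$ with $\mathbf T(!_F)(\psi_{o_{\mathcal C}})=\alpha_G^{-1}\circ\alpha_F:F(o_{\mathcal C})[!_F]\cong G(o_{\mathcal C})[!_G]$. **Bi-initial**: $I$ is bi-initial in a 2-category if for every object $A$ there is an arrow $I\to A$ and for any two arrows $f,g:I\to A$ there is a unique 2-cell $f\Rightarrow g$. **Raw syntax** (contexts, substitutions, types, terms): $\Gamma::=1\mid\Gamma.A$; $\gamma::=\gamma\circ\gamma\mid\mathrm{id}_\Gamma\mid\langle\rangle_\Gamma\mid\mathrm p_A\mid\langle\gamma,a\rangle_A$; $A::=o\mid A[\gamma]$; $a::=a[\gamma]\mid\mathrm q_A$. **Judgments**, defined simultaneously inductively: $\Gamma=\Gamma'\vdash$, $\Delta\vdash\gamma=\gamma':\Gamma$, $\Gamma\vdash A=A'$, $\Gamma\vdash a=a':A$. Reflexive instances are abbreviated $\Gamma\vdash$, $\Delta\vdash\gamma:\Gamma$, $\Gamma\vdash A$, $\Gamma\vdash a:A$.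 *Per rules*: each of the four relations is symmetric and transitive. *Preservation*: if $\Gamma=\Gamma'\vdash$, $\Delta=\Delta'\vdash$, $\Gamma\vdash\gamma=\gamma':\Delta$ then $\Gamma'\vdash\gamma=\gamma':\Delta'$; if $\Gamma=\Gamma'\vdash$, $\Gamma\vdash A=A'$ then $\Gamma'\vdash A=A'$; if $\Gamma=\Gamma'\vdash$, $\Gamma\vdash A=A'$, $\Gamma\vdash a=a':A$ then $\Gamma'\vdash a=a':A'$. *Congruence*: $1=1\vdash$; $1\vdash o=o$; if $\Gamma=\Gamma'\vdash$ and $\Gamma\vdash A=A'$ then $\Gamma.A=\Gamma'.A'\vdash$; if $\Gamma\vdash A=A'$ and $\Delta\vdash\gamma=\gamma':\Gamma$ then $\Delta\vdash A[\gamma]=A'[\gamma']$; if $\Gamma=\Gamma'\vdash$ then $\Gamma\vdash\mathrm{id}_\Gamma=\mathrm{id}_{\Gamma'}:\Gamma$ and $\Gamma\vdash\langle\rangle_\Gamma=\langle\rangle_{\Gamma'}:1$; if $\Gamma\vdash\delta=\delta':\Delta$ and $\Delta\vdash\gamma=\gamma':\Theta$ then $\Gamma\vdash\gamma\circ\delta=\gamma'\circ\delta':\Theta$; if $\Gamma\vdash A=A'$ then $\Gamma.A\vdash\mathrm p_A=\mathrm p_{A'}:\Gamma$ and $\Gamma.A\vdash\mathrm q_A=\mathrm q_{A'}:A[\mathrm p_A]$; if $\Gamma\vdash A=A'$, $\Delta\vdash\gamma=\gamma':\Gamma$, $\Delta\vdash a=a':A[\gamma]$ then $\Delta\vdash\langle\gamma,a\rangle_A=\langle\gamma',a'\rangle_{A'}:\Gamma.A$;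 if $\Gamma\vdash a=a':A$, $\Delta\vdash\gamma=\gamma':\Gamma$ then $\Delta\vdash a[\gamma]=a'[\gamma']:A[\gamma]$. *Conversion* (whenever the constituents are well-typed): $(\theta\circ\delta)\circ\gamma=\theta\circ(\delta\circ\gamma)$; $\gamma=\mathrm{id}\circ\gamma$; $\gamma=\gamma\circ\mathrm{id}$; $A[\gamma\circ\delta]=A[\gamma][\delta]$; $A[\mathrm{id}]=A$; $a[\gamma\circ\delta]=a[\gamma][\delta]$; $a[\mathrm{id}]=a$; $\gamma=\langle\rangle_\Gamma$ if $\Gamma\vdash\gamma:1$; $\mathrm p_A\circ\langle\gamma,a\rangle_A=\gamma$; $\mathrm q_A[\langle\gamma,a\rangle_A]=a$; $\gamma=\langle\mathrm p_A\circ\gamma,\mathrm q_A[\gamma]\rangle_A$ if $\Delta\vdash\gamma:\Gamma.A$. **The cwf $\mathcal T$**: contexts, substitutions $\Gamma\to\Delta$, types over $\Gamma$, terms of type $A$ over $\Gamma$ are the raw $\Gamma$ with $\Gamma\vdash$, $\gamma$ with $\Gamma\vdash\gamma:\Delta$, $A$ with $\Gamma\vdash A$, $a$ with $\Gamma\vdash a:A$ respectively, each modulo derivable equality; cwf-operations are induced by the syntactic constructors. *)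

theory Defs
  imports Main "HOL-Library.FuncSet"
begin

section \<open>Categories with families\<close>

text \<open>
  Hom-sets, sets of types and sets of terms are indexed families that need not be disjoint.
  Every operation therefore takes its indices explicitly, the source context before the target
  context: for \<open>\<delta> : \<Xi> \<rightarrow> \<Delta>\<close>, \<open>\<gamma> : \<Delta> \<rightarrow> \<Gamma>\<close>, \<open>A\<close> a type over \<open>\<Gamma>\<close> and \<open>a\<close> a term of type \<open>A\<close>,

  \<^item> \<open>cmp C \<Xi> \<Delta> \<Gamma> \<gamma> \<delta>\<close> is the composite of \<open>\<gamma>\<close> after \<open>\<delta>\<close>,
  \<^item> \<open>tysub C \<Delta> \<Gamma> A \<gamma>\<close> is \<open>A[\<gamma>]\<close>,
  \<^item> \<open>tmsub C \<Delta> \<Gamma> A a \<gamma>\<close> is \<open>a[\<gamma>]\<close>.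
\<close>

record ('c, 's, 't, 'm) cwf_data =
  Ctx :: "'c set"
  Sub :: "'c \<Rightarrow> 'c \<Rightarrow> 's set"
  Ty :: "'c \<Rightarrow> 't set"
  Tm :: "'c \<Rightarrow> 't \<Rightarrow> 'm set"
  idn :: "'c \<Rightarrow> 's"
  cmp :: "'c \<Rightarrow> 'c \<Rightarrow> 'c \<Rightarrow> 's \<Rightarrow> 's \<Rightarrow> 's"
  tysub :: "'c \<Rightarrow> 'c \<Rightarrow> 't \<Rightarrow> 's \<Rightarrow> 't"
  tmsub :: "'c \<Rightarrow> 'c \<Rightarrow> 't \<Rightarrow> 'm \<Rightarrow> 's \<Rightarrow> 'm"
  emp :: "'c"
  ext :: "'c \<Rightarrow> 't \<Rightarrow> 'c"
  pr :: "'c \<Rightarrow> 't \<Rightarrow> 's"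
  vr :: "'c \<Rightarrow> 't \<Rightarrow> 'm"

definition terminal :: "('c, 's, 't, 'm) cwf_data \<Rightarrow> 'c \<Rightarrow> bool" where
  "terminal C X \<longleftrightarrow> X \<in> Ctx C \<and> (\<forall>\<Gamma>\<in>Ctx C. \<exists>!\<gamma>. \<gamma> \<in> Sub C \<Gamma> X)"

definition comprehension ::
    "('c, 's, 't, 'm) cwf_data \<Rightarrow> 'c \<Rightarrow> 't \<Rightarrow> 'c \<Rightarrow> 's \<Rightarrow> 'm \<Rightarrow> bool" where
  "comprehension C \<Gamma> A E p q \<longleftrightarrow>
     E \<in> Ctx C \<and> p \<in> Sub C E \<Gamma> \<and> q \<in> Tm C E (tysub C E \<Gamma> A p) \<and>
     (\<forall>\<Delta>\<in>Ctx C. \<forall>\<gamma>\<in>Sub C \<Delta> \<Gamma>. \<forall>a\<in>Tm C \<Delta> (tysub C \<Delta> \<Gamma> A \<gamma>).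
        \<exists>!\<sigma>. \<sigma> \<in> Sub C \<Delta> E \<and> cmp C \<Delta> E \<Gamma> p \<sigma> = \<gamma> \<and>
              tmsub C \<Delta> E (tysub C E \<Gamma> A p) q \<sigma> = a)"

locale cwf =
  fixes C :: "('c, 's, 't, 'm) cwf_data"
  assumes idn_in: "\<Gamma> \<in> Ctx C \<Longrightarrow> idn C \<Gamma> \<in> Sub C \<Gamma> \<Gamma>"
    and cmp_in: "\<lbrakk>\<Xi> \<in> Ctx C; \<Delta> \<in> Ctx C; \<Gamma> \<in> Ctx C; \<delta> \<in> Sub C \<Xi> \<Delta>; \<gamma> \<in> Sub C \<Delta> \<Gamma>\<rbrakk>
      \<Longrightarrow> cmp C \<Xi> \<Delta> \<Gamma> \<gamma> \<delta> \<in> Sub C \<Xi> \<Gamma>"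
    and cmp_idn_left: "\<lbrakk>\<Delta> \<in> Ctx C; \<Gamma> \<in> Ctx C; \<gamma> \<in> Sub C \<Delta> \<Gamma>\<rbrakk>
      \<Longrightarrow> cmp C \<Delta> \<Gamma> \<Gamma> (idn C \<Gamma>) \<gamma> = \<gamma>"
    and cmp_idn_right: "\<lbrakk>\<Delta> \<in> Ctx C; \<Gamma> \<in> Ctx C; \<gamma> \<in> Sub C \<Delta> \<Gamma>\<rbrakk>
      \<Longrightarrow> cmp C \<Delta> \<Delta> \<Gamma> \<gamma> (idn C \<Delta>) = \<gamma>"
    and cmp_assoc: "\<lbrakk>\<Theta> \<in> Ctx C; \<Xi> \<in> Ctx C; \<Delta> \<in> Ctx C; \<Gamma> \<in> Ctx C;
        \<epsilon> \<in> Sub C \<Theta> \<Xi>; \<delta> \<in> Sub C \<Xi> \<Delta>; \<gamma> \<in> Sub C \<Delta> \<Gamma>\<rbrakk>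
      \<Longrightarrow> cmp C \<Theta> \<Xi> \<Gamma> (cmp C \<Xi> \<Delta> \<Gamma> \<gamma> \<delta>) \<epsilon> = cmp C \<Theta> \<Delta> \<Gamma> \<gamma> (cmp C \<Theta> \<Xi> \<Delta> \<delta> \<epsilon>)"
    and tysub_in: "\<lbrakk>\<Delta> \<in> Ctx C; \<Gamma> \<in> Ctx C; \<gamma> \<in> Sub C \<Delta> \<Gamma>; A \<in> Ty C \<Gamma>\<rbrakk>
      \<Longrightarrow> tysub C \<Delta> \<Gamma> A \<gamma> \<in> Ty C \<Delta>"
    and tysub_idn: "\<lbrakk>\<Gamma> \<in> Ctx C; A \<in> Ty C \<Gamma>\<rbrakk> \<Longrightarrow> tysub C \<Gamma> \<Gamma> A (idn C \<Gamma>) = A"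
    and tysub_cmp: "\<lbrakk>\<Xi> \<in> Ctx C; \<Delta> \<in> Ctx C; \<Gamma> \<in> Ctx C;
        \<delta> \<in> Sub C \<Xi> \<Delta>; \<gamma> \<in> Sub C \<Delta> \<Gamma>; A \<in> Ty C \<Gamma>\<rbrakk>
      \<Longrightarrow> tysub C \<Xi> \<Gamma> A (cmp C \<Xi> \<Delta> \<Gamma> \<gamma> \<delta>) = tysub C \<Xi> \<Delta> (tysub C \<Delta> \<Gamma> A \<gamma>) \<delta>"
    and tmsub_in: "\<lbrakk>\<Delta> \<in> Ctx C; \<Gamma> \<in> Ctx C; \<gamma> \<in> Sub C \<Delta> \<Gamma>; A \<in> Ty C \<Gamma>; a \<in> Tm C \<Gamma> A\<rbrakk>
      \<Longrightarrow> tmsub C \<Delta> \<Gamma> A a \<gamma> \<in> Tm C \<Delta> (tysub C \<Delta> \<Gamma> A \<gamma>)"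
    and tmsub_idn: "\<lbrakk>\<Gamma> \<in> Ctx C; A \<in> Ty C \<Gamma>; a \<in> Tm C \<Gamma> A\<rbrakk>
      \<Longrightarrow> tmsub C \<Gamma> \<Gamma> A a (idn C \<Gamma>) = a"
    and tmsub_cmp: "\<lbrakk>\<Xi> \<in> Ctx C; \<Delta> \<in> Ctx C; \<Gamma> \<in> Ctx C;
        \<delta> \<in> Sub C \<Xi> \<Delta>; \<gamma> \<in> Sub C \<Delta> \<Gamma>; A \<in> Ty C \<Gamma>; a \<in> Tm C \<Gamma> A\<rbrakk>
      \<Longrightarrow> tmsub C \<Xi> \<Gamma> A a (cmp C \<Xi> \<Delta> \<Gamma> \<gamma> \<delta>)
            = tmsub C \<Xi> \<Delta> (tysub C \<Delta> \<Gamma> A \<gamma>) (tmsub C \<Delta> \<Gamma> A a \<gamma>) \<delta>"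
    and terminal_emp: "terminal C (emp C)"
    and comprehension_ext: "\<lbrakk>\<Gamma> \<in> Ctx C; A \<in> Ty C \<Gamma>\<rbrakk>
      \<Longrightarrow> comprehension C \<Gamma> A (ext C \<Gamma> A) (pr C \<Gamma> A) (vr C \<Gamma> A)"

text \<open>\<open>pair C \<Delta> \<Gamma> A \<gamma> a\<close> is \<open>\<langle>\<gamma>, a\<rangle> : \<Delta> \<rightarrow> \<Gamma>.A\<close>, and \<open>lift C \<Delta> \<Gamma> A \<gamma>\<close> is \<open>\<gamma>\<^sup>+ : \<Delta>.A[\<gamma>] \<rightarrow> \<Gamma>.A\<close>.\<close>

definition pair :: "('c, 's, 't, 'm) cwf_data \<Rightarrow> 'c \<Rightarrow> 'c \<Rightarrow> 't \<Rightarrow> 's \<Rightarrow> 'm \<Rightarrow> 's" where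
  "pair C \<Delta> \<Gamma> A \<gamma> a =
     (let E = ext C \<Gamma> A; p = pr C \<Gamma> A in
      THE \<sigma>. \<sigma> \<in> Sub C \<Delta> E \<and> cmp C \<Delta> E \<Gamma> p \<sigma> = \<gamma> \<and>
             tmsub C \<Delta> E (tysub C E \<Gamma> A p) (vr C \<Gamma> A) \<sigma> = a)"

definition lift :: "('c, 's, 't, 'm) cwf_data \<Rightarrow> 'c \<Rightarrow> 'c \<Rightarrow> 't \<Rightarrow> 's \<Rightarrow> 's" where
  "lift C \<Delta> \<Gamma> A \<gamma> =
     (let A' = tysub C \<Delta> \<Gamma> A \<gamma>; E = ext C \<Delta> A' in
      pair C E \<Gamma> A (cmp C E \<Delta> \<Gamma> \<gamma> (pr C \<Delta> A')) (vr C \<Delta> A'))"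

definition inverse_sub :: "('c, 's, 't, 'm) cwf_data \<Rightarrow> 'c \<Rightarrow> 'c \<Rightarrow> 's \<Rightarrow> 's \<Rightarrow> bool" where
  "inverse_sub C \<Delta> \<Gamma> f g \<longleftrightarrow>
     cmp C \<Delta> \<Gamma> \<Delta> g f = idn C \<Delta> \<and> cmp C \<Gamma> \<Delta> \<Gamma> f g = idn C \<Gamma>"

definition iso_sub :: "('c, 's, 't, 'm) cwf_data \<Rightarrow> 'c \<Rightarrow> 'c \<Rightarrow> 's set" where
  "iso_sub C \<Delta> \<Gamma> = {f \<in> Sub C \<Delta> \<Gamma>. \<exists>g\<in>Sub C \<Gamma> \<Delta>. inverse_sub C \<Delta> \<Gamma> f g}"

definition inv_sub :: "('c, 's, 't, 'm) cwf_data \<Rightarrow> 'c \<Rightarrow> 'c \<Rightarrow> 's \<Rightarrow> 's" where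
  "inv_sub C \<Delta> \<Gamma> f = (THE g. g \<in> Sub C \<Gamma> \<Delta> \<and> inverse_sub C \<Delta> \<Gamma> f g)"


section \<open>The indexed category of types\<close>

text \<open>
  \<open>ty_hom\<close> and \<open>ty_iso\<close> are the morphisms and the isomorphisms of \<open>\<^bold>T(\<Gamma>)\<close>. Composition
  and identities in \<open>\<^bold>T(\<Gamma>)\<close> are those of substitutions between extended contexts; \<open>ty_cmp\<close>
  and \<open>ty_inv\<close> only abbreviate the context indices.
\<close>

definition ty_hom :: "('c, 's, 't, 'm) cwf_data \<Rightarrow> 'c \<Rightarrow> 't \<Rightarrow> 't \<Rightarrow> 's set" where
  "ty_hom C \<Gamma> A B =
     {f \<in> Sub C (ext C \<Gamma> A) (ext C \<Gamma> B).
        cmp C (ext C \<Gamma> A) (ext C \<Gamma> B) \<Gamma> (pr C \<Gamma> B) f = pr C \<Gamma> A}"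

definition ty_cmp :: "('c, 's, 't, 'm) cwf_data \<Rightarrow> 'c \<Rightarrow> 't \<Rightarrow> 't \<Rightarrow> 't \<Rightarrow> 's \<Rightarrow> 's \<Rightarrow> 's" where
  "ty_cmp C \<Gamma> A B B' g f = cmp C (ext C \<Gamma> A) (ext C \<Gamma> B) (ext C \<Gamma> B') g f"

definition ty_iso :: "('c, 's, 't, 'm) cwf_data \<Rightarrow> 'c \<Rightarrow> 't \<Rightarrow> 't \<Rightarrow> 's set" where
  "ty_iso C \<Gamma> A B =
     {f \<in> ty_hom C \<Gamma> A B. \<exists>g\<in>ty_hom C \<Gamma> B A. inverse_sub C (ext C \<Gamma> A) (ext C \<Gamma> B) f g}"

definition ty_inv :: "('c, 's, 't, 'm) cwf_data \<Rightarrow> 'c \<Rightarrow> 't \<Rightarrow> 't \<Rightarrow> 's \<Rightarrow> 's" where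
  "ty_inv C \<Gamma> A B f = inv_sub C (ext C \<Gamma> A) (ext C \<Gamma> B) f"

text \<open>For \<open>\<gamma> : \<Delta> \<rightarrow> \<Gamma>\<close>, the morphism part of the functor \<open>\<^bold>T(\<gamma>) : \<^bold>T(\<Gamma>) \<rightarrow> \<^bold>T(\<Delta>)\<close>:
  \<open>f : A \<rightarrow> B\<close> is sent to \<open>\<langle>p, q[f \<circ> \<gamma>\<^sup>+]\<rangle> : A[\<gamma>] \<rightarrow> B[\<gamma>]\<close>.\<close>

definition ty_reindex ::
    "('c, 's, 't, 'm) cwf_data \<Rightarrow> 'c \<Rightarrow> 'c \<Rightarrow> 't \<Rightarrow> 't \<Rightarrow> 's \<Rightarrow> 's \<Rightarrow> 's" where
  "ty_reindex C \<Delta> \<Gamma> A B \<gamma> f =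
     (let A' = tysub C \<Delta> \<Gamma> A \<gamma>; B' = tysub C \<Delta> \<Gamma> B \<gamma>;
          EA = ext C \<Gamma> A; EB = ext C \<Gamma> B; EA' = ext C \<Delta> A' in
      pair C EA' \<Delta> B' (pr C \<Delta> A')
        (tmsub C EA' EB (tysub C EB \<Gamma> B (pr C \<Gamma> B)) (vr C \<Gamma> B)
          (cmp C EA' EA EB f (lift C \<Delta> \<Gamma> A \<gamma>))))"

text \<open>\<open>ty_app C \<Gamma> A B f a\<close> is \<open>{f}(a) = q[f \<circ> \<langle>id, a\<rangle>]\<close>, a term of type \<open>B\<close>.\<close>

definition ty_app ::
    "('c, 's, 't, 'm) cwf_data \<Rightarrow> 'c \<Rightarrow> 't \<Rightarrow> 't \<Rightarrow> 's \<Rightarrow> 'm \<Rightarrow> 'm" where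
  "ty_app C \<Gamma> A B f a =
     (let EA = ext C \<Gamma> A; EB = ext C \<Gamma> B in
      tmsub C \<Gamma> EB (tysub C EB \<Gamma> B (pr C \<Gamma> B)) (vr C \<Gamma> B)
        (cmp C \<Gamma> EA EB f (pair C \<Gamma> \<Gamma> A (idn C \<Gamma>) a)))"


section \<open>Pseudo cwf-morphisms\<close>

text \<open>\<open>th F \<Delta> \<Gamma> A \<gamma>\<close> is \<open>\<theta>\<^bsub>A,\<gamma>\<^esub>\<close> for \<open>\<gamma> : \<Delta> \<rightarrow> \<Gamma>\<close> and \<open>A\<close> a type over \<open>\<Gamma>\<close>.\<close>

record ('c, 's, 't, 'm, 'd, 'u, 'v, 'n) cwf_map =
  FC :: "'c \<Rightarrow> 'd"
  FS :: "'c \<Rightarrow> 'c \<Rightarrow> 's \<Rightarrow> 'u"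
  FT :: "'c \<Rightarrow> 't \<Rightarrow> 'v"
  FM :: "'c \<Rightarrow> 't \<Rightarrow> 'm \<Rightarrow> 'n"
  th :: "'c \<Rightarrow> 'c \<Rightarrow> 't \<Rightarrow> 's \<Rightarrow> 'u"

definition bang_map ::
    "('c, 's, 't, 'm) cwf_data \<Rightarrow> ('d, 'u, 'v, 'n) cwf_data \<Rightarrow>
     ('c, 's, 't, 'm, 'd, 'u, 'v, 'n) cwf_map \<Rightarrow> 'u" where
  "bang_map C D F = (THE \<gamma>. \<gamma> \<in> Sub D (emp D) (FC F (emp C)))"

text \<open>\<open>rho C D F \<Gamma> A\<close> is \<open>\<rho>\<^bsub>\<Gamma>,A\<^esub> : F(\<Gamma>.A) \<rightarrow> F\<Gamma>.FA\<close>.\<close>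

definition rho ::
    "('c, 's, 't, 'm) cwf_data \<Rightarrow> ('d, 'u, 'v, 'n) cwf_data \<Rightarrow>
     ('c, 's, 't, 'm, 'd, 'u, 'v, 'n) cwf_map \<Rightarrow> 'c \<Rightarrow> 't \<Rightarrow> 'u" where
  "rho C D F \<Gamma> A =
     (let E = ext C \<Gamma> A; p = pr C \<Gamma> A; A' = tysub C E \<Gamma> A p; Fp = FS F E \<Gamma> p;
          FE = FC F E; F\<Gamma> = FC F \<Gamma>; FA = FT F \<Gamma> A; E' = ext D F\<Gamma> FA; p' = pr D F\<Gamma> FA in
      THE \<rho>. \<rho> \<in> iso_sub D FE E' \<and>
        Fp = cmp D FE E' F\<Gamma> p' \<rho> \<and>
        FM F E A' (vr C \<Gamma> A) =
          ty_app D FE (tysub D FE F\<Gamma> FA Fp) (FT F E A') (th F E \<Gamma> A p)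
            (tmsub D FE E' (tysub D E' F\<Gamma> FA p') (vr D F\<Gamma> FA) \<rho>))"

definition rho_inv ::
    "('c, 's, 't, 'm) cwf_data \<Rightarrow> ('d, 'u, 'v, 'n) cwf_data \<Rightarrow>
     ('c, 's, 't, 'm, 'd, 'u, 'v, 'n) cwf_map \<Rightarrow> 'c \<Rightarrow> 't \<Rightarrow> 'u" where
  "rho_inv C D F \<Gamma> A =
     inv_sub D (FC F (ext C \<Gamma> A)) (ext D (FC F \<Gamma>) (FT F \<Gamma> A)) (rho C D F \<Gamma> A)"

text \<open>\<open>map_hom C D F \<Gamma> A B f\<close> is \<open>F\<^sub>\<Gamma>(f) = \<rho>\<^bsub>\<Gamma>,B\<^esub> \<circ> F(f) \<circ> \<rho>\<^bsub>\<Gamma>,A\<^esub>\<^sup>-\<^sup>1 : FA \<rightarrow> FB\<close>.\<close>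

definition map_hom ::
    "('c, 's, 't, 'm) cwf_data \<Rightarrow> ('d, 'u, 'v, 'n) cwf_data \<Rightarrow>
     ('c, 's, 't, 'm, 'd, 'u, 'v, 'n) cwf_map \<Rightarrow> 'c \<Rightarrow> 't \<Rightarrow> 't \<Rightarrow> 's \<Rightarrow> 'u" where
  "map_hom C D F \<Gamma> A B f =
     (let EA = ext C \<Gamma> A; EB = ext C \<Gamma> B;
          EA' = ext D (FC F \<Gamma>) (FT F \<Gamma> A); EB' = ext D (FC F \<Gamma>) (FT F \<Gamma> B) in
      cmp D EA' (FC F EB) EB' (rho C D F \<Gamma> B)
        (cmp D EA' (FC F EA) (FC F EB) (FS F EA EB f) (rho_inv C D F \<Gamma> A)))"

locale pseudo_cwf_morphism = source: cwf C + target: cwf D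
  for C :: "('c, 's, 't, 'm) cwf_data"
    and D :: "('d, 'u, 'v, 'n) cwf_data" +
  fixes F :: "('c, 's, 't, 'm, 'd, 'u, 'v, 'n) cwf_map"
  assumes FC_in: "\<Gamma> \<in> Ctx C \<Longrightarrow> FC F \<Gamma> \<in> Ctx D"
    and FS_in: "\<lbrakk>\<Delta> \<in> Ctx C; \<Gamma> \<in> Ctx C; \<gamma> \<in> Sub C \<Delta> \<Gamma>\<rbrakk>
      \<Longrightarrow> FS F \<Delta> \<Gamma> \<gamma> \<in> Sub D (FC F \<Delta>) (FC F \<Gamma>)"
    and FS_idn: "\<Gamma> \<in> Ctx C \<Longrightarrow> FS F \<Gamma> \<Gamma> (idn C \<Gamma>) = idn D (FC F \<Gamma>)"
    and FS_cmp: "\<lbrakk>\<Xi> \<in> Ctx C; \<Delta> \<in> Ctx C; \<Gamma> \<in> Ctx C; \<delta> \<in> Sub C \<Xi> \<Delta>; \<gamma> \<in> Sub C \<Delta> \<Gamma>\<rbrakk>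
      \<Longrightarrow> FS F \<Xi> \<Gamma> (cmp C \<Xi> \<Delta> \<Gamma> \<gamma> \<delta>)
            = cmp D (FC F \<Xi>) (FC F \<Delta>) (FC F \<Gamma>) (FS F \<Delta> \<Gamma> \<gamma>) (FS F \<Xi> \<Delta> \<delta>)"
    and FT_in: "\<lbrakk>\<Gamma> \<in> Ctx C; A \<in> Ty C \<Gamma>\<rbrakk> \<Longrightarrow> FT F \<Gamma> A \<in> Ty D (FC F \<Gamma>)"
    and FM_in: "\<lbrakk>\<Gamma> \<in> Ctx C; A \<in> Ty C \<Gamma>; a \<in> Tm C \<Gamma> A\<rbrakk>
      \<Longrightarrow> FM F \<Gamma> A a \<in> Tm D (FC F \<Gamma>) (FT F \<Gamma> A)"
    and th_iso: "\<lbrakk>\<Delta> \<in> Ctx C; \<Gamma> \<in> Ctx C; \<gamma> \<in> Sub C \<Delta> \<Gamma>; A \<in> Ty C \<Gamma>\<rbrakk>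
      \<Longrightarrow> th F \<Delta> \<Gamma> A \<gamma> \<in> ty_iso D (FC F \<Delta>)
            (tysub D (FC F \<Delta>) (FC F \<Gamma>) (FT F \<Gamma> A) (FS F \<Delta> \<Gamma> \<gamma>))
            (FT F \<Delta> (tysub C \<Delta> \<Gamma> A \<gamma>))"
    and FM_tmsub: "\<lbrakk>\<Delta> \<in> Ctx C; \<Gamma> \<in> Ctx C; \<gamma> \<in> Sub C \<Delta> \<Gamma>; A \<in> Ty C \<Gamma>; a \<in> Tm C \<Gamma> A\<rbrakk>
      \<Longrightarrow> FM F \<Delta> (tysub C \<Delta> \<Gamma> A \<gamma>) (tmsub C \<Delta> \<Gamma> A a \<gamma>)
            = ty_app D (FC F \<Delta>)
                (tysub D (FC F \<Delta>) (FC F \<Gamma>) (FT F \<Gamma> A) (FS F \<Delta> \<Gamma> \<gamma>))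
                (FT F \<Delta> (tysub C \<Delta> \<Gamma> A \<gamma>))
                (th F \<Delta> \<Gamma> A \<gamma>)
                (tmsub D (FC F \<Delta>) (FC F \<Gamma>) (FT F \<Gamma> A) (FM F \<Gamma> A a) (FS F \<Delta> \<Gamma> \<gamma>))"
    and FC_terminal: "terminal D (FC F (emp C))"
    and FC_comprehension: "\<lbrakk>\<Gamma> \<in> Ctx C; A \<in> Ty C \<Gamma>;
        E = ext C \<Gamma> A; p = pr C \<Gamma> A; A' = tysub C E \<Gamma> A p\<rbrakk>
      \<Longrightarrow> comprehension D (FC F \<Gamma>) (FT F \<Gamma> A) (FC F E) (FS F E \<Gamma> p)
            (ty_app D (FC F E)
               (FT F E A')
               (tysub D (FC F E) (FC F \<Gamma>) (FT F \<Gamma> A) (FS F E \<Gamma> p))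
               (ty_inv D (FC F E)
                  (tysub D (FC F E) (FC F \<Gamma>) (FT F \<Gamma> A) (FS F E \<Gamma> p))
                  (FT F E A')
                  (th F E \<Gamma> A p))
               (FM F E A' (vr C \<Gamma> A)))"
    and th_idn: "\<lbrakk>\<Gamma> \<in> Ctx C; A \<in> Ty C \<Gamma>\<rbrakk>
      \<Longrightarrow> th F \<Gamma> \<Gamma> A (idn C \<Gamma>) = idn D (ext D (FC F \<Gamma>) (FT F \<Gamma> A))"
    and th_cmp: "\<lbrakk>\<Xi> \<in> Ctx C; \<Delta> \<in> Ctx C; \<Gamma> \<in> Ctx C;
        \<delta> \<in> Sub C \<Xi> \<Delta>; \<gamma> \<in> Sub C \<Delta> \<Gamma>; A \<in> Ty C \<Gamma>;
        A\<gamma> = tysub C \<Delta> \<Gamma> A \<gamma>;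
        FA\<gamma> = tysub D (FC F \<Delta>) (FC F \<Gamma>) (FT F \<Gamma> A) (FS F \<Delta> \<Gamma> \<gamma>)\<rbrakk>
      \<Longrightarrow> th F \<Xi> \<Gamma> A (cmp C \<Xi> \<Delta> \<Gamma> \<gamma> \<delta>)
            = ty_cmp D (FC F \<Xi>)
                (tysub D (FC F \<Xi>) (FC F \<Delta>) FA\<gamma> (FS F \<Xi> \<Delta> \<delta>))
                (tysub D (FC F \<Xi>) (FC F \<Delta>) (FT F \<Delta> A\<gamma>) (FS F \<Xi> \<Delta> \<delta>))
                (FT F \<Xi> (tysub C \<Xi> \<Delta> A\<gamma> \<delta>))
                (th F \<Xi> \<Delta> A\<gamma> \<delta>)
                (ty_reindex D (FC F \<Xi>) (FC F \<Delta>) FA\<gamma> (FT F \<Delta> A\<gamma>)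
                   (FS F \<Xi> \<Delta> \<delta>) (th F \<Delta> \<Gamma> A \<gamma>))"
    and th_natural: "\<lbrakk>\<Delta> \<in> Ctx C; \<Gamma> \<in> Ctx C; \<delta> \<in> Sub C \<Delta> \<Gamma>; A \<in> Ty C \<Gamma>; B \<in> Ty C \<Gamma>;
        f \<in> ty_hom C \<Gamma> A B;
        A\<delta> = tysub C \<Delta> \<Gamma> A \<delta>; B\<delta> = tysub C \<Delta> \<Gamma> B \<delta>;
        FA\<delta> = tysub D (FC F \<Delta>) (FC F \<Gamma>) (FT F \<Gamma> A) (FS F \<Delta> \<Gamma> \<delta>);
        FB\<delta> = tysub D (FC F \<Delta>) (FC F \<Gamma>) (FT F \<Gamma> B) (FS F \<Delta> \<Gamma> \<delta>)\<rbrakk>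
      \<Longrightarrow> ty_cmp D (FC F \<Delta>) FA\<delta> (FT F \<Delta> A\<delta>) (FT F \<Delta> B\<delta>)
              (map_hom C D F \<Delta> A\<delta> B\<delta> (ty_reindex C \<Delta> \<Gamma> A B \<delta> f))
              (th F \<Delta> \<Gamma> A \<delta>)
            = ty_cmp D (FC F \<Delta>) FA\<delta> FB\<delta> (FT F \<Delta> B\<delta>)
              (th F \<Delta> \<Gamma> B \<delta>)
              (ty_reindex D (FC F \<Delta>) (FC F \<Gamma>) (FT F \<Gamma> A) (FT F \<Gamma> B)
                 (FS F \<Delta> \<Gamma> \<delta>) (map_hom C D F \<Gamma> A B f))"


section \<open>Pseudo cwf-transformations\<close>

text \<open>
  The components are extensional families (undefined outside the indexing sets), so that
  equality of the pairs \<open>(\<phi>, \<psi>)\<close> is equality of transformations.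
\<close>

definition pseudo_cwf_transformation ::
    "('c, 's, 't, 'm) cwf_data \<Rightarrow> ('d, 'u, 'v, 'n) cwf_data \<Rightarrow>
     ('c, 's, 't, 'm, 'd, 'u, 'v, 'n) cwf_map \<Rightarrow> ('c, 's, 't, 'm, 'd, 'u, 'v, 'n) cwf_map \<Rightarrow>
     ('c \<Rightarrow> 'u) \<Rightarrow> ('c \<Rightarrow> 't \<Rightarrow> 'u) \<Rightarrow> bool" where
  "pseudo_cwf_transformation C D F G \<phi> \<psi> \<longleftrightarrow>
     \<phi> \<in> (\<Pi>\<^sub>E \<Gamma>\<in>Ctx C. Sub D (FC F \<Gamma>) (FC G \<Gamma>)) \<and>
     (\<forall>\<Delta>\<in>Ctx C. \<forall>\<Gamma>\<in>Ctx C. \<forall>\<gamma>\<in>Sub C \<Delta> \<Gamma>.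
        cmp D (FC F \<Delta>) (FC F \<Gamma>) (FC G \<Gamma>) (\<phi> \<Gamma>) (FS F \<Delta> \<Gamma> \<gamma>)
          = cmp D (FC F \<Delta>) (FC G \<Delta>) (FC G \<Gamma>) (FS G \<Delta> \<Gamma> \<gamma>) (\<phi> \<Delta>)) \<and>
     \<psi> \<in> (\<Pi>\<^sub>E \<Gamma>\<in>Ctx C. \<Pi>\<^sub>E A\<in>Ty C \<Gamma>.
            ty_iso D (FC F \<Gamma>) (FT F \<Gamma> A) (tysub D (FC F \<Gamma>) (FC G \<Gamma>) (FT G \<Gamma> A) (\<phi> \<Gamma>))) \<and>
     (\<forall>\<Gamma>\<in>Ctx C. \<forall>A\<in>Ty C \<Gamma>.
        let F\<Gamma> = FC F \<Gamma>; G\<Gamma> = FC G \<Gamma>; FA = FT F \<Gamma> A; GA = FT G \<Gamma> A;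
            FE = FC F (ext C \<Gamma> A); GE = FC G (ext C \<Gamma> A);
            EF = ext D F\<Gamma> FA; EG = ext D G\<Gamma> GA;
            EM = ext D F\<Gamma> (tysub D F\<Gamma> G\<Gamma> GA (\<phi> \<Gamma>))
        in \<phi> (ext C \<Gamma> A) =
             cmp D FE EG GE (rho_inv C D G \<Gamma> A)
               (cmp D FE EM EG (lift D F\<Gamma> G\<Gamma> GA (\<phi> \<Gamma>))
                 (cmp D FE EF EM (\<psi> \<Gamma> A) (rho C D F \<Gamma> A))))"


section \<open>The 2-category of cwfs with a base type\<close>

type_synonym ('c, 's, 't, 'm) cwfo = "('c, 's, 't, 'm) cwf_data \<times> 't"

definition cwfo_obj :: "('c, 's, 't, 'm) cwfo set" where
  "cwfo_obj = {(C, oC). cwf C \<and> oC \<in> Ty C (emp C)}"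

text \<open>\<open>base_image C oC D F\<close> is \<open>F(o\<^sub>C)[!\<^sub>F]\<close>, a type over the terminal context of \<open>D\<close>.\<close>

definition base_image ::
    "('c, 's, 't, 'm) cwf_data \<Rightarrow> 't \<Rightarrow> ('d, 'u, 'v, 'n) cwf_data \<Rightarrow>
     ('c, 's, 't, 'm, 'd, 'u, 'v, 'n) cwf_map \<Rightarrow> 'v" where
  "base_image C oC D F =
     tysub D (emp D) (FC F (emp C)) (FT F (emp C) oC) (bang_map C D F)"

definition cwfo_arr ::
    "('c, 's, 't, 'm) cwfo \<Rightarrow> ('d, 'u, 'v, 'n) cwfo \<Rightarrow>
     (('c, 's, 't, 'm, 'd, 'u, 'v, 'n) cwf_map \<times> 'u) set" where
  "cwfo_arr = (\<lambda>(C, oC) (D, oD).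
     {(F, \<alpha>). pseudo_cwf_morphism C D F \<and> \<alpha> \<in> ty_iso D (emp D) (base_image C oC D F) oD})"

definition cwfo_cell ::
    "('c, 's, 't, 'm) cwfo \<Rightarrow> ('d, 'u, 'v, 'n) cwfo \<Rightarrow>
     ('c, 's, 't, 'm, 'd, 'u, 'v, 'n) cwf_map \<times> 'u \<Rightarrow>
     ('c, 's, 't, 'm, 'd, 'u, 'v, 'n) cwf_map \<times> 'u \<Rightarrow>
     (('c \<Rightarrow> 'u) \<times> ('c \<Rightarrow> 't \<Rightarrow> 'u)) set" where
  "cwfo_cell = (\<lambda>(C, oC) (D, oD) (F, \<alpha>) (G, \<beta>).
     {(\<phi>, \<psi>). pseudo_cwf_transformation C D F G \<phi> \<psi> \<and>
        ty_reindex D (emp D) (FC F (emp C))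
            (FT F (emp C) oC)
            (tysub D (FC F (emp C)) (FC G (emp C)) (FT G (emp C) oC) (\<phi> (emp C)))
            (bang_map C D F) (\<psi> (emp C) oC)
          = ty_cmp D (emp D) (base_image C oC D F) oD (base_image C oC D G)
              (ty_inv D (emp D) (base_image C oC D G) oD \<beta>) \<alpha>})"

text \<open>
  Bi-initiality refers only to the objects, arrows and 2-cells of a 2-category, not to its
  compositions. The object \<open>I\<close> has a type of its own, so that it can be compared with
  objects whose underlying sets live in arbitrary types.
\<close>

definition bi_initial ::
    "'x set \<Rightarrow> ('i \<Rightarrow> 'x \<Rightarrow> 'f set) \<Rightarrow> ('i \<Rightarrow> 'x \<Rightarrow> 'f \<Rightarrow> 'f \<Rightarrow> 'k set) \<Rightarrow> 'i \<Rightarrow> bool" where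
  "bi_initial Obj Arr Cell I \<longleftrightarrow>
     (\<forall>X\<in>Obj. (\<exists>f. f \<in> Arr I X) \<and>
        (\<forall>f\<in>Arr I X. \<forall>g\<in>Arr I X. \<exists>!c. c \<in> Cell I X f g))"


section \<open>Raw syntax and judgments\<close>

text \<open>\<open>SPair \<gamma> a A\<close> is \<open>\<langle>\<gamma>, a\<rangle>\<^sub>A\<close>.\<close>

datatype rctx = CEmp | CExt rctx rty
  and rsub = SComp rsub rsub | SId rctx | SBang rctx | SP rty | SPair rsub rtm rty
  and rty = TBase | TSub rty rsub
  and rtm = MSub rtm rsub | MQ rty

inductive
    ctx_eq :: "rctx \<Rightarrow> rctx \<Rightarrow> bool" ("\<turnstile>\<^sub>c _ \<approx> _" [60, 60] 50)
  and sub_eq :: "rctx \<Rightarrow> rsub \<Rightarrow> rsub \<Rightarrow> rctx \<Rightarrow> bool" ("_ \<turnstile>\<^sub>s _ \<approx> _ : _" [60, 60, 60, 60] 50)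
  and ty_eq :: "rctx \<Rightarrow> rty \<Rightarrow> rty \<Rightarrow> bool" ("_ \<turnstile>\<^sub>t _ \<approx> _" [60, 60, 60] 50)
  and tm_eq :: "rctx \<Rightarrow> rtm \<Rightarrow> rtm \<Rightarrow> rty \<Rightarrow> bool" ("_ \<turnstile>\<^sub>m _ \<approx> _ : _" [60, 60, 60, 60] 50)
where
  ctx_sym: "\<turnstile>\<^sub>c \<Gamma> \<approx> \<Gamma>' \<Longrightarrow> \<turnstile>\<^sub>c \<Gamma>' \<approx> \<Gamma>"
| ctx_trans: "\<lbrakk>\<turnstile>\<^sub>c \<Gamma> \<approx> \<Gamma>'; \<turnstile>\<^sub>c \<Gamma>' \<approx> \<Gamma>''\<rbrakk> \<Longrightarrow> \<turnstile>\<^sub>c \<Gamma> \<approx> \<Gamma>''"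
| sub_sym: "\<Delta> \<turnstile>\<^sub>s \<gamma> \<approx> \<gamma>' : \<Gamma> \<Longrightarrow> \<Delta> \<turnstile>\<^sub>s \<gamma>' \<approx> \<gamma> : \<Gamma>"
| sub_trans: "\<lbrakk>\<Delta> \<turnstile>\<^sub>s \<gamma> \<approx> \<gamma>' : \<Gamma>; \<Delta> \<turnstile>\<^sub>s \<gamma>' \<approx> \<gamma>'' : \<Gamma>\<rbrakk> \<Longrightarrow> \<Delta> \<turnstile>\<^sub>s \<gamma> \<approx> \<gamma>'' : \<Gamma>"
| ty_sym: "\<Gamma> \<turnstile>\<^sub>t A \<approx> A' \<Longrightarrow> \<Gamma> \<turnstile>\<^sub>t A' \<approx> A"
| ty_trans: "\<lbrakk>\<Gamma> \<turnstile>\<^sub>t A \<approx> A'; \<Gamma> \<turnstile>\<^sub>t A' \<approx> A''\<rbrakk> \<Longrightarrow> \<Gamma> \<turnstile>\<^sub>t A \<approx> A''"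
| tm_sym: "\<Gamma> \<turnstile>\<^sub>m a \<approx> a' : A \<Longrightarrow> \<Gamma> \<turnstile>\<^sub>m a' \<approx> a : A"
| tm_trans: "\<lbrakk>\<Gamma> \<turnstile>\<^sub>m a \<approx> a' : A; \<Gamma> \<turnstile>\<^sub>m a' \<approx> a'' : A\<rbrakk> \<Longrightarrow> \<Gamma> \<turnstile>\<^sub>m a \<approx> a'' : A"

| sub_pres: "\<lbrakk>\<turnstile>\<^sub>c \<Gamma> \<approx> \<Gamma>'; \<turnstile>\<^sub>c \<Delta> \<approx> \<Delta>'; \<Gamma> \<turnstile>\<^sub>s \<gamma> \<approx> \<gamma>' : \<Delta>\<rbrakk> \<Longrightarrow> \<Gamma>' \<turnstile>\<^sub>s \<gamma> \<approx> \<gamma>' : \<Delta>'"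
| ty_pres: "\<lbrakk>\<turnstile>\<^sub>c \<Gamma> \<approx> \<Gamma>'; \<Gamma> \<turnstile>\<^sub>t A \<approx> A'\<rbrakk> \<Longrightarrow> \<Gamma>' \<turnstile>\<^sub>t A \<approx> A'"
| tm_pres: "\<lbrakk>\<turnstile>\<^sub>c \<Gamma> \<approx> \<Gamma>'; \<Gamma> \<turnstile>\<^sub>t A \<approx> A'; \<Gamma> \<turnstile>\<^sub>m a \<approx> a' : A\<rbrakk> \<Longrightarrow> \<Gamma>' \<turnstile>\<^sub>m a \<approx> a' : A'"

| emp_cong: "\<turnstile>\<^sub>c CEmp \<approx> CEmp"
| base_cong: "CEmp \<turnstile>\<^sub>t TBase \<approx> TBase"
| ext_cong: "\<lbrakk>\<turnstile>\<^sub>c \<Gamma> \<approx> \<Gamma>'; \<Gamma> \<turnstile>\<^sub>t A \<approx> A'\<rbrakk> \<Longrightarrow> \<turnstile>\<^sub>c CExt \<Gamma> A \<approx> CExt \<Gamma>' A'"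
| tsub_cong: "\<lbrakk>\<Gamma> \<turnstile>\<^sub>t A \<approx> A'; \<Delta> \<turnstile>\<^sub>s \<gamma> \<approx> \<gamma>' : \<Gamma>\<rbrakk> \<Longrightarrow> \<Delta> \<turnstile>\<^sub>t TSub A \<gamma> \<approx> TSub A' \<gamma>'"
| id_cong: "\<turnstile>\<^sub>c \<Gamma> \<approx> \<Gamma>' \<Longrightarrow> \<Gamma> \<turnstile>\<^sub>s SId \<Gamma> \<approx> SId \<Gamma>' : \<Gamma>"
| bang_cong: "\<turnstile>\<^sub>c \<Gamma> \<approx> \<Gamma>' \<Longrightarrow> \<Gamma> \<turnstile>\<^sub>s SBang \<Gamma> \<approx> SBang \<Gamma>' : CEmp"
| comp_cong: "\<lbrakk>\<Gamma> \<turnstile>\<^sub>s \<delta> \<approx> \<delta>' : \<Delta>; \<Delta> \<turnstile>\<^sub>s \<gamma> \<approx> \<gamma>' : \<Theta>\<rbrakk>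
    \<Longrightarrow> \<Gamma> \<turnstile>\<^sub>s SComp \<gamma> \<delta> \<approx> SComp \<gamma>' \<delta>' : \<Theta>"
| p_cong: "\<Gamma> \<turnstile>\<^sub>t A \<approx> A' \<Longrightarrow> CExt \<Gamma> A \<turnstile>\<^sub>s SP A \<approx> SP A' : \<Gamma>"
| q_cong: "\<Gamma> \<turnstile>\<^sub>t A \<approx> A' \<Longrightarrow> CExt \<Gamma> A \<turnstile>\<^sub>m MQ A \<approx> MQ A' : TSub A (SP A)"
| pair_cong: "\<lbrakk>\<Gamma> \<turnstile>\<^sub>t A \<approx> A'; \<Delta> \<turnstile>\<^sub>s \<gamma> \<approx> \<gamma>' : \<Gamma>; \<Delta> \<turnstile>\<^sub>m a \<approx> a' : TSub A \<gamma>\<rbrakk>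
    \<Longrightarrow> \<Delta> \<turnstile>\<^sub>s SPair \<gamma> a A \<approx> SPair \<gamma>' a' A' : CExt \<Gamma> A"
| msub_cong: "\<lbrakk>\<Gamma> \<turnstile>\<^sub>m a \<approx> a' : A; \<Delta> \<turnstile>\<^sub>s \<gamma> \<approx> \<gamma>' : \<Gamma>\<rbrakk>
    \<Longrightarrow> \<Delta> \<turnstile>\<^sub>m MSub a \<gamma> \<approx> MSub a' \<gamma>' : TSub A \<gamma>"

| comp_assoc: "\<lbrakk>\<Xi> \<turnstile>\<^sub>s \<gamma> \<approx> \<gamma> : \<Delta>; \<Delta> \<turnstile>\<^sub>s \<delta> \<approx> \<delta> : \<Gamma>; \<Gamma> \<turnstile>\<^sub>s \<theta> \<approx> \<theta> : \<Theta>\<rbrakk>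
    \<Longrightarrow> \<Xi> \<turnstile>\<^sub>s SComp (SComp \<theta> \<delta>) \<gamma> \<approx> SComp \<theta> (SComp \<delta> \<gamma>) : \<Theta>"
| id_left: "\<Delta> \<turnstile>\<^sub>s \<gamma> \<approx> \<gamma> : \<Gamma> \<Longrightarrow> \<Delta> \<turnstile>\<^sub>s \<gamma> \<approx> SComp (SId \<Gamma>) \<gamma> : \<Gamma>"
| id_right: "\<Delta> \<turnstile>\<^sub>s \<gamma> \<approx> \<gamma> : \<Gamma> \<Longrightarrow> \<Delta> \<turnstile>\<^sub>s \<gamma> \<approx> SComp \<gamma> (SId \<Delta>) : \<Gamma>"
| tsub_comp: "\<lbrakk>\<Gamma> \<turnstile>\<^sub>t A \<approx> A; \<Delta> \<turnstile>\<^sub>s \<gamma> \<approx> \<gamma> : \<Gamma>; \<Xi> \<turnstile>\<^sub>s \<delta> \<approx> \<delta> : \<Delta>\<rbrakk>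
    \<Longrightarrow> \<Xi> \<turnstile>\<^sub>t TSub A (SComp \<gamma> \<delta>) \<approx> TSub (TSub A \<gamma>) \<delta>"
| tsub_id: "\<Gamma> \<turnstile>\<^sub>t A \<approx> A \<Longrightarrow> \<Gamma> \<turnstile>\<^sub>t TSub A (SId \<Gamma>) \<approx> A"
| msub_comp: "\<lbrakk>\<Gamma> \<turnstile>\<^sub>m a \<approx> a : A; \<Delta> \<turnstile>\<^sub>s \<gamma> \<approx> \<gamma> : \<Gamma>; \<Xi> \<turnstile>\<^sub>s \<delta> \<approx> \<delta> : \<Delta>\<rbrakk>
    \<Longrightarrow> \<Xi> \<turnstile>\<^sub>m MSub a (SComp \<gamma> \<delta>) \<approx> MSub (MSub a \<gamma>) \<delta> : TSub A (SComp \<gamma> \<delta>)"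
| msub_id: "\<Gamma> \<turnstile>\<^sub>m a \<approx> a : A \<Longrightarrow> \<Gamma> \<turnstile>\<^sub>m MSub a (SId \<Gamma>) \<approx> a : A"
| bang_eta: "\<Gamma> \<turnstile>\<^sub>s \<gamma> \<approx> \<gamma> : CEmp \<Longrightarrow> \<Gamma> \<turnstile>\<^sub>s \<gamma> \<approx> SBang \<Gamma> : CEmp"
| p_pair: "\<lbrakk>\<Gamma> \<turnstile>\<^sub>t A \<approx> A; \<Delta> \<turnstile>\<^sub>s \<gamma> \<approx> \<gamma> : \<Gamma>; \<Delta> \<turnstile>\<^sub>m a \<approx> a : TSub A \<gamma>\<rbrakk>
    \<Longrightarrow> \<Delta> \<turnstile>\<^sub>s SComp (SP A) (SPair \<gamma> a A) \<approx> \<gamma> : \<Gamma>"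
| q_pair: "\<lbrakk>\<Gamma> \<turnstile>\<^sub>t A \<approx> A; \<Delta> \<turnstile>\<^sub>s \<gamma> \<approx> \<gamma> : \<Gamma>; \<Delta> \<turnstile>\<^sub>m a \<approx> a : TSub A \<gamma>\<rbrakk>
    \<Longrightarrow> \<Delta> \<turnstile>\<^sub>m MSub (MQ A) (SPair \<gamma> a A) \<approx> a : TSub A \<gamma>"
| pair_eta: "\<lbrakk>\<Gamma> \<turnstile>\<^sub>t A \<approx> A; \<Delta> \<turnstile>\<^sub>s \<gamma> \<approx> \<gamma> : CExt \<Gamma> A\<rbrakk>
    \<Longrightarrow> \<Delta> \<turnstile>\<^sub>s \<gamma> \<approx> SPair (SComp (SP A) \<gamma>) (MSub (MQ A) \<gamma>) A : CExt \<Gamma> A"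


section \<open>The syntactic cwf\<close>

text \<open>
  Derivable equality as relations on raw expressions, indexed by equivalence classes
  \<open>X, Y\<close> of contexts and \<open>T\<close> of types. By preservation, the choice of representatives of the
  indices is immaterial. The carriers are the quotients of the domains of reflexivity.
\<close>

definition ctx_rel :: "(rctx \<times> rctx) set" where
  "ctx_rel = {(\<Gamma>, \<Gamma>'). \<turnstile>\<^sub>c \<Gamma> \<approx> \<Gamma>'}"

definition sub_rel :: "rctx set \<Rightarrow> rctx set \<Rightarrow> (rsub \<times> rsub) set" where
  "sub_rel X Y = {(\<gamma>, \<gamma>'). \<exists>\<Delta>\<in>X. \<exists>\<Gamma>\<in>Y. \<Delta> \<turnstile>\<^sub>s \<gamma> \<approx> \<gamma>' : \<Gamma>}"

definition ty_rel :: "rctx set \<Rightarrow> (rty \<times> rty) set" where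
  "ty_rel X = {(A, A'). \<exists>\<Gamma>\<in>X. \<Gamma> \<turnstile>\<^sub>t A \<approx> A'}"

definition tm_rel :: "rctx set \<Rightarrow> rty set \<Rightarrow> (rtm \<times> rtm) set" where
  "tm_rel X T = {(a, a'). \<exists>\<Gamma>\<in>X. \<exists>A\<in>T. \<Gamma> \<turnstile>\<^sub>m a \<approx> a' : A}"

definition per_quotient :: "('a \<times> 'a) set \<Rightarrow> 'a set set" where
  "per_quotient R = {x. (x, x) \<in> R} // R"

text \<open>
  Each operation takes the saturation, under derivable equality, of the set of raw expressions
  obtained by applying the constructor to all representatives of its arguments.
\<close>

definition syn_ext :: "rctx set \<Rightarrow> rty set \<Rightarrow> rctx set" where
  "syn_ext X T = ctx_rel `` {CExt \<Gamma> A |\<Gamma> A. \<Gamma> \<in> X \<and> A \<in> T}"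

definition syn_tysub :: "rctx set \<Rightarrow> rctx set \<Rightarrow> rty set \<Rightarrow> rsub set \<Rightarrow> rty set" where
  "syn_tysub X Y T s = ty_rel X `` {TSub A \<gamma> |A \<gamma>. A \<in> T \<and> \<gamma> \<in> s}"

definition syn_pr :: "rctx set \<Rightarrow> rty set \<Rightarrow> rsub set" where
  "syn_pr X T = sub_rel (syn_ext X T) X `` {SP A |A. A \<in> T}"

definition syn_cwf :: "(rctx set, rsub set, rty set, rtm set) cwf_data" where
  "syn_cwf = \<lparr>
     Ctx = per_quotient ctx_rel,
     Sub = (\<lambda>X Y. per_quotient (sub_rel X Y)),
     Ty = (\<lambda>X. per_quotient (ty_rel X)),
     Tm = (\<lambda>X T. per_quotient (tm_rel X T)),
     idn = (\<lambda>X. sub_rel X X `` {SId \<Gamma> |\<Gamma>. \<Gamma> \<in> X}),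
     cmp = (\<lambda>X Y Z s t. sub_rel X Z `` {SComp \<gamma> \<delta> |\<gamma> \<delta>. \<gamma> \<in> s \<and> \<delta> \<in> t}),
     tysub = syn_tysub,
     tmsub = (\<lambda>X Y T m s. tm_rel X (syn_tysub X Y T s) `` {MSub a \<gamma> |a \<gamma>. a \<in> m \<and> \<gamma> \<in> s}),
     emp = ctx_rel `` {CEmp},
     ext = syn_ext,
     pr = syn_pr,
     vr = (\<lambda>X T. tm_rel (syn_ext X T) (syn_tysub (syn_ext X T) X T (syn_pr X T)) `` {MQ A |A. A \<in> T})
   \<rparr>"

definition syn_base :: "rty set" where
  "syn_base = ty_rel (emp syn_cwf) `` {TBase}"

definition syn_cwfo :: "(rctx set, rsub set, rty set, rtm set) cwfo" where
  "syn_cwfo = (syn_cwf, syn_base)"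

end

theory Submission
  imports Defs
begin

text \<open>In a cwf the types A[\<gamma>][\<delta>] and A[\<gamma> o \<delta>] are equal on the
  nose, but a pseudo cwf-morphism preserves substitution only up to \<theta> and comprehension only
  up to \<rho>, and these isomorphisms shape the whole argument. Two devices keep them manageable.
  Each \<theta> is replaced by the bijections that it induces on terms, so that its law for
  composites becomes plain composition of maps. And \<rho> is traded for the pair F(p),
  {\<theta>^-1}(Fq), through which F(\<Gamma>.A) is itself a comprehension. Naturality threatens to
  be circular: at \<gamma> : \<Delta> -> \<Gamma>.A it needs the components at types to be
  compatible with \<theta> at p o \<gamma>, which in turn needs naturality at p o \<gamma>. The
  circle is broken because p o \<gamma> has a shorter target and because naturality at the
  projections holds by construction of the components at extended contexts. The 2-cell condition
  prescribes not the component at o but its reindexing along \<open>!_F\<close>. As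
  \<open>!_F\<close> is a map between terminal objects, it is invertible, and the component is
  recovered by reindexing along the inverse.\<close>

text \<open>
  Since \<open>A = o[\<langle>\<rangle>]\<close> is derivable for every type \<open>A\<close> over \<open>\<Gamma>\<close>, contexts up to derivable equality
  are natural numbers \<open>n\<close>, terms over \<open>n\<close> are variables \<open>i < n\<close>, and substitutions are functions
  between variables; distinct variables are told apart by reading raw expressions as such functions.
  Interpreting variables as projections gives a strict, hence pseudo, cwf-morphism into any cwf with a
  base type. Between two pseudo cwf-morphisms \<open>F\<close> and \<open>G\<close>, the component of a transformation at
  \<open>o[\<langle>\<rangle>]\<close> is forced by naturality at \<open>\<langle>\<rangle>\<^sup>+\<close> to be the one at \<open>o\<close> conjugated with the isomorphisms
  \<open>\<theta>\<close> of \<open>F\<close> and \<open>G\<close>, the one at \<open>o\<close> is prescribed, and the component at \<open>\<Gamma>.A\<close> is built from those at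
  \<open>\<Gamma>\<close> and \<open>A\<close>. Conversely these formulas define a transformation: naturality at
  \<open>\<gamma> : \<Delta> \<rightarrow> \<Gamma>.A\<close> follows by induction on the target, and reduces to naturality with respect to variables.
\<close>

section \<open>The syntax and its variables\<close>

primrec len :: "rctx \<Rightarrow> nat" where
  "len CEmp = 0"
| "len (CExt \<Gamma> A) = Suc (len \<Gamma>)"

text \<open>Variables are numbered from the last one in the context. The value at \<open>SBang\<close> is arbitrary, as the
  empty context has no variables.\<close>

primrec sub_var :: "rsub \<Rightarrow> nat \<Rightarrow> nat" and tm_var :: "rtm \<Rightarrow> nat" where
  "sub_var (SComp \<gamma> \<delta>) = sub_var \<delta> \<circ> sub_var \<gamma>"
| "sub_var (SId \<Gamma>) = id"
| "sub_var (SBang \<Gamma>) = id"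
| "sub_var (SP A) = Suc"
| "sub_var (SPair \<gamma> a A) = case_nat (tm_var a) (sub_var \<gamma>)"
| "tm_var (MSub a \<gamma>) = sub_var \<gamma> (tm_var a)"
| "tm_var (MQ A) = 0"

text \<open>The reading is contravariant: a substitution from \<Delta> to \<Gamma> sends variables
  of \<Gamma> to variables of \<Delta>. Agreement is claimed only below \<open>len \<Gamma>\<close>,
  since \<open>bang_eta\<close> identifies \<open>SBang\<close> with every substitution into the
  empty context. The bounds travel along because, in a composite, the reading applied second is
  evaluated at values of the first and is controlled only there.\<close>

lemma soundness:
  shows ctx_sound: "\<turnstile>\<^sub>c \<Gamma> \<approx> \<Gamma>' \<Longrightarrow> len \<Gamma> = len \<Gamma>'"
    and sub_sound: "\<Delta> \<turnstile>\<^sub>s \<gamma> \<approx> \<gamma>' : \<Gamma> \<Longrightarrow>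
      \<forall>i<len \<Gamma>. sub_var \<gamma> i = sub_var \<gamma>' i \<and> sub_var \<gamma> i < len \<Delta>"
    and "\<Gamma> \<turnstile>\<^sub>t A \<approx> A' \<Longrightarrow> True"
    and tm_sound: "\<Gamma> \<turnstile>\<^sub>m a \<approx> a' : A \<Longrightarrow> tm_var a = tm_var a' \<and> tm_var a < len \<Gamma>"
proof (induction rule: ctx_eq_sub_eq_ty_eq_tm_eq.inducts)
qed (auto split: nat.splits)

text \<open>Few rules ask for well-formed contexts explicitly. This is recovered here because
  \<open>SBang \<Gamma>\<close> and \<open>base_ty \<Gamma>\<close> make sense only over a
  well-formed \<Gamma>.\<close>

lemma presupposition:
  shows ctx_presup: "\<turnstile>\<^sub>c \<Gamma> \<approx> \<Gamma>' \<Longrightarrow> \<turnstile>\<^sub>c \<Gamma> \<approx> \<Gamma>"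
    and sub_presup: "\<Delta> \<turnstile>\<^sub>s \<gamma> \<approx> \<gamma>' : \<Gamma> \<Longrightarrow> \<turnstile>\<^sub>c \<Delta> \<approx> \<Delta> \<and> \<turnstile>\<^sub>c \<Gamma> \<approx> \<Gamma>"
    and ty_presup: "\<Gamma> \<turnstile>\<^sub>t A \<approx> A' \<Longrightarrow> \<turnstile>\<^sub>c \<Gamma> \<approx> \<Gamma>"
    and tm_presup: "\<Gamma> \<turnstile>\<^sub>m a \<approx> a' : A \<Longrightarrow> \<turnstile>\<^sub>c \<Gamma> \<approx> \<Gamma> \<and> \<Gamma> \<turnstile>\<^sub>t A \<approx> A"
proof (induction rule: ctx_eq_sub_eq_ty_eq_tm_eq.inducts)
qed (blast intro: ctx_eq_sub_eq_ty_eq_tm_eq.intros)+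

lemma sub_refl: "\<Delta> \<turnstile>\<^sub>s \<gamma> \<approx> \<gamma>' : \<Gamma> \<Longrightarrow> \<Delta> \<turnstile>\<^sub>s \<gamma> \<approx> \<gamma> : \<Gamma>"
  by (blast intro: sub_sym sub_trans)

lemma ty_refl: "\<Gamma> \<turnstile>\<^sub>t A \<approx> A' \<Longrightarrow> \<Gamma> \<turnstile>\<^sub>t A \<approx> A"
  by (blast intro: ty_sym ty_trans)

lemma tm_refl: "\<Gamma> \<turnstile>\<^sub>m a \<approx> a' : A \<Longrightarrow> \<Gamma> \<turnstile>\<^sub>m a \<approx> a : A"
  by (blast intro: tm_sym tm_trans)

subsection \<open>Uniqueness of types and normal forms of contexts\<close>

abbreviation base_ty :: "rctx \<Rightarrow> rty" where
  "base_ty \<Gamma> \<equiv> TSub TBase (SBang \<Gamma>)"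

lemma bang_unique:
  assumes "\<Gamma> \<turnstile>\<^sub>s \<gamma> \<approx> \<gamma> : CEmp" "\<Gamma> \<turnstile>\<^sub>s \<delta> \<approx> \<delta> : CEmp"
  shows "\<Gamma> \<turnstile>\<^sub>s \<gamma> \<approx> \<delta> : CEmp"
  by (rule sub_trans[OF bang_eta[OF assms(1)] sub_sym[OF bang_eta[OF assms(2)]]])

lemma base_ty_cong: "\<turnstile>\<^sub>c \<Gamma> \<approx> \<Gamma>' \<Longrightarrow> \<Gamma> \<turnstile>\<^sub>t base_ty \<Gamma> \<approx> base_ty \<Gamma>'"
  by (rule tsub_cong[OF base_cong bang_cong])

text \<open>o[<>][\<gamma>] = o[<> o \<gamma>] = o[<>], where the last step holds because any two
  substitutions into the empty context are equal.\<close>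

lemma tsub_base:
  assumes "\<Gamma> \<turnstile>\<^sub>t A \<approx> base_ty \<Gamma>" "\<Delta> \<turnstile>\<^sub>s \<gamma> \<approx> \<gamma> : \<Gamma>"
  shows "\<Delta> \<turnstile>\<^sub>t TSub A \<gamma> \<approx> base_ty \<Delta>"
proof -
  have bangs: "\<Gamma> \<turnstile>\<^sub>s SBang \<Gamma> \<approx> SBang \<Gamma> : CEmp" "\<Delta> \<turnstile>\<^sub>s SBang \<Delta> \<approx> SBang \<Delta> : CEmp"
    using sub_presup[OF assms(2)] by (blast intro: bang_cong)+
  have "\<Delta> \<turnstile>\<^sub>t TSub A \<gamma> \<approx> TSub (base_ty \<Gamma>) \<gamma>"
    using assms by (rule tsub_cong)
  moreover have "\<Delta> \<turnstile>\<^sub>t TSub TBase (SComp (SBang \<Gamma>) \<gamma>) \<approx> TSub (base_ty \<Gamma>) \<gamma>"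
    using bangs assms(2) by (blast intro: tsub_comp base_cong)
  moreover have "\<Delta> \<turnstile>\<^sub>t TSub TBase (SComp (SBang \<Gamma>) \<gamma>) \<approx> base_ty \<Delta>"
    using bangs assms(2) by (meson tsub_cong base_cong bang_unique comp_cong)
  ultimately show ?thesis
    by (blast intro: ty_sym ty_trans)
qed

text \<open>Besides \<open>TBase\<close> the only type former is substitution, which
  \<open>tsub_base\<close> handles, so types carry no information beyond their context.\<close>

lemma ty_base: "\<Gamma> \<turnstile>\<^sub>t A \<approx> A' \<Longrightarrow> \<Gamma> \<turnstile>\<^sub>t A \<approx> base_ty \<Gamma>"
\<comment> \<open>Of the substitutions inside a type only well-typedness matters, so the other three
  judgments are given trivial predicates.\<close>
proof (induction rule: ctx_eq_sub_eq_ty_eq_tm_eq.inducts(3)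
    [where ?P1.0 = "\<lambda>_ _. True" and ?P2.0 = "\<lambda>_ _ _ _. True" and ?P4.0 = "\<lambda>_ _ _ _. True"])
  case (ty_pres \<Gamma> \<Gamma>' A A')
  then show ?case
    by (meson base_ty_cong ctx_eq_sub_eq_ty_eq_tm_eq.ty_pres ty_trans)
next
  case base_cong
  \<comment> \<open>Over the empty context o = o[id] and id = <>, so even o itself has the form
    o[<>].\<close>
  have "CEmp \<turnstile>\<^sub>s SId CEmp \<approx> SBang CEmp : CEmp"
    by (blast intro: emp_cong bang_eta id_cong)
  then have "CEmp \<turnstile>\<^sub>t TSub TBase (SId CEmp) \<approx> base_ty CEmp"
    by (blast intro: tsub_cong ctx_eq_sub_eq_ty_eq_tm_eq.base_cong)
  then show ?case
    by (meson ctx_eq_sub_eq_ty_eq_tm_eq.base_cong tsub_id ty_sym ty_trans)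
next
  case (tsub_cong \<Gamma> A A' \<Delta> \<gamma> \<gamma>')
  then show ?case
    by (meson tsub_base sub_refl)
next
  case (tsub_comp \<Gamma> A \<Delta> \<gamma> \<Xi> \<delta>)
  then show ?case
    by (meson tsub_base comp_cong)
next
  case (tsub_id \<Gamma> A)
  then show ?case
    by (meson tsub_base id_cong ty_presup)
qed (blast intro: ty_trans ty_sym)+

lemma ty_unique: "\<lbrakk>\<Gamma> \<turnstile>\<^sub>t A \<approx> A; \<Gamma> \<turnstile>\<^sub>t B \<approx> B\<rbrakk> \<Longrightarrow> \<Gamma> \<turnstile>\<^sub>t A \<approx> B"
  by (rule ty_trans[OF ty_base ty_sym[OF ty_base]])

text \<open>As all types over one context are equal, the type annotation of a term may be exchanged
  at will. This removes types from all the normal form arguments below.\<close>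

lemma tm_conv:
  "\<lbrakk>\<Gamma> \<turnstile>\<^sub>m a \<approx> a' : A; \<turnstile>\<^sub>c \<Gamma> \<approx> \<Gamma>'; \<Gamma>' \<turnstile>\<^sub>t B \<approx> B\<rbrakk> \<Longrightarrow> \<Gamma>' \<turnstile>\<^sub>m a \<approx> a' : B"
  by (meson ctx_sym tm_pres tm_presup ty_pres ty_unique)

primrec nf_ctx :: "nat \<Rightarrow> rctx" where
  "nf_ctx 0 = CEmp"
| "nf_ctx (Suc n) = CExt (nf_ctx n) (base_ty (nf_ctx n))"

abbreviation nf_ty :: "nat \<Rightarrow> rty" where
  "nf_ty n \<equiv> base_ty (nf_ctx n)"

lemma len_nf_ctx [simp]: "len (nf_ctx n) = n"
  by (induction n) auto

lemma nf_ctx_wf: "\<turnstile>\<^sub>c nf_ctx n \<approx> nf_ctx n"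
  by (induction n) (auto intro: emp_cong ext_cong base_ty_cong)

lemma nf_ty_wf: "nf_ctx n \<turnstile>\<^sub>t nf_ty n \<approx> nf_ty n"
  by (rule base_ty_cong[OF nf_ctx_wf])

text \<open>By \<open>ty_base\<close> every extension adds the same type, so only the number of
  extensions survives.\<close>

lemma ctx_nf: "\<turnstile>\<^sub>c \<Gamma> \<approx> \<Gamma>' \<Longrightarrow> \<turnstile>\<^sub>c \<Gamma> \<approx> nf_ctx (len \<Gamma>)"
proof (induction rule: ctx_eq_sub_eq_ty_eq_tm_eq.inducts(1)
    [where ?P2.0 = "\<lambda>_ _ _ _. True" and ?P3.0 = "\<lambda>_ _ _. True" and ?P4.0 = "\<lambda>_ _ _ _. True"])
  case (ctx_sym \<Gamma> \<Gamma>')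
  then show ?case
    by (metis ctx_eq_sub_eq_ty_eq_tm_eq.ctx_sym ctx_trans ctx_sound)
next
  case emp_cong
  then show ?case
    by (simp add: ctx_eq_sub_eq_ty_eq_tm_eq.emp_cong)
next
  case (ext_cong \<Gamma> \<Gamma>' A A')
  then have "\<Gamma> \<turnstile>\<^sub>t A \<approx> base_ty (nf_ctx (len \<Gamma>))"
    by (meson base_ty_cong ty_base ty_trans)
  then show ?case
    using ext_cong by (simp add: ctx_eq_sub_eq_ty_eq_tm_eq.ext_cong)
qed auto

subsection \<open>Normal forms of terms and substitutions\<close>

text \<open>De Bruijn index i over a context of length n: \<open>MQ\<close> weakened i times. The
  value at length 0 is a filler, as the empty context has no variables.\<close>

fun nf_tm :: "nat \<Rightarrow> nat \<Rightarrow> rtm" where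
  "nf_tm 0 i = undefined"
| "nf_tm (Suc n) 0 = MQ (nf_ty n)"
| "nf_tm (Suc n) (Suc i) = MSub (nf_tm n i) (SP (nf_ty n))"

lemma nf_p: "nf_ctx (Suc n) \<turnstile>\<^sub>s SP (nf_ty n) \<approx> SP (nf_ty n) : nf_ctx n"
  unfolding nf_ctx.simps by (intro p_cong nf_ty_wf)

lemma nf_tm_wf: "i < n \<Longrightarrow> nf_ctx n \<turnstile>\<^sub>m nf_tm n i \<approx> nf_tm n i : nf_ty n"
proof (induction n i rule: nf_tm.induct)
  case (2 n)
  then show ?case
    using tm_conv q_cong[OF nf_ty_wf] nf_ctx_wf nf_ty_wf
    by (metis nf_ctx.simps(2) nf_tm.simps(2))
next
  case (3 n i)
  then have "nf_ctx (Suc n) \<turnstile>\<^sub>m nf_tm (Suc n) (Suc i) \<approx> nf_tm (Suc n) (Suc i) : TSub (nf_ty n) (SP (nf_ty n))"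
    using msub_cong nf_p by simp
  then show ?case
    using nf_ctx_wf nf_ty_wf tm_conv by blast
qed auto

lemma tm_var_nf_tm [simp]: "i < n \<Longrightarrow> tm_var (nf_tm n i) = i"
  by (induction n i rule: nf_tm.induct) auto

lemma nf_tm_in: "\<lbrakk>i < len \<Gamma>; \<Gamma> \<turnstile>\<^sub>t A \<approx> A\<rbrakk> \<Longrightarrow> \<Gamma> \<turnstile>\<^sub>m nf_tm (len \<Gamma>) i \<approx> nf_tm (len \<Gamma>) i : A"
  by (meson ctx_nf ctx_sym nf_tm_wf tm_conv ty_presup)

lemma tm_trans': "\<lbrakk>\<Gamma> \<turnstile>\<^sub>m a \<approx> b : A; \<Gamma> \<turnstile>\<^sub>m b \<approx> c : B\<rbrakk> \<Longrightarrow> \<Gamma> \<turnstile>\<^sub>m a \<approx> c : A"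
  by (meson tm_conv tm_presup tm_trans)

abbreviation tm_nf :: "rctx \<Rightarrow> rtm \<Rightarrow> nat \<Rightarrow> bool" where
  "tm_nf \<Gamma> a i \<equiv> \<Gamma> \<turnstile>\<^sub>m a \<approx> nf_tm (len \<Gamma>) i : base_ty \<Gamma>"

abbreviation sub_nf :: "rctx \<Rightarrow> rsub \<Rightarrow> rctx \<Rightarrow> (nat \<Rightarrow> nat) \<Rightarrow> bool" where
  "sub_nf \<Delta> \<gamma> \<Gamma> f \<equiv> \<forall>i<len \<Gamma>. tm_nf \<Delta> (MSub (nf_tm (len \<Gamma>) i) \<gamma>) (f i)"

lemma tm_nfI: "\<Gamma> \<turnstile>\<^sub>m a \<approx> nf_tm (len \<Gamma>) i : A \<Longrightarrow> tm_nf \<Gamma> a i"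
  by (meson base_ty_cong tm_conv tm_presup)

lemma tm_nf_trans: "\<Gamma> \<turnstile>\<^sub>m a \<approx> b : A \<Longrightarrow> tm_nf \<Gamma> b i \<Longrightarrow> tm_nf \<Gamma> a i"
  by (meson tm_nfI tm_trans')

lemma sub_nf_trans:
  assumes "\<Delta> \<turnstile>\<^sub>s \<gamma> \<approx> \<gamma>' : \<Gamma>" "sub_nf \<Delta> \<gamma>' \<Gamma> f"
  shows "sub_nf \<Delta> \<gamma> \<Gamma> f"
  using assms
  by (meson base_ty_cong msub_cong nf_tm_in sub_presup tm_nf_trans)

text \<open>Variable i under \<gamma> o \<delta> is first sent by \<gamma> to variable f i and then
  by \<delta> to variable g (f i), hence the reversed composite. The bound on f lets the hypothesis
  about g apply.\<close>

lemma sub_nf_comp: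
  assumes "\<Delta> \<turnstile>\<^sub>s \<gamma> \<approx> \<gamma> : \<Gamma>" "\<Xi> \<turnstile>\<^sub>s \<delta> \<approx> \<delta> : \<Delta>" "sub_nf \<Delta> \<gamma> \<Gamma> f" "sub_nf \<Xi> \<delta> \<Delta> g"
    "\<forall>i<len \<Gamma>. f i < len \<Delta>"
  shows "sub_nf \<Xi> (SComp \<gamma> \<delta>) \<Gamma> (g \<circ> f)"
proof (intro allI impI)
  fix i assume i: "i < len \<Gamma>"
  let ?v = "nf_tm (len \<Gamma>) i"
  have "\<Gamma> \<turnstile>\<^sub>m ?v \<approx> ?v : base_ty \<Gamma>"
    using assms(1) i by (meson base_ty_cong nf_tm_in sub_presup)
  then have "\<Xi> \<turnstile>\<^sub>m MSub ?v (SComp \<gamma> \<delta>) \<approx> MSub (MSub ?v \<gamma>) \<delta> : TSub (base_ty \<Gamma>) (SComp \<gamma> \<delta>)"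
    using assms by (blast intro: msub_comp)
  moreover have "\<Xi> \<turnstile>\<^sub>m MSub (MSub ?v \<gamma>) \<delta> \<approx> MSub (nf_tm (len \<Delta>) (f i)) \<delta> : TSub (base_ty \<Delta>) \<delta>"
    using assms i by (blast intro: msub_cong)
  moreover have "tm_nf \<Xi> (MSub (nf_tm (len \<Delta>) (f i)) \<delta>) (g (f i))"
    using assms i by blast
  ultimately show "tm_nf \<Xi> (MSub ?v (SComp \<gamma> \<delta>)) ((g \<circ> f) i)"
    unfolding comp_def by (blast intro: tm_nf_trans)
qed

text \<open>Once A is replaced by the equal type \<open>nf_ty\<close>, a variable weakened by p is
  by definition the normal form of the next index.\<close>

lemma sub_nf_p:
  assumes "\<Gamma> \<turnstile>\<^sub>t A \<approx> A'"
  shows "sub_nf (CExt \<Gamma> A) (SP A) \<Gamma> Suc"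
proof (intro allI impI)
  fix i assume i: "i < len \<Gamma>"
  have "\<Gamma> \<turnstile>\<^sub>t A \<approx> nf_ty (len \<Gamma>)"
    using assms by (meson base_ty_cong ctx_nf ty_base ty_presup ty_trans)
  then have "CExt \<Gamma> A \<turnstile>\<^sub>s SP A \<approx> SP (nf_ty (len \<Gamma>)) : \<Gamma>"
    by (rule p_cong)
  moreover have "\<Gamma> \<turnstile>\<^sub>m nf_tm (len \<Gamma>) i \<approx> nf_tm (len \<Gamma>) i : A"
    using assms i by (meson nf_tm_in ty_refl)
  ultimately have "CExt \<Gamma> A \<turnstile>\<^sub>m MSub (nf_tm (len \<Gamma>) i) (SP A) \<approx> nf_tm (len (CExt \<Gamma> A)) (Suc i) : TSub A (SP A)"
    by (simp add: msub_cong)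
  then show "tm_nf (CExt \<Gamma> A) (MSub (nf_tm (len \<Gamma>) i) (SP A)) (Suc i)"
    by (rule tm_nfI)
qed

lemma tm_nf_q:
  assumes "\<Gamma> \<turnstile>\<^sub>t A \<approx> A'"
  shows "tm_nf (CExt \<Gamma> A) (MQ A) 0"
proof -
  have "\<Gamma> \<turnstile>\<^sub>t A \<approx> nf_ty (len \<Gamma>)"
    using assms by (meson base_ty_cong ctx_nf ty_base ty_presup ty_trans)
  then have "CExt \<Gamma> A \<turnstile>\<^sub>m MQ A \<approx> nf_tm (len (CExt \<Gamma> A)) 0 : TSub A (SP A)"
    by (simp add: q_cong)
  then show ?thesis
    by (rule tm_nfI)
qed

text \<open>Index 0 is q, which the pairing sends to a. Index k + 1 is variable k weakened by p, and
  p cancels against the pairing, leaving \<gamma>.\<close>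

lemma sub_nf_pair:
  assumes "\<Gamma> \<turnstile>\<^sub>t A \<approx> A" "\<Delta> \<turnstile>\<^sub>s \<gamma> \<approx> \<gamma> : \<Gamma>" "\<Delta> \<turnstile>\<^sub>m a \<approx> a : TSub A \<gamma>"
    and "sub_nf \<Delta> \<gamma> \<Gamma> f" "tm_nf \<Delta> a i"
  shows "sub_nf \<Delta> (SPair \<gamma> a A) (CExt \<Gamma> A) (case_nat i f)"
proof (intro allI impI)
  fix j assume j: "j < len (CExt \<Gamma> A)"
  have pair: "\<Delta> \<turnstile>\<^sub>s SPair \<gamma> a A \<approx> SPair \<gamma> a A : CExt \<Gamma> A"
    using assms by (blast intro: pair_cong)
  show "tm_nf \<Delta> (MSub (nf_tm (len (CExt \<Gamma> A)) j) (SPair \<gamma> a A)) (case_nat i f j)"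
  proof (cases j)
    case 0
    have "\<Delta> \<turnstile>\<^sub>m MSub (nf_tm (len (CExt \<Gamma> A)) 0) (SPair \<gamma> a A) \<approx> MSub (MQ A) (SPair \<gamma> a A) :
        TSub (base_ty (CExt \<Gamma> A)) (SPair \<gamma> a A)"
      by (rule msub_cong[OF tm_sym[OF tm_nf_q[OF assms(1)]] pair])
    moreover have "\<Delta> \<turnstile>\<^sub>m MSub (MQ A) (SPair \<gamma> a A) \<approx> a : TSub A \<gamma>"
      using assms by (intro q_pair)
    ultimately have "tm_nf \<Delta> (MSub (nf_tm (len (CExt \<Gamma> A)) 0) (SPair \<gamma> a A)) i"
      using assms(5) by (blast intro: tm_nf_trans)
    then show ?thesis
      using 0 by simp
  next
    case (Suc k)
    have k: "k < len \<Gamma>"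
      using Suc j by simp
    let ?v = "nf_tm (len \<Gamma>) k"
    have v: "\<Gamma> \<turnstile>\<^sub>m ?v \<approx> ?v : A"
      using k assms(1) by (rule nf_tm_in)
    have p: "CExt \<Gamma> A \<turnstile>\<^sub>s SP A \<approx> SP A : \<Gamma>"
      using assms by (blast intro: p_cong)
    have "\<Delta> \<turnstile>\<^sub>m MSub (nf_tm (len (CExt \<Gamma> A)) (Suc k)) (SPair \<gamma> a A) \<approx> MSub (MSub ?v (SP A)) (SPair \<gamma> a A) :
        TSub (base_ty (CExt \<Gamma> A)) (SPair \<gamma> a A)"
      using msub_cong[OF tm_sym[OF sub_nf_p[OF assms(1), rule_format, OF k]] pair] by simp
    moreover have "\<Delta> \<turnstile>\<^sub>m MSub (MSub ?v (SP A)) (SPair \<gamma> a A) \<approx> MSub ?v (SComp (SP A) (SPair \<gamma> a A)) :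
        TSub A (SComp (SP A) (SPair \<gamma> a A))"
      using v p pair by (blast intro: msub_comp tm_sym)
    moreover have "\<Delta> \<turnstile>\<^sub>m MSub ?v (SComp (SP A) (SPair \<gamma> a A)) \<approx> MSub ?v \<gamma> :
        TSub A (SComp (SP A) (SPair \<gamma> a A))"
      by (rule msub_cong[OF v p_pair[OF assms(1-3)]])
    moreover have "tm_nf \<Delta> (MSub ?v \<gamma>) (f k)"
      using assms(4) k by blast
    ultimately have "tm_nf \<Delta> (MSub (nf_tm (len (CExt \<Gamma> A)) (Suc k)) (SPair \<gamma> a A)) (f k)"
      by (blast intro: tm_nf_trans)
    then show ?thesis
      using Suc by simp
  qed
qed

text \<open>Every term equals the variable that it is read as, and every substitution acts on
  variables as its reading says. With \<open>soundness\<close>, two terms over one context are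
  derivably equal exactly if they are read as the same variable. The claim concerns only the left
  side of a judgment.\<close>

lemma completeness:
  shows "\<turnstile>\<^sub>c \<Gamma> \<approx> \<Gamma>' \<Longrightarrow> True"
    and sub_complete: "\<Delta> \<turnstile>\<^sub>s \<gamma> \<approx> \<gamma>' : \<Gamma> \<Longrightarrow> sub_nf \<Delta> \<gamma> \<Gamma> (sub_var \<gamma>)"
    and "\<Gamma> \<turnstile>\<^sub>t A \<approx> A' \<Longrightarrow> True"
    and tm_complete: "\<Gamma> \<turnstile>\<^sub>m a \<approx> a' : A \<Longrightarrow> tm_nf \<Gamma> a (tm_var a)"
proof (induction rule: ctx_eq_sub_eq_ty_eq_tm_eq.inducts)
  case (sub_sym \<Delta> \<gamma> \<gamma>' \<Gamma>)
  then show ?case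
    \<comment> \<open>The induction hypothesis speaks of \<gamma>, the goal of \<gamma>'. Soundness
      says that both are read alike on the variables of \<Gamma>.\<close>
    using sub_sound[OF sub_sym(1)] sub_nf_trans[OF ctx_eq_sub_eq_ty_eq_tm_eq.sub_sym[OF sub_sym(1)]]
    by simp
next
  case (tm_sym \<Gamma> a a' A)
  then show ?case
    using tm_sound[OF tm_sym(1)] tm_nf_trans[OF ctx_eq_sub_eq_ty_eq_tm_eq.tm_sym[OF tm_sym(1)]]
    by simp
next
  case (sub_pres \<Gamma> \<Gamma>' \<Delta> \<Delta>' \<gamma> \<gamma>')
  then have "\<Gamma>' \<turnstile>\<^sub>t base_ty \<Gamma>' \<approx> base_ty \<Gamma>'"
    by (meson base_ty_cong ctx_sym ctx_trans)
  then show ?case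
    using sub_pres ctx_sound tm_conv by metis
next
  case (tm_pres \<Gamma> \<Gamma>' A A' a a')
  then have "\<Gamma>' \<turnstile>\<^sub>t base_ty \<Gamma>' \<approx> base_ty \<Gamma>'"
    by (meson base_ty_cong ctx_sym ctx_trans)
  then show ?case
    using tm_pres ctx_sound tm_conv by metis
next
  case (id_cong \<Gamma> \<Gamma>')
  then have "\<Gamma> \<turnstile>\<^sub>t base_ty \<Gamma> \<approx> base_ty \<Gamma>"
    by (meson base_ty_cong ctx_presup)
  then show ?case
    by (auto intro: tm_nfI msub_id nf_tm_in)
next
  case (comp_cong \<Gamma> \<delta> \<delta>' \<Delta> \<gamma> \<gamma>' \<Theta>)
  moreover have "\<forall>i<len \<Theta>. sub_var \<gamma> i < len \<Delta>"
    using sub_sound comp_cong by blast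
  ultimately show ?case
    using sub_nf_comp sub_refl unfolding sub_var.simps by blast
next
  case (p_cong \<Gamma> A A')
  then show ?case
    using sub_nf_p by simp
next
  case (q_cong \<Gamma> A A')
  then show ?case
    using tm_nf_q by simp
next
  case (pair_cong \<Gamma> A A' \<Delta> \<gamma> \<gamma>' a a')
  then show ?case
    using sub_nf_pair[of \<Gamma> A \<Delta> \<gamma> a] by (simp add: sub_refl tm_refl ty_refl)
next
  case (msub_cong \<Gamma> a a' A \<Delta> \<gamma> \<gamma>')
  then have "\<Delta> \<turnstile>\<^sub>m MSub a \<gamma> \<approx> MSub (nf_tm (len \<Gamma>) (tm_var a)) \<gamma> : TSub (base_ty \<Gamma>) \<gamma>"
    by (blast intro: ctx_eq_sub_eq_ty_eq_tm_eq.msub_cong sub_refl)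
  then show ?case
    using msub_cong tm_sound[of \<Gamma> a a' A] tm_nf_trans by simp
next
  case (comp_assoc \<Xi> \<gamma> \<Delta> \<delta> \<Gamma> \<theta> \<Theta>)
  then show ?case
    using sub_nf_comp[of \<Gamma> \<theta> \<Theta> \<Delta> \<delta> "sub_var \<theta>" "sub_var \<delta>"]
      sub_nf_comp[of \<Delta> "SComp \<theta> \<delta>" \<Theta> \<Xi> \<gamma> "sub_var \<delta> \<circ> sub_var \<theta>" "sub_var \<gamma>"]
      sub_sound[of \<Gamma> \<theta> \<theta> \<Theta>] sub_sound[of \<Delta> \<delta> \<delta> \<Gamma>]
      comp_cong[OF comp_assoc(2,3)]
    by (simp add: comp_assoc)
next
  case (msub_comp \<Gamma> a A \<Delta> \<gamma> \<Xi> \<delta>)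
  then have "sub_nf \<Xi> (SComp \<gamma> \<delta>) \<Gamma> (sub_var \<delta> \<circ> sub_var \<gamma>)"
    using sub_nf_comp[of \<Delta> \<gamma> \<Gamma> \<Xi> \<delta>] sub_sound[of \<Delta> \<gamma> \<gamma> \<Gamma>] by simp
  moreover have "\<Xi> \<turnstile>\<^sub>m MSub a (SComp \<gamma> \<delta>) \<approx> MSub (nf_tm (len \<Gamma>) (tm_var a)) (SComp \<gamma> \<delta>) :
      TSub (base_ty \<Gamma>) (SComp \<gamma> \<delta>)"
    using msub_comp by (blast intro: msub_cong comp_cong)
  ultimately show ?case
    using msub_comp tm_sound[of \<Gamma> a a A] tm_nf_trans by simp
next
  case (msub_id \<Gamma> a A)
  then show ?case
    using tm_nf_trans[OF ctx_eq_sub_eq_ty_eq_tm_eq.msub_id] by simp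
next
  case (p_pair \<Gamma> A \<Delta> \<gamma> a)
  then show ?case
    using sub_nf_trans[OF ctx_eq_sub_eq_ty_eq_tm_eq.p_pair] by (simp add: comp_def)
next
  case (q_pair \<Gamma> A \<Delta> \<gamma> a)
  then show ?case
    using tm_nf_trans[OF ctx_eq_sub_eq_ty_eq_tm_eq.q_pair] by simp
qed auto

text \<open>The tuple of the variables f 0, ..., f (n - 1) over a context of length m. Its outermost
  component answers index 0, the last variable of the target, so the remaining tuple uses f shifted
  by one.\<close>

primrec nf_sub :: "nat \<Rightarrow> nat \<Rightarrow> (nat \<Rightarrow> nat) \<Rightarrow> rsub" where
  "nf_sub m 0 f = SBang (nf_ctx m)"
| "nf_sub m (Suc n) f = SPair (nf_sub m n (f \<circ> Suc)) (nf_tm m (f 0)) (nf_ty n)"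

lemma nf_sub_cong: "(\<And>i. i < n \<Longrightarrow> f i = g i) \<Longrightarrow> nf_sub m n f = nf_sub m n g"
proof (induction n arbitrary: f g)
  case (Suc n)
  have "nf_sub m n (f \<circ> Suc) = nf_sub m n (g \<circ> Suc)"
    by (rule Suc.IH) (simp add: Suc.prems)
  then show ?case
    by (simp add: Suc.prems)
qed simp

lemma nf_sub_wf:
  "\<forall>i<n. f i < m \<Longrightarrow> nf_ctx m \<turnstile>\<^sub>s nf_sub m n f \<approx> nf_sub m n f : nf_ctx n"
proof (induction n arbitrary: f)
  case 0
  then show ?case
    by (simp add: bang_cong nf_ctx_wf)
next
  case (Suc n)
  then have "nf_ctx m \<turnstile>\<^sub>s nf_sub m n (f \<circ> Suc) \<approx> nf_sub m n (f \<circ> Suc) : nf_ctx n"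
    by simp
  moreover from this have "nf_ctx m \<turnstile>\<^sub>m nf_tm m (f 0) \<approx> nf_tm m (f 0) : TSub (nf_ty n) (nf_sub m n (f \<circ> Suc))"
    using nf_tm_in[of "f 0" "nf_ctx m"] Suc.prems tsub_cong[OF nf_ty_wf] by simp
  ultimately show ?case
    using pair_cong[OF nf_ty_wf] by simp
qed

lemma sub_var_nf_sub: "\<lbrakk>\<forall>i<n. f i < m; i < n\<rbrakk> \<Longrightarrow> sub_var (nf_sub m n f) i = f i"
  by (induction n arbitrary: f i) (auto split: nat.splits)

text \<open>Surjective pairing, iterated: \<gamma> = <p o \<gamma>, q[\<gamma>]>, where p o \<gamma>
  does to index i what \<gamma> does to index i + 1, and q[\<gamma>] is the image of index
  0.\<close>

lemma sub_nf_sub: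
  assumes "nf_ctx m \<turnstile>\<^sub>s \<gamma> \<approx> \<gamma> : nf_ctx n" "sub_nf (nf_ctx m) \<gamma> (nf_ctx n) f"
  shows "nf_ctx m \<turnstile>\<^sub>s \<gamma> \<approx> nf_sub m n f : nf_ctx n"
  using assms
proof (induction n arbitrary: \<gamma> f)
  case 0
  then show ?case
    by (simp add: bang_eta)
next
  case (Suc n)
  let ?p = "SComp (SP (nf_ty n)) \<gamma>"
  have p: "nf_ctx m \<turnstile>\<^sub>s ?p \<approx> ?p : nf_ctx n"
    using Suc.prems(1) nf_p by (blast intro: comp_cong)
  have sub: "nf_ctx m \<turnstile>\<^sub>m MSub (nf_tm n i) ?p \<approx> MSub (nf_tm (Suc n) (Suc i)) \<gamma> : TSub (nf_ty n) ?p"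
    if "i < n" for i
    using msub_comp[OF nf_tm_wf[OF that] nf_p Suc.prems(1)] by simp
  have "sub_nf (nf_ctx m) ?p (nf_ctx n) (f \<circ> Suc)"
  proof (intro allI impI)
    fix i assume "i < len (nf_ctx n)"
    then show "tm_nf (nf_ctx m) (MSub (nf_tm (len (nf_ctx n)) i) ?p) ((f \<circ> Suc) i)"
      using tm_nf_trans[OF sub] Suc.prems(2)[rule_format, of "Suc i"] by simp
  qed
  with p have "nf_ctx m \<turnstile>\<^sub>s ?p \<approx> nf_sub m n (f \<circ> Suc) : nf_ctx n"
    by (rule Suc.IH)
  moreover have "nf_ctx m \<turnstile>\<^sub>m MSub (MQ (nf_ty n)) \<gamma> \<approx> nf_tm m (f 0) : TSub (nf_ty n) ?p"
    using tm_conv[OF Suc.prems(2)[rule_format, of 0] nf_ctx_wf tsub_cong[OF nf_ty_wf p]] by simp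
  ultimately have "nf_ctx m \<turnstile>\<^sub>s SPair ?p (MSub (MQ (nf_ty n)) \<gamma>) (nf_ty n) \<approx> nf_sub m (Suc n) f : nf_ctx (Suc n)"
    using pair_cong[OF nf_ty_wf] by simp
  moreover have "nf_ctx m \<turnstile>\<^sub>s \<gamma> \<approx> SPair ?p (MSub (MQ (nf_ty n)) \<gamma>) (nf_ty n) : nf_ctx (Suc n)"
    using Suc.prems(1) pair_eta[OF nf_ty_wf] by simp
  ultimately show ?case
    by (blast intro: sub_trans)
qed

lemma sub_eq_nf: "nf_ctx m \<turnstile>\<^sub>s \<gamma> \<approx> \<gamma> : nf_ctx n \<Longrightarrow> nf_ctx m \<turnstile>\<^sub>s \<gamma> \<approx> nf_sub m n (sub_var \<gamma>) : nf_ctx n"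
  using sub_nf_sub sub_complete by metis

lemma tm_eq_nf: "nf_ctx n \<turnstile>\<^sub>m a \<approx> a : nf_ty n \<Longrightarrow> nf_ctx n \<turnstile>\<^sub>m a \<approx> nf_tm n (tm_var a) : nf_ty n"
  using tm_complete by fastforce

section \<open>The syntactic cwf, computed\<close>

definition syn_ctx :: "nat \<Rightarrow> rctx set" where
  "syn_ctx n = ctx_rel `` {nf_ctx n}"

definition syn_sub :: "nat \<Rightarrow> nat \<Rightarrow> (nat \<Rightarrow> nat) \<Rightarrow> rsub set" where
  "syn_sub m n f = {\<gamma>. nf_ctx m \<turnstile>\<^sub>s nf_sub m n f \<approx> \<gamma> : nf_ctx n}"

definition syn_ty :: "nat \<Rightarrow> rty set" where
  "syn_ty n = {A. nf_ctx n \<turnstile>\<^sub>t nf_ty n \<approx> A}"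

definition syn_tm :: "nat \<Rightarrow> nat \<Rightarrow> rtm set" where
  "syn_tm n i = {a. nf_ctx n \<turnstile>\<^sub>m nf_tm n i \<approx> a : nf_ty n}"

definition is_per :: "('a \<times> 'a) set \<Rightarrow> bool" where
  "is_per R \<longleftrightarrow> sym R \<and> trans R"

text \<open>Each operation of \<open>syn_cwf\<close> is the image of a set of constructor instances.
  It collapses to one class as soon as this set is nonempty and all its members are related to one
  normal form.\<close>

lemma per_Image:
  assumes "is_per R" "x \<in> S" "\<And>y. y \<in> S \<Longrightarrow> (z, y) \<in> R"
  shows "R `` S = R `` {z}"
  using assms unfolding is_per_def by (blast dest: symD transD)

text \<open>Used to enumerate the carriers: every element in the domain of the relation must be
  related to some normal form, and the normal forms must lie in that domain.\<close>

lemma per_quotient_eq: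
  assumes "is_per R" "\<And>x. (x, x) \<in> R \<Longrightarrow> \<exists>i\<in>I. (f i, x) \<in> R" "\<And>i. i \<in> I \<Longrightarrow> (f i, f i) \<in> R"
  shows "per_quotient R = (\<lambda>i. R `` {f i}) ` I"
proof -
  have "\<exists>i\<in>I. R `` {x} = R `` {f i}" if "(x, x) \<in> R" for x
    using assms(1) assms(2)[OF that] unfolding is_per_def by (blast dest: symD transD)
  then show ?thesis
    using assms(3) unfolding per_quotient_def quotient_def by blast
qed

lemma ctx_per: "is_per ctx_rel"
  unfolding is_per_def ctx_rel_def
  by (auto intro!: symI transI intro: ctx_sym ctx_trans)

lemma sub_rel_eq: "sub_rel (syn_ctx m) (syn_ctx n) = {(\<gamma>, \<gamma>'). nf_ctx m \<turnstile>\<^sub>s \<gamma> \<approx> \<gamma>' : nf_ctx n}"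
  unfolding sub_rel_def syn_ctx_def ctx_rel_def
  by (auto intro: nf_ctx_wf sub_pres ctx_sym)

lemma ty_rel_eq: "ty_rel (syn_ctx n) = {(A, A'). nf_ctx n \<turnstile>\<^sub>t A \<approx> A'}"
  unfolding ty_rel_def syn_ctx_def ctx_rel_def
  by (auto intro: nf_ctx_wf ty_pres ctx_sym)

lemma tm_rel_eq: "tm_rel (syn_ctx n) (syn_ty n) = {(a, a'). nf_ctx n \<turnstile>\<^sub>m a \<approx> a' : nf_ty n}"
  unfolding tm_rel_def syn_ctx_def ctx_rel_def syn_ty_def
  using nf_ctx_wf nf_ty_wf tm_conv ctx_sym by blast

lemma sub_per: "is_per (sub_rel (syn_ctx m) (syn_ctx n))"
  unfolding is_per_def sub_rel_eq
  by (auto intro!: symI transI intro: sub_sym sub_trans)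

lemma ty_per: "is_per (ty_rel (syn_ctx n))"
  unfolding is_per_def ty_rel_eq
  by (auto intro!: symI transI intro: ty_sym ty_trans)

lemma tm_per: "is_per (tm_rel (syn_ctx n) (syn_ty n))"
  unfolding is_per_def tm_rel_eq
  by (auto intro!: symI transI intro: tm_sym tm_trans)

lemma syn_sub_Image: "syn_sub m n f = sub_rel (syn_ctx m) (syn_ctx n) `` {nf_sub m n f}"
  unfolding syn_sub_def sub_rel_eq by auto

lemma syn_ty_Image: "syn_ty n = ty_rel (syn_ctx n) `` {nf_ty n}"
  unfolding syn_ty_def ty_rel_eq by auto

lemma syn_tm_Image: "syn_tm n i = tm_rel (syn_ctx n) (syn_ty n) `` {nf_tm n i}"
  unfolding syn_tm_def tm_rel_eq by auto

lemma syn_ctx_inj [simp]: "syn_ctx m = syn_ctx n \<longleftrightarrow> m = n"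
proof
  assume "syn_ctx m = syn_ctx n"
  then have "nf_ctx m \<in> syn_ctx n"
    using nf_ctx_wf[of m] by (auto simp: syn_ctx_def ctx_rel_def)
  then show "m = n"
    by (auto simp: syn_ctx_def ctx_rel_def dest: ctx_sound)
qed simp

text \<open>Soundness separates the classes: the reading of the normal form gives back f on the
  variables of the target.\<close>

lemma syn_sub_eq_iff:
  assumes "\<forall>i<n. f i < m" "\<forall>i<n. g i < m"
  shows "syn_sub m n f = syn_sub m n g \<longleftrightarrow> (\<forall>i<n. f i = g i)"
proof
  assume "syn_sub m n f = syn_sub m n g"
  then have "nf_ctx m \<turnstile>\<^sub>s nf_sub m n f \<approx> nf_sub m n g : nf_ctx n"
    using nf_sub_wf[OF assms(2)] by (auto simp: syn_sub_def)
  then show "\<forall>i<n. f i = g i"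
    using assms by (auto dest!: sub_sound simp: sub_var_nf_sub)
qed (simp add: syn_sub_def nf_sub_cong[of n f g m])

lemma syn_tm_eq_iff:
  assumes "i < n" "j < n"
  shows "syn_tm n i = syn_tm n j \<longleftrightarrow> i = j"
proof
  assume "syn_tm n i = syn_tm n j"
  then have "nf_ctx n \<turnstile>\<^sub>m nf_tm n i \<approx> nf_tm n j : nf_ty n"
    using nf_tm_wf[OF assms(2)] by (auto simp: syn_tm_def)
  then show "i = j"
    using assms by (auto dest!: tm_sound)
qed simp

section \<open>The carriers of the syntactic cwf\<close>

lemma Ctx_syn: "Ctx syn_cwf = range syn_ctx"
proof -
  have "(x, x) \<in> ctx_rel \<Longrightarrow> (nf_ctx (len x), x) \<in> ctx_rel" for x
    by (auto simp: ctx_rel_def intro: ctx_nf ctx_sym)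
  then have "per_quotient ctx_rel = (\<lambda>n. ctx_rel `` {nf_ctx n}) ` UNIV"
    by (intro per_quotient_eq ctx_per) (auto simp: ctx_rel_def nf_ctx_wf)
  then show ?thesis
    by (simp add: syn_cwf_def syn_ctx_def)
qed

lemma Sub_syn: "Sub syn_cwf (syn_ctx m) (syn_ctx n) = syn_sub m n ` {f. \<forall>i<n. f i < m}"
proof -
  let ?R = "sub_rel (syn_ctx m) (syn_ctx n)"
  have "\<exists>f\<in>{f. \<forall>i<n. f i < m}. (nf_sub m n f, x) \<in> ?R" if "(x, x) \<in> ?R" for x
    using that sub_sound[of "nf_ctx m" x x "nf_ctx n"] sub_eq_nf[of m x n]
    by (intro bexI[of _ "sub_var x"]) (auto simp: sub_rel_eq intro: sub_sym)
  then have "per_quotient ?R = (\<lambda>f. ?R `` {nf_sub m n f}) ` {f. \<forall>i<n. f i < m}"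
    by (intro per_quotient_eq sub_per) (auto simp: sub_rel_eq nf_sub_wf)
  then show ?thesis
    by (simp add: syn_cwf_def syn_sub_Image)
qed

lemma Ty_syn: "Ty syn_cwf (syn_ctx n) = {syn_ty n}"
proof -
  \<comment> \<open>A one-element index type suffices because any two types over a context are
    equal.\<close>
  have "per_quotient (ty_rel (syn_ctx n)) = (\<lambda>_::unit. ty_rel (syn_ctx n) `` {nf_ty n}) ` UNIV"
    by (intro per_quotient_eq ty_per) (auto simp: ty_rel_eq nf_ty_wf intro: ty_unique)
  then show ?thesis
    by (simp add: syn_cwf_def syn_ty_Image)
qed

lemma Tm_syn: "Tm syn_cwf (syn_ctx n) (syn_ty n) = syn_tm n ` {..<n}"
proof -
  let ?R = "tm_rel (syn_ctx n) (syn_ty n)"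
  have "\<exists>i\<in>{..<n}. (nf_tm n i, x) \<in> ?R" if "(x, x) \<in> ?R" for x
    using that tm_sound[of "nf_ctx n" x x "nf_ty n"] tm_eq_nf[of n x]
    by (intro bexI[of _ "tm_var x"]) (auto simp: tm_rel_eq intro: tm_sym)
  then have "per_quotient ?R = (\<lambda>i. ?R `` {nf_tm n i}) ` {..<n}"
    by (intro per_quotient_eq tm_per) (auto simp: tm_rel_eq nf_tm_wf)
  then show ?thesis
    by (simp add: syn_cwf_def syn_tm_Image)
qed

text \<open>Membership of a constructor instance in its class needs no equational derivation any
  more: it is enough that the instance is well-typed and has the right reading.\<close>

lemma sub_nfI:
  assumes "nf_ctx m \<turnstile>\<^sub>s \<gamma> \<approx> \<gamma>' : nf_ctx n" "\<And>i. i < n \<Longrightarrow> sub_var \<gamma> i = f i"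
  shows "nf_ctx m \<turnstile>\<^sub>s nf_sub m n f \<approx> \<gamma> : nf_ctx n"
  using sub_eq_nf[OF sub_refl[OF assms(1)]] nf_sub_cong[of n "sub_var \<gamma>" f m] assms(2)
  by (auto intro: sub_sym)

lemma tm_nfI':
  assumes "nf_ctx n \<turnstile>\<^sub>m a \<approx> a' : A" "tm_var a = i"
  shows "nf_ctx n \<turnstile>\<^sub>m nf_tm n i \<approx> a : nf_ty n"
  using tm_complete[OF assms(1)] assms(2) by (auto intro: tm_sym)

lemma syn_sub_rep:
  assumes "\<gamma> \<in> syn_sub m n f" "\<forall>i<n. f i < m"
  shows "nf_ctx m \<turnstile>\<^sub>s \<gamma> \<approx> \<gamma> : nf_ctx n" "i < n \<Longrightarrow> sub_var \<gamma> i = f i"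
  using assms sub_sound[of "nf_ctx m" "nf_sub m n f" \<gamma> "nf_ctx n"]
  by (auto simp: syn_sub_def sub_var_nf_sub intro: sub_sym sub_refl)

lemma syn_tm_rep:
  assumes "a \<in> syn_tm n i" "i < n"
  shows "nf_ctx n \<turnstile>\<^sub>m a \<approx> a : nf_ty n" "tm_var a = i"
  using assms tm_sound[of "nf_ctx n" "nf_tm n i" a "nf_ty n"]
  by (auto simp: syn_tm_def intro: tm_sym tm_refl)

lemma syn_ty_rep: "A \<in> syn_ty n \<Longrightarrow> nf_ctx n \<turnstile>\<^sub>t A \<approx> A"
  by (auto simp: syn_ty_def intro: ty_sym ty_refl)

lemma syn_ctx_rep: "\<Gamma> \<in> syn_ctx n \<Longrightarrow> \<turnstile>\<^sub>c \<Gamma> \<approx> nf_ctx n"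
  by (auto simp: syn_ctx_def ctx_rel_def intro: ctx_sym)

lemma syn_nonempty:
  "nf_ctx n \<in> syn_ctx n" "nf_ty n \<in> syn_ty n" "i < n \<Longrightarrow> nf_tm n i \<in> syn_tm n i"
  "\<forall>i<n. f i < m \<Longrightarrow> nf_sub m n f \<in> syn_sub m n f"
  by (auto simp: syn_ctx_def ctx_rel_def syn_ty_def syn_tm_def syn_sub_def
      nf_ctx_wf nf_ty_wf nf_tm_wf nf_sub_wf)

section \<open>The operations of the syntactic cwf on normal forms\<close>

lemma emp_syn: "emp syn_cwf = syn_ctx 0"
  by (simp add: syn_cwf_def syn_ctx_def)

lemma ext_syn': "syn_ext (syn_ctx n) (syn_ty n) = syn_ctx (Suc n)"
  unfolding syn_ext_def syn_ctx_def[of "Suc n"]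
proof (rule per_Image[OF ctx_per])
  show "CExt (nf_ctx n) (nf_ty n) \<in> {CExt \<Gamma> A |\<Gamma> A. \<Gamma> \<in> syn_ctx n \<and> A \<in> syn_ty n}"
    using syn_nonempty by blast
  show "(nf_ctx (Suc n), \<Delta>) \<in> ctx_rel" if "\<Delta> \<in> {CExt \<Gamma> A |\<Gamma> A. \<Gamma> \<in> syn_ctx n \<and> A \<in> syn_ty n}" for \<Delta>
    using that by (auto simp: ctx_rel_def syn_ty_def intro: ext_cong ctx_sym dest: syn_ctx_rep)
qed

lemma ext_syn: "ext syn_cwf (syn_ctx n) (syn_ty n) = syn_ctx (Suc n)"
  by (simp add: syn_cwf_def ext_syn')

lemma tysub_syn':
  assumes "\<forall>i<n. f i < m"
  shows "syn_tysub (syn_ctx m) (syn_ctx n) (syn_ty n) (syn_sub m n f) = syn_ty m"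
  unfolding syn_tysub_def syn_ty_Image[of m]
proof (rule per_Image[OF ty_per])
  show "TSub (nf_ty n) (nf_sub m n f) \<in> {TSub A \<gamma> |A \<gamma>. A \<in> syn_ty n \<and> \<gamma> \<in> syn_sub m n f}"
    using syn_nonempty assms by blast
  show "(nf_ty m, B) \<in> ty_rel (syn_ctx m)"
    if "B \<in> {TSub A \<gamma> |A \<gamma>. A \<in> syn_ty n \<and> \<gamma> \<in> syn_sub m n f}" for B
  proof -
    from that obtain A \<gamma> where "B = TSub A \<gamma>" "A \<in> syn_ty n" "\<gamma> \<in> syn_sub m n f"
      by blast
    then have "nf_ctx m \<turnstile>\<^sub>t B \<approx> B"
      using tsub_cong syn_ty_rep syn_sub_rep(1)[OF _ assms] by blast
    then show ?thesis
      by (simp add: ty_rel_eq ty_unique nf_ty_wf)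
  qed
qed

lemma tysub_syn:
  "\<forall>i<n. f i < m \<Longrightarrow> tysub syn_cwf (syn_ctx m) (syn_ctx n) (syn_ty n) (syn_sub m n f) = syn_ty m"
  by (simp add: syn_cwf_def tysub_syn')

lemma idn_syn: "idn syn_cwf (syn_ctx n) = syn_sub n n id"
proof -
  have "sub_rel (syn_ctx n) (syn_ctx n) `` {SId \<Gamma> |\<Gamma>. \<Gamma> \<in> syn_ctx n} = syn_sub n n id"
    unfolding syn_sub_Image
  proof (rule per_Image[OF sub_per])
    show "SId (nf_ctx n) \<in> {SId \<Gamma> |\<Gamma>. \<Gamma> \<in> syn_ctx n}"
      using syn_nonempty by blast
    show "(nf_sub n n id, \<gamma>) \<in> sub_rel (syn_ctx n) (syn_ctx n)" if "\<gamma> \<in> {SId \<Gamma> |\<Gamma>. \<Gamma> \<in> syn_ctx n}" for \<gamma>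
    proof -
      from that obtain \<Gamma> where "\<gamma> = SId \<Gamma>" "\<turnstile>\<^sub>c \<Gamma> \<approx> nf_ctx n"
        using syn_ctx_rep by blast
      then have "nf_ctx n \<turnstile>\<^sub>s \<gamma> \<approx> \<gamma> : nf_ctx n"
        by (blast intro: id_cong sub_pres ctx_presup)
      then show ?thesis
        using \<open>\<gamma> = SId \<Gamma>\<close> sub_nfI[of n \<gamma> \<gamma> n id] by (simp add: sub_rel_eq)
    qed
  qed
  then show ?thesis
    by (simp add: syn_cwf_def)
qed

lemma cmp_syn:
  assumes "\<forall>i<n. f i < m" "\<forall>i<m. g i < k"
  shows "cmp syn_cwf (syn_ctx k) (syn_ctx m) (syn_ctx n) (syn_sub m n f) (syn_sub k m g) = syn_sub k n (g \<circ> f)"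
proof -
  let ?S = "{SComp \<gamma> \<delta> |\<gamma> \<delta>. \<gamma> \<in> syn_sub m n f \<and> \<delta> \<in> syn_sub k m g}"
  have "sub_rel (syn_ctx k) (syn_ctx n) `` ?S = syn_sub k n (g \<circ> f)"
    unfolding syn_sub_Image[of k n]
  proof (rule per_Image[OF sub_per])
    show "SComp (nf_sub m n f) (nf_sub k m g) \<in> ?S"
      using syn_nonempty assms by blast
    show "(nf_sub k n (g \<circ> f), \<theta>) \<in> sub_rel (syn_ctx k) (syn_ctx n)" if "\<theta> \<in> ?S" for \<theta>
    proof -
      from that obtain \<gamma> \<delta> where "\<theta> = SComp \<gamma> \<delta>" "\<gamma> \<in> syn_sub m n f" "\<delta> \<in> syn_sub k m g"
        by blast
      then show ?thesis
        using syn_sub_rep[OF _ assms(1)] syn_sub_rep[OF _ assms(2)] assms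
          sub_nfI[of k "SComp \<gamma> \<delta>" "SComp \<gamma> \<delta>" n "g \<circ> f"] comp_cong[of "nf_ctx k" \<delta> \<delta> "nf_ctx m"]
        by (simp add: sub_rel_eq)
    qed
  qed
  then show ?thesis
    by (simp add: syn_cwf_def)
qed

lemma tmsub_syn:
  assumes "\<forall>i<n. f i < m" "i < n"
  shows "tmsub syn_cwf (syn_ctx m) (syn_ctx n) (syn_ty n) (syn_tm n i) (syn_sub m n f) = syn_tm m (f i)"
proof -
  let ?S = "{MSub a \<gamma> |a \<gamma>. a \<in> syn_tm n i \<and> \<gamma> \<in> syn_sub m n f}"
  have "tm_rel (syn_ctx m) (syn_ty m) `` ?S = syn_tm m (f i)"
    unfolding syn_tm_Image[of m]
  proof (rule per_Image[OF tm_per])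
    show "MSub (nf_tm n i) (nf_sub m n f) \<in> ?S"
      using syn_nonempty assms by blast
    show "(nf_tm m (f i), b) \<in> tm_rel (syn_ctx m) (syn_ty m)" if "b \<in> ?S" for b
    proof -
      from that obtain a \<gamma> where "b = MSub a \<gamma>" "a \<in> syn_tm n i" "\<gamma> \<in> syn_sub m n f"
        by blast
      then show ?thesis
        using syn_sub_rep[OF _ assms(1)] syn_tm_rep[OF _ assms(2)] assms
          tm_nfI'[OF msub_cong, of "nf_ctx n" a a "nf_ty n" m \<gamma> \<gamma> "f i"]
        by (simp add: tm_rel_eq)
    qed
  qed
  then show ?thesis
    by (simp add: syn_cwf_def tysub_syn'[OF assms(1)])
qed

lemma pr_syn': "syn_pr (syn_ctx n) (syn_ty n) = syn_sub (Suc n) n Suc"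
  unfolding syn_pr_def ext_syn' syn_sub_Image
proof (rule per_Image[OF sub_per])
  show "SP (nf_ty n) \<in> {SP A |A. A \<in> syn_ty n}"
    using syn_nonempty by blast
  show "(nf_sub (Suc n) n Suc, \<gamma>) \<in> sub_rel (syn_ctx (Suc n)) (syn_ctx n)" if "\<gamma> \<in> {SP A |A. A \<in> syn_ty n}" for \<gamma>
  proof -
    from that obtain A where A: "\<gamma> = SP A" "nf_ctx n \<turnstile>\<^sub>t nf_ty n \<approx> A"
      by (auto simp: syn_ty_def)
    then have "nf_ctx (Suc n) \<turnstile>\<^sub>s \<gamma> \<approx> \<gamma> : nf_ctx n"
      using p_cong by (metis nf_ctx.simps(2) sub_refl sub_sym)
    then show ?thesis
      using A sub_nfI[of "Suc n" \<gamma> \<gamma> n Suc] by (simp add: sub_rel_eq)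
  qed
qed

lemma pr_syn: "pr syn_cwf (syn_ctx n) (syn_ty n) = syn_sub (Suc n) n Suc"
  by (simp add: syn_cwf_def pr_syn')

lemma vr_syn: "vr syn_cwf (syn_ctx n) (syn_ty n) = syn_tm (Suc n) 0"
proof -
  have "tm_rel (syn_ctx (Suc n)) (syn_ty (Suc n)) `` {MQ A |A. A \<in> syn_ty n} = syn_tm (Suc n) 0"
    unfolding syn_tm_Image
  proof (rule per_Image[OF tm_per])
    show "MQ (nf_ty n) \<in> {MQ A |A. A \<in> syn_ty n}"
      using syn_nonempty by blast
    show "(nf_tm (Suc n) 0, a) \<in> tm_rel (syn_ctx (Suc n)) (syn_ty (Suc n))" if "a \<in> {MQ A |A. A \<in> syn_ty n}" for a
    proof -
      from that obtain A where A: "a = MQ A" "nf_ctx n \<turnstile>\<^sub>t nf_ty n \<approx> A"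
        by (auto simp: syn_ty_def)
      then have "nf_ctx (Suc n) \<turnstile>\<^sub>m MQ (nf_ty n) \<approx> a : TSub (nf_ty n) (SP (nf_ty n))"
        using q_cong by simp
      then show ?thesis
        using A tm_nfI'[of "Suc n" a, OF tm_sym] by (simp add: tm_rel_eq)
    qed
  qed
  then show ?thesis
    by (simp add: syn_cwf_def pr_syn' ext_syn' tysub_syn')
qed

lemmas syn_simps = Ctx_syn Ty_syn emp_syn ext_syn idn_syn cmp_syn tysub_syn tmsub_syn pr_syn vr_syn

text \<open>After the computations above, the laws are identities between functions on initial
  segments of the natural numbers, composed in reverse order. Only comprehension takes an
  argument.\<close>

lemma cwf_syn: "cwf syn_cwf"
proof
  show "terminal syn_cwf (emp syn_cwf)"
    by (auto simp: terminal_def syn_simps Sub_syn syn_sub_def)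
  show "comprehension syn_cwf \<Gamma> A (ext syn_cwf \<Gamma> A) (pr syn_cwf \<Gamma> A) (vr syn_cwf \<Gamma> A)"
    if "\<Gamma> \<in> Ctx syn_cwf" "A \<in> Ty syn_cwf \<Gamma>" for \<Gamma> A
  proof -
    from that obtain n where \<Gamma>: "\<Gamma> = syn_ctx n" and A: "A = syn_ty n"
      by (auto simp: syn_simps)
    have "\<exists>!\<sigma>. \<sigma> \<in> Sub syn_cwf (syn_ctx m) (syn_ctx (Suc n)) \<and>
        cmp syn_cwf (syn_ctx m) (syn_ctx (Suc n)) (syn_ctx n) (syn_sub (Suc n) n Suc) \<sigma> = syn_sub m n f \<and>
        tmsub syn_cwf (syn_ctx m) (syn_ctx (Suc n)) (syn_ty (Suc n)) (syn_tm (Suc n) 0) \<sigma> = syn_tm m i"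
      if f: "\<forall>i<n. f i < m" and i: "i < m" for m f i
    \<comment> \<open>The pairing sends the new variable 0 to the given term and the old ones,
      shifted by one, where f sends them.\<close>
    proof (rule ex1I[of _ "syn_sub m (Suc n) (case_nat i f)"], goal_cases)
      case 1
      have "\<forall>j<Suc n. (case_nat i f) j < m"
        using f i by (auto split: nat.splits)
      then show ?case
        by (auto simp: syn_simps Sub_syn comp_def)
    next
      case (2 \<sigma>)
      then obtain g where \<sigma>: "\<sigma> = syn_sub m (Suc n) g" and g: "\<forall>j<Suc n. g j < m"
        by (auto simp: Sub_syn)
      with 2 have "syn_sub m n (g \<circ> Suc) = syn_sub m n f" "syn_tm m (g 0) = syn_tm m i"
        by (auto simp: syn_simps)
      with f g i have eq: "\<forall>i<n. g (Suc i) = f i" "g 0 = i"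
        by (auto simp: syn_sub_eq_iff syn_tm_eq_iff)
      \<comment> \<open>The two functions need to agree only on the variables of the target, since
        the normal form depends on nothing else.\<close>
      have "nf_sub m (Suc n) g = nf_sub m (Suc n) (case_nat i f)"
        by (rule nf_sub_cong) (use eq in \<open>auto split: nat.splits\<close>)
      then show ?case
        by (simp add: \<sigma> syn_sub_def)
    qed
    then show ?thesis
      by (auto simp: \<Gamma> A comprehension_def syn_simps Sub_syn Tm_syn)
  qed
qed (auto simp: syn_simps Sub_syn Tm_syn o_assoc)

section \<open>Calculus in a category with families\<close>

lemma comprehensionD:
  assumes "comprehension C \<Gamma> A E p q"
  shows "E \<in> Ctx C" "p \<in> Sub C E \<Gamma>" "q \<in> Tm C E (tysub C E \<Gamma> A p)"
  using assms by (auto simp: comprehension_def)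

lemma comprehension_ex:
  assumes "comprehension C \<Gamma> A E p q" "\<Delta> \<in> Ctx C" "\<gamma> \<in> Sub C \<Delta> \<Gamma>" "a \<in> Tm C \<Delta> (tysub C \<Delta> \<Gamma> A \<gamma>)"
  obtains \<sigma> where "\<sigma> \<in> Sub C \<Delta> E" "cmp C \<Delta> E \<Gamma> p \<sigma> = \<gamma>" "tmsub C \<Delta> E (tysub C E \<Gamma> A p) q \<sigma> = a"
  using assms unfolding comprehension_def by blast

context cwf
begin

section \<open>Terminal objects, comprehensions and pairing\<close>

definition bang :: "'c \<Rightarrow> 's" where
  "bang \<Gamma> = (THE \<gamma>. \<gamma> \<in> Sub C \<Gamma> (emp C))"

lemma emp_in: "emp C \<in> Ctx C"
  using terminal_emp by (simp add: terminal_def)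

lemma terminal_unique:
  "\<lbrakk>terminal C X; \<Gamma> \<in> Ctx C; \<gamma> \<in> Sub C \<Gamma> X; \<delta> \<in> Sub C \<Gamma> X\<rbrakk> \<Longrightarrow> \<gamma> = \<delta>"
  unfolding terminal_def by blast

lemma terminal_the:
  "\<lbrakk>terminal C X; \<Gamma> \<in> Ctx C\<rbrakk> \<Longrightarrow> (THE \<gamma>. \<gamma> \<in> Sub C \<Gamma> X) \<in> Sub C \<Gamma> X"
  unfolding terminal_def by (rule theI') blast

lemma bang_in: "\<Gamma> \<in> Ctx C \<Longrightarrow> bang \<Gamma> \<in> Sub C \<Gamma> (emp C)"
  unfolding bang_def by (rule terminal_the[OF terminal_emp])

lemma bang_cmp:
  "\<lbrakk>\<Delta> \<in> Ctx C; \<Gamma> \<in> Ctx C; \<gamma> \<in> Sub C \<Delta> \<Gamma>\<rbrakk> \<Longrightarrow> cmp C \<Delta> \<Gamma> (emp C) (bang \<Gamma>) \<gamma> = bang \<Delta>"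
  by (rule terminal_unique[OF terminal_emp]) (auto intro: bang_in cmp_in emp_in)

text \<open>p and q are jointly monic: both substitutions solve the universal problem posed by p o
  \<sigma> and q[\<sigma>]. This is stated for arbitrary comprehensions because the image of an
  extended context under F is one, though not the chosen one.\<close>

lemma comprehension_unique:
  assumes "comprehension C \<Gamma> A E p q" "\<Gamma> \<in> Ctx C" "A \<in> Ty C \<Gamma>"
    and \<Delta>: "\<Delta> \<in> Ctx C" and \<sigma>: "\<sigma> \<in> Sub C \<Delta> E" and \<tau>: "\<tau> \<in> Sub C \<Delta> E"
    and p: "cmp C \<Delta> E \<Gamma> p \<sigma> = cmp C \<Delta> E \<Gamma> p \<tau>"
    and q: "tmsub C \<Delta> E (tysub C E \<Gamma> A p) q \<sigma> = tmsub C \<Delta> E (tysub C E \<Gamma> A p) q \<tau>"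
  shows "\<sigma> = \<tau>"
proof -
  note E = comprehensionD[OF assms(1)]
  let ?\<gamma> = "cmp C \<Delta> E \<Gamma> p \<sigma>" and ?a = "tmsub C \<Delta> E (tysub C E \<Gamma> A p) q \<sigma>"
  have "?\<gamma> \<in> Sub C \<Delta> \<Gamma>"
    using E assms by (auto intro: cmp_in)
  moreover have "?a \<in> Tm C \<Delta> (tysub C \<Delta> \<Gamma> A ?\<gamma>)"
    using E assms(2-5) by (subst tysub_cmp) (auto intro: tmsub_in tysub_in)
  ultimately have "\<exists>!\<sigma>. \<sigma> \<in> Sub C \<Delta> E \<and> cmp C \<Delta> E \<Gamma> p \<sigma> = ?\<gamma> \<and> tmsub C \<Delta> E (tysub C E \<Gamma> A p) q \<sigma> = ?a"
    using assms(1) \<Delta> unfolding comprehension_def by blast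
  then show ?thesis
    using \<sigma> \<tau> p q by auto
qed

lemma ext_in: "\<lbrakk>\<Gamma> \<in> Ctx C; A \<in> Ty C \<Gamma>\<rbrakk> \<Longrightarrow> ext C \<Gamma> A \<in> Ctx C"
  and pr_in: "\<lbrakk>\<Gamma> \<in> Ctx C; A \<in> Ty C \<Gamma>\<rbrakk> \<Longrightarrow> pr C \<Gamma> A \<in> Sub C (ext C \<Gamma> A) \<Gamma>"
  and vr_in': "\<lbrakk>\<Gamma> \<in> Ctx C; A \<in> Ty C \<Gamma>\<rbrakk>
    \<Longrightarrow> vr C \<Gamma> A \<in> Tm C (ext C \<Gamma> A) (tysub C (ext C \<Gamma> A) \<Gamma> A (pr C \<Gamma> A))"
  using comprehensionD[OF comprehension_ext] by blast+

lemma ext_unique: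
  assumes "\<Gamma> \<in> Ctx C" "A \<in> Ty C \<Gamma>" "\<Delta> \<in> Ctx C" "\<sigma> \<in> Sub C \<Delta> (ext C \<Gamma> A)" "\<tau> \<in> Sub C \<Delta> (ext C \<Gamma> A)"
    and "cmp C \<Delta> (ext C \<Gamma> A) \<Gamma> (pr C \<Gamma> A) \<sigma> = cmp C \<Delta> (ext C \<Gamma> A) \<Gamma> (pr C \<Gamma> A) \<tau>"
    and "tmsub C \<Delta> (ext C \<Gamma> A) (tysub C (ext C \<Gamma> A) \<Gamma> A (pr C \<Gamma> A)) (vr C \<Gamma> A) \<sigma>
       = tmsub C \<Delta> (ext C \<Gamma> A) (tysub C (ext C \<Gamma> A) \<Gamma> A (pr C \<Gamma> A)) (vr C \<Gamma> A) \<tau>"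
  shows "\<sigma> = \<tau>"
  by (rule comprehension_unique[OF comprehension_ext]) (use assms in auto)

lemma pair_props:
  assumes "\<Gamma> \<in> Ctx C" "A \<in> Ty C \<Gamma>" "\<Delta> \<in> Ctx C" "\<gamma> \<in> Sub C \<Delta> \<Gamma>" "a \<in> Tm C \<Delta> (tysub C \<Delta> \<Gamma> A \<gamma>)"
  shows pair_in: "pair C \<Delta> \<Gamma> A \<gamma> a \<in> Sub C \<Delta> (ext C \<Gamma> A)"
    and pr_pair: "cmp C \<Delta> (ext C \<Gamma> A) \<Gamma> (pr C \<Gamma> A) (pair C \<Delta> \<Gamma> A \<gamma> a) = \<gamma>"
    and vr_pair': "tmsub C \<Delta> (ext C \<Gamma> A) (tysub C (ext C \<Gamma> A) \<Gamma> A (pr C \<Gamma> A)) (vr C \<Gamma> A)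
        (pair C \<Delta> \<Gamma> A \<gamma> a) = a"
proof -
  let ?E = "ext C \<Gamma> A" and ?p = "pr C \<Gamma> A"
  have "\<exists>!\<sigma>. \<sigma> \<in> Sub C \<Delta> ?E \<and> cmp C \<Delta> ?E \<Gamma> ?p \<sigma> = \<gamma> \<and>
      tmsub C \<Delta> ?E (tysub C ?E \<Gamma> A ?p) (vr C \<Gamma> A) \<sigma> = a"
    using comprehension_ext[OF assms(1,2)] assms(3-5) unfolding comprehension_def by blast
  from theI'[OF this] show "pair C \<Delta> \<Gamma> A \<gamma> a \<in> Sub C \<Delta> ?E"
    "cmp C \<Delta> ?E \<Gamma> ?p (pair C \<Delta> \<Gamma> A \<gamma> a) = \<gamma>"
    "tmsub C \<Delta> ?E (tysub C ?E \<Gamma> A ?p) (vr C \<Gamma> A) (pair C \<Delta> \<Gamma> A \<gamma> a) = a"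
    unfolding pair_def Let_def by blast+
qed

text \<open>In the following variants the type index is a variable constrained by an equation, so that
  they still rewrite when that index occurs in another form, such as \<open>A[\<gamma> \<circ> \<delta>]\<close> for \<open>A[\<gamma>][\<delta>]\<close>.\<close>

lemma vr_in: "\<lbrakk>\<Gamma> \<in> Ctx C; A \<in> Ty C \<Gamma>; T = tysub C (ext C \<Gamma> A) \<Gamma> A (pr C \<Gamma> A)\<rbrakk>
    \<Longrightarrow> vr C \<Gamma> A \<in> Tm C (ext C \<Gamma> A) T"
  using vr_in' by blast

lemma tmsub_in_eq:
  "\<lbrakk>\<Delta> \<in> Ctx C; \<Gamma> \<in> Ctx C; \<gamma> \<in> Sub C \<Delta> \<Gamma>; A \<in> Ty C \<Gamma>; a \<in> Tm C \<Gamma> A; T = tysub C \<Delta> \<Gamma> A \<gamma>\<rbrakk>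
    \<Longrightarrow> tmsub C \<Delta> \<Gamma> A a \<gamma> \<in> Tm C \<Delta> T"
  using tmsub_in by blast

lemma tmsub_tmsub:
  "\<lbrakk>\<Xi> \<in> Ctx C; \<Delta> \<in> Ctx C; \<Gamma> \<in> Ctx C; \<delta> \<in> Sub C \<Xi> \<Delta>; \<gamma> \<in> Sub C \<Delta> \<Gamma>; A \<in> Ty C \<Gamma>; a \<in> Tm C \<Gamma> A;
    T = tysub C \<Delta> \<Gamma> A \<gamma>\<rbrakk>
   \<Longrightarrow> tmsub C \<Xi> \<Delta> T (tmsub C \<Delta> \<Gamma> A a \<gamma>) \<delta> = tmsub C \<Xi> \<Gamma> A a (cmp C \<Xi> \<Delta> \<Gamma> \<gamma> \<delta>)"
  using tmsub_cmp by metis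

lemma vr_pair:
  "\<lbrakk>\<Gamma> \<in> Ctx C; A \<in> Ty C \<Gamma>; \<Delta> \<in> Ctx C; \<gamma> \<in> Sub C \<Delta> \<Gamma>; a \<in> Tm C \<Delta> (tysub C \<Delta> \<Gamma> A \<gamma>);
    T = tysub C (ext C \<Gamma> A) \<Gamma> A (pr C \<Gamma> A)\<rbrakk>
   \<Longrightarrow> tmsub C \<Delta> (ext C \<Gamma> A) T (vr C \<Gamma> A) (pair C \<Delta> \<Gamma> A \<gamma> a) = a"
  using vr_pair' by metis

text \<open>Membership facts together with oriented equations: composites associate to the right,
  and iterated substitutions A[\<gamma>][\<delta>] and a[\<gamma>][\<delta>] collapse to a single
  one.\<close>

lemmas calc = idn_in cmp_in tysub_in tmsub_in_eq emp_in ext_in pr_in vr_in pair_in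
  cmp_idn_left cmp_idn_right cmp_assoc tysub_idn tysub_cmp[symmetric]
  tmsub_idn tmsub_tmsub pr_pair vr_pair

text \<open>Association to the right hides the redex p o <\<gamma>, a> in p o (<\<gamma>, a> o
  \<delta>), so this form is needed as an equation of its own.\<close>

lemma pr_pair_cmp:
  assumes "\<Gamma> \<in> Ctx C" "A \<in> Ty C \<Gamma>" "\<Delta> \<in> Ctx C" "\<gamma> \<in> Sub C \<Delta> \<Gamma>" "a \<in> Tm C \<Delta> (tysub C \<Delta> \<Gamma> A \<gamma>)"
    and "\<Xi> \<in> Ctx C" "\<delta> \<in> Sub C \<Xi> \<Delta>"
  shows "cmp C \<Xi> (ext C \<Gamma> A) \<Gamma> (pr C \<Gamma> A) (cmp C \<Xi> \<Delta> (ext C \<Gamma> A) (pair C \<Delta> \<Gamma> A \<gamma> a) \<delta>) = cmp C \<Xi> \<Delta> \<Gamma> \<gamma> \<delta>"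
proof -
  have "cmp C \<Xi> \<Delta> \<Gamma> (cmp C \<Delta> (ext C \<Gamma> A) \<Gamma> (pr C \<Gamma> A) (pair C \<Delta> \<Gamma> A \<gamma> a)) \<delta> = cmp C \<Xi> \<Delta> \<Gamma> \<gamma> \<delta>"
    using assms by (simp add: pr_pair)
  then show ?thesis
    using assms by (simp add: calc del: pr_pair)
qed

lemma vr_pair_cmp:
  assumes "\<Gamma> \<in> Ctx C" "A \<in> Ty C \<Gamma>" "\<Delta> \<in> Ctx C" "\<gamma> \<in> Sub C \<Delta> \<Gamma>" "a \<in> Tm C \<Delta> (tysub C \<Delta> \<Gamma> A \<gamma>)"
    and "\<Xi> \<in> Ctx C" "\<delta> \<in> Sub C \<Xi> \<Delta>" and T: "T = tysub C (ext C \<Gamma> A) \<Gamma> A (pr C \<Gamma> A)"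
  shows "tmsub C \<Xi> (ext C \<Gamma> A) T (vr C \<Gamma> A) (cmp C \<Xi> \<Delta> (ext C \<Gamma> A) (pair C \<Delta> \<Gamma> A \<gamma> a) \<delta>)
    = tmsub C \<Xi> \<Delta> (tysub C \<Delta> \<Gamma> A \<gamma>) a \<delta>"
  unfolding T
  using assms by (subst tmsub_cmp) (simp_all add: calc)

lemma pair_cmp:
  assumes "\<Gamma> \<in> Ctx C" "A \<in> Ty C \<Gamma>" "\<Delta> \<in> Ctx C" "\<gamma> \<in> Sub C \<Delta> \<Gamma>" "a \<in> Tm C \<Delta> (tysub C \<Delta> \<Gamma> A \<gamma>)"
    and "\<Xi> \<in> Ctx C" "\<delta> \<in> Sub C \<Xi> \<Delta>"
  shows "cmp C \<Xi> \<Delta> (ext C \<Gamma> A) (pair C \<Delta> \<Gamma> A \<gamma> a) \<delta>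
    = pair C \<Xi> \<Gamma> A (cmp C \<Xi> \<Delta> \<Gamma> \<gamma> \<delta>) (tmsub C \<Xi> \<Delta> (tysub C \<Delta> \<Gamma> A \<gamma>) a \<delta>)"
  by (rule ext_unique[of \<Gamma> A \<Xi>]) (use assms in \<open>simp_all add: calc pr_pair_cmp vr_pair_cmp\<close>)

lemma pair_eqI:
  assumes "\<Gamma> \<in> Ctx C" "A \<in> Ty C \<Gamma>" "\<Delta> \<in> Ctx C" "\<sigma> \<in> Sub C \<Delta> (ext C \<Gamma> A)"
    and "cmp C \<Delta> (ext C \<Gamma> A) \<Gamma> (pr C \<Gamma> A) \<sigma> = \<gamma>"
    and "tmsub C \<Delta> (ext C \<Gamma> A) (tysub C (ext C \<Gamma> A) \<Gamma> A (pr C \<Gamma> A)) (vr C \<Gamma> A) \<sigma> = a"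
  shows "pair C \<Delta> \<Gamma> A \<gamma> a = \<sigma>"
proof -
  have "\<gamma> \<in> Sub C \<Delta> \<Gamma>" "a \<in> Tm C \<Delta> (tysub C \<Delta> \<Gamma> A \<gamma>)"
    unfolding assms(5,6)[symmetric] using assms(1-4) by (simp_all add: calc)
  note a = this
  show ?thesis
    by (rule ext_unique[of \<Gamma> A \<Delta>]) (use assms(1-4) a in \<open>simp_all add: calc assms(5,6)\<close>)
qed

lemma pair_pr_vr:
  assumes "\<Gamma> \<in> Ctx C" "A \<in> Ty C \<Gamma>"
  shows "pair C (ext C \<Gamma> A) \<Gamma> A (pr C \<Gamma> A) (vr C \<Gamma> A) = idn C (ext C \<Gamma> A)"
  using assms by (intro pair_eqI) (simp_all add: calc)

lemma lift_in:
  assumes "\<Gamma> \<in> Ctx C" "A \<in> Ty C \<Gamma>" "\<Delta> \<in> Ctx C" "\<gamma> \<in> Sub C \<Delta> \<Gamma>" "A' = tysub C \<Delta> \<Gamma> A \<gamma>"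
  shows "lift C \<Delta> \<Gamma> A \<gamma> \<in> Sub C (ext C \<Delta> A') (ext C \<Gamma> A)"
  using assms unfolding lift_def Let_def by (simp add: calc)

lemma lift_proj:
  assumes "\<Gamma> \<in> Ctx C" "A \<in> Ty C \<Gamma>" "\<Delta> \<in> Ctx C" "\<gamma> \<in> Sub C \<Delta> \<Gamma>" "A' = tysub C \<Delta> \<Gamma> A \<gamma>"
  shows "cmp C (ext C \<Delta> A') (ext C \<Gamma> A) \<Gamma> (pr C \<Gamma> A) (lift C \<Delta> \<Gamma> A \<gamma>) = cmp C (ext C \<Delta> A') \<Delta> \<Gamma> \<gamma> (pr C \<Delta> A')"
    and "tmsub C (ext C \<Delta> A') (ext C \<Gamma> A) (tysub C (ext C \<Gamma> A) \<Gamma> A (pr C \<Gamma> A)) (vr C \<Gamma> A) (lift C \<Delta> \<Gamma> A \<gamma>) = vr C \<Delta> A'"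
  using assms unfolding lift_def Let_def by (simp_all add: calc vr_in)

lemma lift_pair:
  assumes "\<Gamma> \<in> Ctx C" "A \<in> Ty C \<Gamma>" "\<Delta> \<in> Ctx C" "\<gamma> \<in> Sub C \<Delta> \<Gamma>" "A' = tysub C \<Delta> \<Gamma> A \<gamma>"
    and "\<Xi> \<in> Ctx C" "\<delta> \<in> Sub C \<Xi> \<Delta>" "a \<in> Tm C \<Xi> (tysub C \<Xi> \<Gamma> A (cmp C \<Xi> \<Delta> \<Gamma> \<gamma> \<delta>))"
  shows "cmp C \<Xi> (ext C \<Delta> A') (ext C \<Gamma> A) (lift C \<Delta> \<Gamma> A \<gamma>) (pair C \<Xi> \<Delta> A' \<delta> a)
    = pair C \<Xi> \<Gamma> A (cmp C \<Xi> \<Delta> \<Gamma> \<gamma> \<delta>) a"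
  using assms unfolding lift_def Let_def by (simp add: calc pair_cmp)

subsection \<open>Morphisms of types as families of maps between terms\<close>

text \<open>A morphism \<open>f : A \<rightarrow> B\<close> of \<open>\<^bold>T(\<Gamma>)\<close> is determined by the maps it induces from the terms of
  type \<open>A[\<gamma>]\<close> to those of type \<open>B[\<gamma>]\<close>. Working with these maps instead of with \<open>f\<close> turns
  composition into composition of maps and reindexing into a change of \<open>\<gamma>\<close>.\<close>

definition app :: "'c \<Rightarrow> 't \<Rightarrow> 't \<Rightarrow> 'c \<Rightarrow> 's \<Rightarrow> 's \<Rightarrow> 'm \<Rightarrow> 'm" where
  "app \<Gamma> A B \<Delta> f \<gamma> a = tmsub C \<Delta> (ext C \<Gamma> B) (tysub C (ext C \<Gamma> B) \<Gamma> B (pr C \<Gamma> B)) (vr C \<Gamma> B)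
     (cmp C \<Delta> (ext C \<Gamma> A) (ext C \<Gamma> B) f (pair C \<Delta> \<Gamma> A \<gamma> a))"

lemma ty_app_eq: "ty_app C \<Gamma> A B f a = app \<Gamma> A B \<Gamma> f (idn C \<Gamma>) a"
  by (simp add: ty_app_def app_def Let_def)

lemma hom_in: "f \<in> ty_hom C \<Gamma> A B \<Longrightarrow> f \<in> Sub C (ext C \<Gamma> A) (ext C \<Gamma> B)"
  and pr_hom: "f \<in> ty_hom C \<Gamma> A B \<Longrightarrow> cmp C (ext C \<Gamma> A) (ext C \<Gamma> B) \<Gamma> (pr C \<Gamma> B) f = pr C \<Gamma> A"
  by (auto simp: ty_hom_def)

lemma homI:
  "\<lbrakk>f \<in> Sub C (ext C \<Gamma> A) (ext C \<Gamma> B); cmp C (ext C \<Gamma> A) (ext C \<Gamma> B) \<Gamma> (pr C \<Gamma> B) f = pr C \<Gamma> A\<rbrakk>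
    \<Longrightarrow> f \<in> ty_hom C \<Gamma> A B"
  by (simp add: ty_hom_def)

lemma pr_hom_cmp:
  assumes "\<Gamma> \<in> Ctx C" "A \<in> Ty C \<Gamma>" "B \<in> Ty C \<Gamma>" "\<Delta> \<in> Ctx C" "f \<in> ty_hom C \<Gamma> A B" "\<sigma> \<in> Sub C \<Delta> (ext C \<Gamma> A)"
  shows "cmp C \<Delta> (ext C \<Gamma> B) \<Gamma> (pr C \<Gamma> B) (cmp C \<Delta> (ext C \<Gamma> A) (ext C \<Gamma> B) f \<sigma>)
    = cmp C \<Delta> (ext C \<Gamma> A) \<Gamma> (pr C \<Gamma> A) \<sigma>"
  using assms by (subst cmp_assoc[symmetric]) (simp_all add: calc hom_in pr_hom)

lemma app_in:
  assumes "\<Gamma> \<in> Ctx C" "A \<in> Ty C \<Gamma>" "B \<in> Ty C \<Gamma>" "\<Delta> \<in> Ctx C" "\<gamma> \<in> Sub C \<Delta> \<Gamma>"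
    "a \<in> Tm C \<Delta> (tysub C \<Delta> \<Gamma> A \<gamma>)" "f \<in> ty_hom C \<Gamma> A B" "T = tysub C \<Delta> \<Gamma> B \<gamma>"
  shows "app \<Gamma> A B \<Delta> f \<gamma> a \<in> Tm C \<Delta> T"
  using assms by (simp add: app_def calc hom_in pr_hom_cmp)

lemma hom_pair:
  assumes "\<Gamma> \<in> Ctx C" "A \<in> Ty C \<Gamma>" "B \<in> Ty C \<Gamma>" "\<Delta> \<in> Ctx C" "\<gamma> \<in> Sub C \<Delta> \<Gamma>"
    "a \<in> Tm C \<Delta> (tysub C \<Delta> \<Gamma> A \<gamma>)" "f \<in> ty_hom C \<Gamma> A B"
  shows "cmp C \<Delta> (ext C \<Gamma> A) (ext C \<Gamma> B) f (pair C \<Delta> \<Gamma> A \<gamma> a) = pair C \<Delta> \<Gamma> B \<gamma> (app \<Gamma> A B \<Delta> f \<gamma> a)"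
  using assms by (intro pair_eqI[symmetric]) (simp_all add: calc hom_in pr_hom_cmp app_def)

text \<open>Naturality of the maps between terms, from <\<gamma>, a> o \<delta> = <\<gamma> o
  \<delta>, a[\<delta>]>.\<close>

lemma app_tmsub:
  assumes "\<Gamma> \<in> Ctx C" "A \<in> Ty C \<Gamma>" "B \<in> Ty C \<Gamma>" "\<Delta> \<in> Ctx C" "\<gamma> \<in> Sub C \<Delta> \<Gamma>"
    "a \<in> Tm C \<Delta> (tysub C \<Delta> \<Gamma> A \<gamma>)" "f \<in> ty_hom C \<Gamma> A B" "\<Xi> \<in> Ctx C" "\<delta> \<in> Sub C \<Xi> \<Delta>"
    "T = tysub C \<Delta> \<Gamma> B \<gamma>"
  shows "tmsub C \<Xi> \<Delta> T (app \<Gamma> A B \<Delta> f \<gamma> a) \<delta>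
    = app \<Gamma> A B \<Xi> f (cmp C \<Xi> \<Delta> \<Gamma> \<gamma> \<delta>) (tmsub C \<Xi> \<Delta> (tysub C \<Delta> \<Gamma> A \<gamma>) a \<delta>)"
  using assms by (simp add: app_def calc hom_in pr_hom_cmp pair_cmp)

text \<open>The Yoneda argument: on the generic term q over \<Gamma>.A the induced map takes the
  value q[f], because <p, q> = id, and p o f = p is already part of being a morphism.\<close>

lemma hom_eqI:
  assumes "\<Gamma> \<in> Ctx C" "A \<in> Ty C \<Gamma>" "B \<in> Ty C \<Gamma>" "f \<in> ty_hom C \<Gamma> A B" "g \<in> ty_hom C \<Gamma> A B"
    and "app \<Gamma> A B (ext C \<Gamma> A) f (pr C \<Gamma> A) (vr C \<Gamma> A) = app \<Gamma> A B (ext C \<Gamma> A) g (pr C \<Gamma> A) (vr C \<Gamma> A)"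
  shows "f = g"
  by (rule ext_unique[of \<Gamma> B "ext C \<Gamma> A"])
    (use assms in \<open>simp_all add: calc hom_in pr_hom app_def pair_pr_vr\<close>)

lemma idn_hom: "\<lbrakk>\<Gamma> \<in> Ctx C; A \<in> Ty C \<Gamma>\<rbrakk> \<Longrightarrow> idn C (ext C \<Gamma> A) \<in> ty_hom C \<Gamma> A A"
  by (rule homI) (simp_all add: calc)

lemma app_idn:
  "\<lbrakk>\<Gamma> \<in> Ctx C; A \<in> Ty C \<Gamma>; \<Delta> \<in> Ctx C; \<gamma> \<in> Sub C \<Delta> \<Gamma>; a \<in> Tm C \<Delta> (tysub C \<Delta> \<Gamma> A \<gamma>)\<rbrakk>
    \<Longrightarrow> app \<Gamma> A A \<Delta> (idn C (ext C \<Gamma> A)) \<gamma> a = a"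
  by (simp add: app_def calc)

lemma ty_cmp_hom:
  "\<lbrakk>\<Gamma> \<in> Ctx C; A \<in> Ty C \<Gamma>; B \<in> Ty C \<Gamma>; B' \<in> Ty C \<Gamma>; f \<in> ty_hom C \<Gamma> A B; g \<in> ty_hom C \<Gamma> B B'\<rbrakk>
    \<Longrightarrow> ty_cmp C \<Gamma> A B B' g f \<in> ty_hom C \<Gamma> A B'"
  by (rule homI) (simp_all add: ty_cmp_def calc hom_in pr_hom pr_hom_cmp)

lemma app_ty_cmp:
  "\<lbrakk>\<Gamma> \<in> Ctx C; A \<in> Ty C \<Gamma>; B \<in> Ty C \<Gamma>; B' \<in> Ty C \<Gamma>; f \<in> ty_hom C \<Gamma> A B; g \<in> ty_hom C \<Gamma> B B';
    \<Delta> \<in> Ctx C; \<gamma> \<in> Sub C \<Delta> \<Gamma>; a \<in> Tm C \<Delta> (tysub C \<Delta> \<Gamma> A \<gamma>)\<rbrakk>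
    \<Longrightarrow> app \<Gamma> A B' \<Delta> (ty_cmp C \<Gamma> A B B' g f) \<gamma> a = app \<Gamma> B B' \<Delta> g \<gamma> (app \<Gamma> A B \<Delta> f \<gamma> a)"
  by (simp add: ty_cmp_def app_def[of \<Gamma> A B'] app_def[of \<Gamma> B B'] calc hom_in hom_pair)

lemma ty_reindex_hom:
  assumes "\<Gamma> \<in> Ctx C" "A \<in> Ty C \<Gamma>" "B \<in> Ty C \<Gamma>" "f \<in> ty_hom C \<Gamma> A B" "\<Delta> \<in> Ctx C" "\<gamma> \<in> Sub C \<Delta> \<Gamma>"
    "A' = tysub C \<Delta> \<Gamma> A \<gamma>" "B' = tysub C \<Delta> \<Gamma> B \<gamma>"
  shows "ty_reindex C \<Delta> \<Gamma> A B \<gamma> f \<in> ty_hom C \<Delta> A' B'"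
proof -
  note p = lift_proj(1)[OF assms(1,2,5,6,7)]
  show ?thesis
    by (rule homI) (use assms p in \<open>simp_all add: ty_reindex_def Let_def calc hom_in lift_in pr_hom_cmp\<close>)
qed

text \<open>What the passage to term maps gains: reindexing along \<gamma> becomes evaluation at
  \<gamma> o \<delta>, because \<gamma>^+ o <\<delta>, a> = <\<gamma> o \<delta>, a>.\<close>

lemma app_ty_reindex:
  assumes "\<Gamma> \<in> Ctx C" "A \<in> Ty C \<Gamma>" "B \<in> Ty C \<Gamma>" "f \<in> ty_hom C \<Gamma> A B" "\<Delta> \<in> Ctx C" "\<gamma> \<in> Sub C \<Delta> \<Gamma>"
    "A' = tysub C \<Delta> \<Gamma> A \<gamma>" "B' = tysub C \<Delta> \<Gamma> B \<gamma>"
    "\<Xi> \<in> Ctx C" "\<delta> \<in> Sub C \<Xi> \<Delta>" "a \<in> Tm C \<Xi> (tysub C \<Xi> \<Gamma> A (cmp C \<Xi> \<Delta> \<Gamma> \<gamma> \<delta>))"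
  shows "app \<Delta> A' B' \<Xi> (ty_reindex C \<Delta> \<Gamma> A B \<gamma> f) \<delta> a = app \<Gamma> A B \<Xi> f (cmp C \<Xi> \<Delta> \<Gamma> \<gamma> \<delta>) a"
proof -
  note p = lift_proj(1)[OF assms(1,2,5,6,7)]
  show ?thesis
    using assms p
    by (simp add: ty_reindex_def Let_def app_def calc hom_in lift_in pr_hom_cmp vr_pair_cmp lift_pair)
qed

section \<open>Isomorphisms between types\<close>

lemma inv_sub_eqI:
  assumes "\<Delta> \<in> Ctx C" "\<Gamma> \<in> Ctx C" "f \<in> Sub C \<Delta> \<Gamma>" "g \<in> Sub C \<Gamma> \<Delta>" "inverse_sub C \<Delta> \<Gamma> f g"
  shows "inv_sub C \<Delta> \<Gamma> f = g"
  unfolding inv_sub_def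
proof (rule the_equality)
  show "g \<in> Sub C \<Gamma> \<Delta> \<and> inverse_sub C \<Delta> \<Gamma> f g"
    using assms by blast
  fix h assume h: "h \<in> Sub C \<Gamma> \<Delta> \<and> inverse_sub C \<Delta> \<Gamma> f h"
  then have "h = cmp C \<Gamma> \<Gamma> \<Delta> h (cmp C \<Gamma> \<Delta> \<Gamma> f g)"
    using assms by (simp add: inverse_sub_def calc)
  also have "\<dots> = cmp C \<Gamma> \<Delta> \<Delta> (cmp C \<Delta> \<Gamma> \<Delta> h f) g"
    using assms h by (simp add: calc)
  also have "\<dots> = g"
    using assms h by (simp add: inverse_sub_def calc)
  finally show "h = g" .
qed

lemma iso_hom: "f \<in> ty_iso C \<Gamma> A B \<Longrightarrow> f \<in> ty_hom C \<Gamma> A B"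
  by (simp add: ty_iso_def)

lemma ty_inv:
  assumes "\<Gamma> \<in> Ctx C" "A \<in> Ty C \<Gamma>" "B \<in> Ty C \<Gamma>" "f \<in> ty_iso C \<Gamma> A B"
  shows ty_inv_hom: "ty_inv C \<Gamma> A B f \<in> ty_hom C \<Gamma> B A"
    and ty_inv_left: "ty_cmp C \<Gamma> A B A (ty_inv C \<Gamma> A B f) f = idn C (ext C \<Gamma> A)"
    and ty_inv_right: "ty_cmp C \<Gamma> B A B f (ty_inv C \<Gamma> A B f) = idn C (ext C \<Gamma> B)"
proof -
  obtain g where g: "f \<in> ty_hom C \<Gamma> A B" "g \<in> ty_hom C \<Gamma> B A" "inverse_sub C (ext C \<Gamma> A) (ext C \<Gamma> B) f g"
    using assms(4) by (auto simp: ty_iso_def)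
  then have "ty_inv C \<Gamma> A B f = g"
    unfolding ty_inv_def using assms by (intro inv_sub_eqI) (simp_all add: calc hom_in)
  then show "ty_inv C \<Gamma> A B f \<in> ty_hom C \<Gamma> B A"
    "ty_cmp C \<Gamma> A B A (ty_inv C \<Gamma> A B f) f = idn C (ext C \<Gamma> A)"
    "ty_cmp C \<Gamma> B A B f (ty_inv C \<Gamma> A B f) = idn C (ext C \<Gamma> B)"
    using g by (auto simp: ty_cmp_def inverse_sub_def)
qed

lemma app_inv:
  assumes "\<Gamma> \<in> Ctx C" "A \<in> Ty C \<Gamma>" "B \<in> Ty C \<Gamma>" "f \<in> ty_iso C \<Gamma> A B" "\<Delta> \<in> Ctx C" "\<gamma> \<in> Sub C \<Delta> \<Gamma>"
  shows app_inv_left: "a \<in> Tm C \<Delta> (tysub C \<Delta> \<Gamma> A \<gamma>) \<Longrightarrow>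
      app \<Gamma> B A \<Delta> (ty_inv C \<Gamma> A B f) \<gamma> (app \<Gamma> A B \<Delta> f \<gamma> a) = a"
    and app_inv_right: "b \<in> Tm C \<Delta> (tysub C \<Delta> \<Gamma> B \<gamma>) \<Longrightarrow>
      app \<Gamma> A B \<Delta> f \<gamma> (app \<Gamma> B A \<Delta> (ty_inv C \<Gamma> A B f) \<gamma> b) = b"
  using assms
  by (simp_all add: app_ty_cmp[symmetric] iso_hom ty_inv app_idn)

text \<open>Both composites induce the identity on all terms, in particular on the generic ones, and
  \<open>hom_eqI\<close> makes them identities.\<close>

lemma ty_isoI:
  assumes "\<Gamma> \<in> Ctx C" "A \<in> Ty C \<Gamma>" "B \<in> Ty C \<Gamma>" "f \<in> ty_hom C \<Gamma> A B" "g \<in> ty_hom C \<Gamma> B A"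
    and "\<And>\<Delta> \<gamma> a. \<lbrakk>\<Delta> \<in> Ctx C; \<gamma> \<in> Sub C \<Delta> \<Gamma>; a \<in> Tm C \<Delta> (tysub C \<Delta> \<Gamma> A \<gamma>)\<rbrakk>
      \<Longrightarrow> app \<Gamma> B A \<Delta> g \<gamma> (app \<Gamma> A B \<Delta> f \<gamma> a) = a"
    and "\<And>\<Delta> \<gamma> a. \<lbrakk>\<Delta> \<in> Ctx C; \<gamma> \<in> Sub C \<Delta> \<Gamma>; a \<in> Tm C \<Delta> (tysub C \<Delta> \<Gamma> B \<gamma>)\<rbrakk>
      \<Longrightarrow> app \<Gamma> A B \<Delta> f \<gamma> (app \<Gamma> B A \<Delta> g \<gamma> a) = a"
  shows "f \<in> ty_iso C \<Gamma> A B"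
proof -
  have "ty_cmp C \<Gamma> A B A g f = idn C (ext C \<Gamma> A)"
  proof (rule hom_eqI)
    show "app \<Gamma> A A (ext C \<Gamma> A) (ty_cmp C \<Gamma> A B A g f) (pr C \<Gamma> A) (vr C \<Gamma> A) =
      app \<Gamma> A A (ext C \<Gamma> A) (idn C (ext C \<Gamma> A)) (pr C \<Gamma> A) (vr C \<Gamma> A)"
      using assms by (simp add: app_ty_cmp app_idn calc)
  qed (use assms in \<open>simp_all add: ty_cmp_hom idn_hom\<close>)
  moreover have "ty_cmp C \<Gamma> B A B f g = idn C (ext C \<Gamma> B)"
  proof (rule hom_eqI)
    show "app \<Gamma> B B (ext C \<Gamma> B) (ty_cmp C \<Gamma> B A B f g) (pr C \<Gamma> B) (vr C \<Gamma> B) =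
      app \<Gamma> B B (ext C \<Gamma> B) (idn C (ext C \<Gamma> B)) (pr C \<Gamma> B) (vr C \<Gamma> B)"
      using assms by (simp add: app_ty_cmp app_idn calc)
  qed (use assms in \<open>simp_all add: ty_cmp_hom idn_hom\<close>)
  ultimately show ?thesis
    using assms by (auto simp: ty_iso_def inverse_sub_def ty_cmp_def)
qed

lemma idn_iso: "\<lbrakk>\<Gamma> \<in> Ctx C; A \<in> Ty C \<Gamma>\<rbrakk> \<Longrightarrow> idn C (ext C \<Gamma> A) \<in> ty_iso C \<Gamma> A A"
  by (rule ty_isoI[of _ _ _ _ "idn C (ext C \<Gamma> A)"]) (simp_all add: idn_hom app_idn)

lemma ty_inv_iso:
  assumes "\<Gamma> \<in> Ctx C" "A \<in> Ty C \<Gamma>" "B \<in> Ty C \<Gamma>" "f \<in> ty_iso C \<Gamma> A B"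
  shows "ty_inv C \<Gamma> A B f \<in> ty_iso C \<Gamma> B A"
  using assms by (intro ty_isoI[of _ _ _ _ f]) (simp_all add: ty_inv_hom iso_hom app_inv)

lemma ty_cmp_iso:
  assumes "\<Gamma> \<in> Ctx C" "A \<in> Ty C \<Gamma>" "B \<in> Ty C \<Gamma>" "B' \<in> Ty C \<Gamma>" "f \<in> ty_iso C \<Gamma> A B" "g \<in> ty_iso C \<Gamma> B B'"
  shows "ty_cmp C \<Gamma> A B B' g f \<in> ty_iso C \<Gamma> A B'"
  using assms
  by (intro ty_isoI[of _ _ _ _ "ty_cmp C \<Gamma> B' B A (ty_inv C \<Gamma> A B f) (ty_inv C \<Gamma> B B' g)"])
    (simp_all add: ty_cmp_hom ty_inv_hom iso_hom app_ty_cmp app_in app_inv)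

lemma ty_reindex_iso:
  assumes "\<Gamma> \<in> Ctx C" "A \<in> Ty C \<Gamma>" "B \<in> Ty C \<Gamma>" "f \<in> ty_iso C \<Gamma> A B" "\<Delta> \<in> Ctx C" "\<gamma> \<in> Sub C \<Delta> \<Gamma>"
    "A' = tysub C \<Delta> \<Gamma> A \<gamma>" "B' = tysub C \<Delta> \<Gamma> B \<gamma>"
  shows "ty_reindex C \<Delta> \<Gamma> A B \<gamma> f \<in> ty_iso C \<Delta> A' B'"
  using assms
  by (intro ty_isoI[of _ _ _ _ "ty_reindex C \<Delta> \<Gamma> B A \<gamma> (ty_inv C \<Gamma> A B f)"])
    (simp_all add: ty_reindex_hom ty_inv_hom iso_hom app_ty_reindex app_in app_inv calc)

lemma ty_inv_idn:
  assumes "\<Gamma> \<in> Ctx C" "A \<in> Ty C \<Gamma>"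
  shows "ty_inv C \<Gamma> A A (idn C (ext C \<Gamma> A)) = idn C (ext C \<Gamma> A)"
  unfolding ty_inv_def using assms by (intro inv_sub_eqI) (simp_all add: inverse_sub_def calc)

end

section \<open>Pseudo cwf-morphisms\<close>

context pseudo_cwf_morphism
begin

lemmas fcalc = FC_in FS_in FT_in FM_in source.calc target.calc

lemma FS_cmp':
  "\<lbrakk>\<Xi> \<in> Ctx C; \<Delta> \<in> Ctx C; \<Gamma> \<in> Ctx C; \<delta> \<in> Sub C \<Xi> \<Delta>; \<gamma> \<in> Sub C \<Delta> \<Gamma>\<rbrakk>
    \<Longrightarrow> cmp D (FC F \<Xi>) (FC F \<Delta>) (FC F \<Gamma>) (FS F \<Delta> \<Gamma> \<gamma>) (FS F \<Xi> \<Delta> \<delta>)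
      = FS F \<Xi> \<Gamma> (cmp C \<Xi> \<Delta> \<Gamma> \<gamma> \<delta>)"
  by (simp add: FS_cmp)

subsection \<open>The isomorphisms \<open>\<theta>\<close> on terms\<close>

text \<open>The bijection from terms of FA[F\<gamma> o \<delta>] to terms of
  F(A[\<gamma>])[\<delta>] over \<Xi>. \<open>th_unapp\<close> is its inverse.\<close>

definition th_app :: "'c \<Rightarrow> 'c \<Rightarrow> 't \<Rightarrow> 's \<Rightarrow> 'd \<Rightarrow> 'u \<Rightarrow> 'n \<Rightarrow> 'n" where
  "th_app \<Delta> \<Gamma> A \<gamma> \<Xi> \<delta> x =
     target.app (FC F \<Delta>) (tysub D (FC F \<Delta>) (FC F \<Gamma>) (FT F \<Gamma> A) (FS F \<Delta> \<Gamma> \<gamma>))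
       (FT F \<Delta> (tysub C \<Delta> \<Gamma> A \<gamma>)) \<Xi> (th F \<Delta> \<Gamma> A \<gamma>) \<delta> x"

definition th_unapp :: "'c \<Rightarrow> 'c \<Rightarrow> 't \<Rightarrow> 's \<Rightarrow> 'd \<Rightarrow> 'u \<Rightarrow> 'n \<Rightarrow> 'n" where
  "th_unapp \<Delta> \<Gamma> A \<gamma> \<Xi> \<delta> x =
     target.app (FC F \<Delta>) (FT F \<Delta> (tysub C \<Delta> \<Gamma> A \<gamma>))
       (tysub D (FC F \<Delta>) (FC F \<Gamma>) (FT F \<Gamma> A) (FS F \<Delta> \<Gamma> \<gamma>)) \<Xi>
       (ty_inv D (FC F \<Delta>) (tysub D (FC F \<Delta>) (FC F \<Gamma>) (FT F \<Gamma> A) (FS F \<Delta> \<Gamma> \<gamma>))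
         (FT F \<Delta> (tysub C \<Delta> \<Gamma> A \<gamma>)) (th F \<Delta> \<Gamma> A \<gamma>)) \<delta> x"

context
  fixes \<Delta> \<Gamma> A \<gamma> \<Xi> \<delta>
  assumes ctx: "\<Delta> \<in> Ctx C" "\<Gamma> \<in> Ctx C" "\<gamma> \<in> Sub C \<Delta> \<Gamma>" "A \<in> Ty C \<Gamma>"
    "\<Xi> \<in> Ctx D" "\<delta> \<in> Sub D \<Xi> (FC F \<Delta>)"
begin

lemma th_app_in:
  "\<lbrakk>x \<in> Tm D \<Xi> (tysub D \<Xi> (FC F \<Gamma>) (FT F \<Gamma> A) (cmp D \<Xi> (FC F \<Delta>) (FC F \<Gamma>) (FS F \<Delta> \<Gamma> \<gamma>) \<delta>));
    T = tysub D \<Xi> (FC F \<Delta>) (FT F \<Delta> (tysub C \<Delta> \<Gamma> A \<gamma>)) \<delta>\<rbrakk>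
   \<Longrightarrow> th_app \<Delta> \<Gamma> A \<gamma> \<Xi> \<delta> x \<in> Tm D \<Xi> T"
  using ctx by (simp add: th_app_def fcalc target.app_in target.iso_hom th_iso)

lemma th_unapp_in:
  "\<lbrakk>x \<in> Tm D \<Xi> (tysub D \<Xi> (FC F \<Delta>) (FT F \<Delta> (tysub C \<Delta> \<Gamma> A \<gamma>)) \<delta>);
    T = tysub D \<Xi> (FC F \<Gamma>) (FT F \<Gamma> A) (cmp D \<Xi> (FC F \<Delta>) (FC F \<Gamma>) (FS F \<Delta> \<Gamma> \<gamma>) \<delta>)\<rbrakk>
   \<Longrightarrow> th_unapp \<Delta> \<Gamma> A \<gamma> \<Xi> \<delta> x \<in> Tm D \<Xi> T"
  using ctx by (simp add: th_unapp_def fcalc target.app_in target.iso_hom target.ty_inv_hom th_iso)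

lemma th_unapp_th_app:
  "x \<in> Tm D \<Xi> (tysub D \<Xi> (FC F \<Gamma>) (FT F \<Gamma> A) (cmp D \<Xi> (FC F \<Delta>) (FC F \<Gamma>) (FS F \<Delta> \<Gamma> \<gamma>) \<delta>))
   \<Longrightarrow> th_unapp \<Delta> \<Gamma> A \<gamma> \<Xi> \<delta> (th_app \<Delta> \<Gamma> A \<gamma> \<Xi> \<delta> x) = x"
  using ctx by (simp add: th_app_def th_unapp_def fcalc target.app_inv th_iso)

lemma th_app_th_unapp:
  "x \<in> Tm D \<Xi> (tysub D \<Xi> (FC F \<Delta>) (FT F \<Delta> (tysub C \<Delta> \<Gamma> A \<gamma>)) \<delta>)
   \<Longrightarrow> th_app \<Delta> \<Gamma> A \<gamma> \<Xi> \<delta> (th_unapp \<Delta> \<Gamma> A \<gamma> \<Xi> \<delta> x) = x"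
  using ctx by (simp add: th_app_def th_unapp_def fcalc target.app_inv th_iso)

lemma th_app_tmsub:
  assumes "x \<in> Tm D \<Xi> (tysub D \<Xi> (FC F \<Gamma>) (FT F \<Gamma> A) (cmp D \<Xi> (FC F \<Delta>) (FC F \<Gamma>) (FS F \<Delta> \<Gamma> \<gamma>) \<delta>))"
    and "\<Theta> \<in> Ctx D" "\<epsilon> \<in> Sub D \<Theta> \<Xi>"
    and "T = tysub D \<Xi> (FC F \<Delta>) (FT F \<Delta> (tysub C \<Delta> \<Gamma> A \<gamma>)) \<delta>"
    and "T' = tysub D \<Xi> (FC F \<Gamma>) (FT F \<Gamma> A) (cmp D \<Xi> (FC F \<Delta>) (FC F \<Gamma>) (FS F \<Delta> \<Gamma> \<gamma>) \<delta>)"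
  shows "tmsub D \<Theta> \<Xi> T (th_app \<Delta> \<Gamma> A \<gamma> \<Xi> \<delta> x) \<epsilon>
    = th_app \<Delta> \<Gamma> A \<gamma> \<Theta> (cmp D \<Theta> \<Xi> (FC F \<Delta>) \<delta> \<epsilon>) (tmsub D \<Theta> \<Xi> T' x \<epsilon>)"
  using ctx assms by (simp add: th_app_def fcalc target.app_tmsub target.iso_hom th_iso)

end

text \<open>The law of \<theta> for composites, read on terms. The reindexing along F\<delta> turns
  into a change of the point at which \<theta> is evaluated.\<close>

lemma th_app_cmp:
  assumes "\<Xi> \<in> Ctx C" "\<Delta> \<in> Ctx C" "\<Gamma> \<in> Ctx C" "\<delta> \<in> Sub C \<Xi> \<Delta>" "\<gamma> \<in> Sub C \<Delta> \<Gamma>" "A \<in> Ty C \<Gamma>"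
    and "\<Omega> \<in> Ctx D" "\<epsilon> \<in> Sub D \<Omega> (FC F \<Xi>)"
    and "x \<in> Tm D \<Omega> (tysub D \<Omega> (FC F \<Gamma>) (FT F \<Gamma> A)
      (cmp D \<Omega> (FC F \<Xi>) (FC F \<Gamma>) (FS F \<Xi> \<Gamma> (cmp C \<Xi> \<Delta> \<Gamma> \<gamma> \<delta>)) \<epsilon>))"
    and T: "T = tysub C \<Delta> \<Gamma> A \<gamma>"
  shows "th_app \<Xi> \<Gamma> A (cmp C \<Xi> \<Delta> \<Gamma> \<gamma> \<delta>) \<Omega> \<epsilon> x =
    th_app \<Xi> \<Delta> T \<delta> \<Omega> \<epsilon>
      (th_app \<Delta> \<Gamma> A \<gamma> \<Omega> (cmp D \<Omega> (FC F \<Xi>) (FC F \<Delta>) (FS F \<Xi> \<Delta> \<delta>) \<epsilon>) x)"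
proof -
  let ?FA = "tysub D (FC F \<Delta>) (FC F \<Gamma>) (FT F \<Gamma> A) (FS F \<Delta> \<Gamma> \<gamma>)"
  let ?FA' = "FT F \<Delta> (tysub C \<Delta> \<Gamma> A \<gamma>)"
  let ?r = "ty_reindex D (FC F \<Xi>) (FC F \<Delta>) ?FA ?FA' (FS F \<Xi> \<Delta> \<delta>) (th F \<Delta> \<Gamma> A \<gamma>)"
  have th: "th F \<Delta> \<Gamma> A \<gamma> \<in> ty_hom D (FC F \<Delta>) ?FA ?FA'"
    using assms by (intro target.iso_hom th_iso)
  have th': "th F \<Xi> \<Delta> T \<delta> \<in> ty_hom D (FC F \<Xi>)
      (tysub D (FC F \<Xi>) (FC F \<Delta>) (FT F \<Delta> T) (FS F \<Xi> \<Delta> \<delta>))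
      (FT F \<Xi> (tysub C \<Xi> \<Delta> T \<delta>))"
    using assms by (intro target.iso_hom th_iso) (simp_all add: fcalc)
  have r: "?r \<in> ty_hom D (FC F \<Xi>)
      (tysub D (FC F \<Xi>) (FC F \<Delta>) ?FA (FS F \<Xi> \<Delta> \<delta>))
      (tysub D (FC F \<Xi>) (FC F \<Delta>) ?FA' (FS F \<Xi> \<Delta> \<delta>))"
    using assms th by (intro target.ty_reindex_hom) (simp_all add: fcalc)
  have ty: "tysub D (FC F \<Xi>) (FC F \<Gamma>) (FT F \<Gamma> A) (FS F \<Xi> \<Gamma> (cmp C \<Xi> \<Delta> \<Gamma> \<gamma> \<delta>))
      = tysub D (FC F \<Xi>) (FC F \<Delta>) ?FA (FS F \<Xi> \<Delta> \<delta>)"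
    "tysub C \<Xi> \<Gamma> A (cmp C \<Xi> \<Delta> \<Gamma> \<gamma> \<delta>) = tysub C \<Xi> \<Delta> (tysub C \<Delta> \<Gamma> A \<gamma>) \<delta>"
    using assms by (simp_all add: fcalc FS_cmp)
  have x: "x \<in> Tm D \<Omega> (tysub D \<Omega> (FC F \<Xi>) (tysub D (FC F \<Xi>) (FC F \<Delta>) ?FA (FS F \<Xi> \<Delta> \<delta>)) \<epsilon>)"
    using assms by (simp add: fcalc FS_cmp)
  have "th_app \<Xi> \<Gamma> A (cmp C \<Xi> \<Delta> \<Gamma> \<gamma> \<delta>) \<Omega> \<epsilon> x =
    target.app (FC F \<Xi>) (tysub D (FC F \<Xi>) (FC F \<Delta>) ?FA' (FS F \<Xi> \<Delta> \<delta>))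
      (FT F \<Xi> (tysub C \<Xi> \<Delta> (tysub C \<Delta> \<Gamma> A \<gamma>) \<delta>)) \<Omega> (th F \<Xi> \<Delta> (tysub C \<Delta> \<Gamma> A \<gamma>) \<delta>) \<epsilon>
      (target.app (FC F \<Xi>) (tysub D (FC F \<Xi>) (FC F \<Delta>) ?FA (FS F \<Xi> \<Delta> \<delta>))
        (tysub D (FC F \<Xi>) (FC F \<Delta>) ?FA' (FS F \<Xi> \<Delta> \<delta>)) \<Omega> ?r \<epsilon> x)"
    \<comment> \<open>The types must keep the iterated form A[..][..] by which the reindexed
      \<theta> is indexed, so collapsing substitutions is switched off here.\<close>
    unfolding th_app_def th_cmp[OF assms(1-6) refl refl] ty
    by (rule target.app_ty_cmp)
      (use assms th' r x in \<open>simp_all add: fcalc del: target.tysub_cmp[symmetric] source.tysub_cmp[symmetric]\<close>)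
  also have "target.app (FC F \<Xi>) (tysub D (FC F \<Xi>) (FC F \<Delta>) ?FA (FS F \<Xi> \<Delta> \<delta>))
        (tysub D (FC F \<Xi>) (FC F \<Delta>) ?FA' (FS F \<Xi> \<Delta> \<delta>)) \<Omega> ?r \<epsilon> x =
      th_app \<Delta> \<Gamma> A \<gamma> \<Omega> (cmp D \<Omega> (FC F \<Xi>) (FC F \<Delta>) (FS F \<Xi> \<Delta> \<delta>) \<epsilon>) x"
    unfolding th_app_def
    by (rule target.app_ty_reindex) (use assms th x in \<open>simp_all add: fcalc FS_cmp\<close>)
  finally show ?thesis
    by (simp add: th_app_def T)
qed

lemma FM_tmsub':
  assumes "\<Delta> \<in> Ctx C" "\<Gamma> \<in> Ctx C" "\<gamma> \<in> Sub C \<Delta> \<Gamma>" "A \<in> Ty C \<Gamma>" "a \<in> Tm C \<Gamma> A"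
    "T = tysub C \<Delta> \<Gamma> A \<gamma>"
  shows "FM F \<Delta> T (tmsub C \<Delta> \<Gamma> A a \<gamma>) = th_app \<Delta> \<Gamma> A \<gamma> (FC F \<Delta>) (idn D (FC F \<Delta>))
    (tmsub D (FC F \<Delta>) (FC F \<Gamma>) (FT F \<Gamma> A) (FM F \<Gamma> A a) (FS F \<Delta> \<Gamma> \<gamma>))"
  using assms by (simp add: FM_tmsub th_app_def target.ty_app_eq)

subsection \<open>Preservation of context comprehension\<close>

definition fpr :: "'c \<Rightarrow> 't \<Rightarrow> 'u" where
  "fpr \<Gamma> A = FS F (ext C \<Gamma> A) \<Gamma> (pr C \<Gamma> A)"

text \<open>The image of q has type F(A[p]). Transported back along \<theta> it gets type FA[Fp] and
  so can serve as generic term of a comprehension of FA.\<close>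

definition fvr :: "'c \<Rightarrow> 't \<Rightarrow> 'n" where
  "fvr \<Gamma> A = th_unapp (ext C \<Gamma> A) \<Gamma> A (pr C \<Gamma> A) (FC F (ext C \<Gamma> A)) (idn D (FC F (ext C \<Gamma> A)))
     (FM F (ext C \<Gamma> A) (tysub C (ext C \<Gamma> A) \<Gamma> A (pr C \<Gamma> A)) (vr C \<Gamma> A))"

context
  fixes \<Gamma> A
  assumes \<Gamma>: "\<Gamma> \<in> Ctx C" and A: "A \<in> Ty C \<Gamma>"
begin

lemma fcomprehension:
  "comprehension D (FC F \<Gamma>) (FT F \<Gamma> A) (FC F (ext C \<Gamma> A)) (fpr \<Gamma> A) (fvr \<Gamma> A)"
  using FC_comprehension[OF \<Gamma> A refl refl refl]
  by (simp add: fpr_def fvr_def th_unapp_def target.ty_app_eq)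

lemma fpr_in: "fpr \<Gamma> A \<in> Sub D (FC F (ext C \<Gamma> A)) (FC F \<Gamma>)"
  and fvr_in: "T = tysub D (FC F (ext C \<Gamma> A)) (FC F \<Gamma>) (FT F \<Gamma> A) (fpr \<Gamma> A)
    \<Longrightarrow> fvr \<Gamma> A \<in> Tm D (FC F (ext C \<Gamma> A)) T"
  using comprehensionD[OF fcomprehension] by blast+

lemma th_app_fvr:
  "th_app (ext C \<Gamma> A) \<Gamma> A (pr C \<Gamma> A) (FC F (ext C \<Gamma> A)) (idn D (FC F (ext C \<Gamma> A))) (fvr \<Gamma> A)
    = FM F (ext C \<Gamma> A) (tysub C (ext C \<Gamma> A) \<Gamma> A (pr C \<Gamma> A)) (vr C \<Gamma> A)"
  unfolding fvr_def using \<Gamma> A by (intro th_app_th_unapp) (simp_all add: fcalc source.vr_in)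

lemma funique:
  assumes "\<Delta> \<in> Ctx D" "\<sigma> \<in> Sub D \<Delta> (FC F (ext C \<Gamma> A))" "\<tau> \<in> Sub D \<Delta> (FC F (ext C \<Gamma> A))"
    and "cmp D \<Delta> (FC F (ext C \<Gamma> A)) (FC F \<Gamma>) (fpr \<Gamma> A) \<sigma> = cmp D \<Delta> (FC F (ext C \<Gamma> A)) (FC F \<Gamma>) (fpr \<Gamma> A) \<tau>"
    and "tmsub D \<Delta> (FC F (ext C \<Gamma> A)) (tysub D (FC F (ext C \<Gamma> A)) (FC F \<Gamma>) (FT F \<Gamma> A) (fpr \<Gamma> A)) (fvr \<Gamma> A) \<sigma>
      = tmsub D \<Delta> (FC F (ext C \<Gamma> A)) (tysub D (FC F (ext C \<Gamma> A)) (FC F \<Gamma>) (FT F \<Gamma> A) (fpr \<Gamma> A)) (fvr \<Gamma> A) \<tau>"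
  shows "\<sigma> = \<tau>"
  by (rule target.comprehension_unique[OF fcomprehension]) (use assms \<Gamma> A in \<open>simp_all add: fcalc\<close>)

text \<open>Two comprehensions of the same context and type are isomorphic by the substitution that
  matches projections and generic terms.\<close>

lemma rho_pair_iso:
  defines "\<rho> \<equiv> pair D (FC F (ext C \<Gamma> A)) (FC F \<Gamma>) (FT F \<Gamma> A) (fpr \<Gamma> A) (fvr \<Gamma> A)"
  obtains \<sigma> where "\<sigma> \<in> Sub D (ext D (FC F \<Gamma>) (FT F \<Gamma> A)) (FC F (ext C \<Gamma> A))"
    "inverse_sub D (FC F (ext C \<Gamma> A)) (ext D (FC F \<Gamma>) (FT F \<Gamma> A)) \<rho> \<sigma>"
proof -
  let ?F\<Gamma> = "FC F \<Gamma>" and ?FA = "FT F \<Gamma> A" and ?FE = "FC F (ext C \<Gamma> A)"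
  let ?E = "ext D ?F\<Gamma> ?FA"
  have mem: "?F\<Gamma> \<in> Ctx D" "?FA \<in> Ty D ?F\<Gamma>" "?FE \<in> Ctx D" "?E \<in> Ctx D"
    using \<Gamma> A by (simp_all add: fcalc)
  have fvr: "fvr \<Gamma> A \<in> Tm D ?FE (tysub D ?FE ?F\<Gamma> ?FA (fpr \<Gamma> A))"
    by (simp add: fvr_in)
  \<comment> \<open>The inverse is the pairing of p and q formed in the comprehension
    F(\<Gamma>.A).\<close>
  obtain \<sigma> where \<sigma>: "\<sigma> \<in> Sub D ?E ?FE" "cmp D ?E ?FE ?F\<Gamma> (fpr \<Gamma> A) \<sigma> = pr D ?F\<Gamma> ?FA"
    "tmsub D ?E ?FE (tysub D ?FE ?F\<Gamma> ?FA (fpr \<Gamma> A)) (fvr \<Gamma> A) \<sigma> = vr D ?F\<Gamma> ?FA"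
    using mem by (elim comprehension_ex[OF fcomprehension, of ?E "pr D ?F\<Gamma> ?FA" "vr D ?F\<Gamma> ?FA"])
      (simp_all add: fcalc target.vr_in)
  have \<rho>: "\<rho> \<in> Sub D ?FE ?E"
    unfolding \<rho>_def using mem fpr_in fvr by (simp add: fcalc)
  have "cmp D ?E ?FE ?E \<rho> \<sigma> = idn D ?E"
    unfolding \<rho>_def using mem fpr_in fvr \<sigma> by (simp add: target.pair_cmp target.pair_pr_vr)
  moreover have "cmp D ?FE ?E ?FE \<sigma> \<rho> = idn D ?FE"
  proof (rule funique)
    have "cmp D ?FE ?FE ?F\<Gamma> (fpr \<Gamma> A) (cmp D ?FE ?E ?FE \<sigma> \<rho>) = cmp D ?FE ?E ?F\<Gamma> (pr D ?F\<Gamma> ?FA) \<rho>"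
      using mem \<sigma> \<rho> fpr_in by (subst target.cmp_assoc[symmetric]) auto
    also have "\<dots> = fpr \<Gamma> A"
      unfolding \<rho>_def using mem fpr_in fvr by (simp add: fcalc)
    finally show "cmp D ?FE ?FE ?F\<Gamma> (fpr \<Gamma> A) (cmp D ?FE ?E ?FE \<sigma> \<rho>) = cmp D ?FE ?FE ?F\<Gamma> (fpr \<Gamma> A) (idn D ?FE)"
      using mem fpr_in by (simp add: fcalc)
    let ?T = "tysub D ?FE ?F\<Gamma> ?FA (fpr \<Gamma> A)"
    have "tmsub D ?FE ?FE ?T (fvr \<Gamma> A) (cmp D ?FE ?E ?FE \<sigma> \<rho>)
        = tmsub D ?FE ?E (tysub D ?E ?FE ?T \<sigma>) (tmsub D ?E ?FE ?T (fvr \<Gamma> A) \<sigma>) \<rho>"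
      using mem \<sigma>(1) \<rho> fpr_in fvr by (intro target.tmsub_cmp) (simp_all add: fcalc)
    also have "\<dots> = tmsub D ?FE ?E (tysub D ?E ?F\<Gamma> ?FA (pr D ?F\<Gamma> ?FA)) (vr D ?F\<Gamma> ?FA) \<rho>"
      using mem \<sigma> fpr_in by (simp add: fcalc)
    also have "\<dots> = fvr \<Gamma> A"
      unfolding \<rho>_def using mem fpr_in fvr by (simp add: fcalc)
    finally show "tmsub D ?FE ?FE ?T (fvr \<Gamma> A) (cmp D ?FE ?E ?FE \<sigma> \<rho>) = tmsub D ?FE ?FE ?T (fvr \<Gamma> A) (idn D ?FE)"
      using mem fpr_in fvr by (simp add: fcalc)
  qed (use mem \<sigma> \<rho> in \<open>simp_all add: fcalc\<close>)
  ultimately show thesis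
    using that \<sigma>(1) by (simp add: inverse_sub_def)
qed

text \<open>Replaces the definite description by a pairing that can be computed with. The two
  equations describing \<rho> fix p o \<rho> directly and q[\<rho>] up to \<theta>.\<close>

lemma rho_eq: "rho C D F \<Gamma> A = pair D (FC F (ext C \<Gamma> A)) (FC F \<Gamma>) (FT F \<Gamma> A) (fpr \<Gamma> A) (fvr \<Gamma> A)"
proof -
  let ?F\<Gamma> = "FC F \<Gamma>" and ?FA = "FT F \<Gamma> A" and ?FE = "FC F (ext C \<Gamma> A)"
  let ?E = "ext D ?F\<Gamma> ?FA"
  let ?p = "pr D ?F\<Gamma> ?FA" and ?q = "vr D ?F\<Gamma> ?FA"
  let ?\<rho> = "pair D ?FE ?F\<Gamma> ?FA (fpr \<Gamma> A) (fvr \<Gamma> A)"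
  let ?T = "tysub D ?E ?F\<Gamma> ?FA ?p"
  have mem: "?F\<Gamma> \<in> Ctx D" "?FA \<in> Ty D ?F\<Gamma>" "?FE \<in> Ctx D" "?E \<in> Ctx D"
    using \<Gamma> A by (simp_all add: fcalc)
  have fvr: "fvr \<Gamma> A \<in> Tm D ?FE (tysub D ?FE ?F\<Gamma> ?FA (fpr \<Gamma> A))"
    by (simp add: fvr_in)
  have "(THE \<rho>. \<rho> \<in> iso_sub D ?FE ?E \<and> fpr \<Gamma> A = cmp D ?FE ?E ?F\<Gamma> ?p \<rho> \<and>
      FM F (ext C \<Gamma> A) (tysub C (ext C \<Gamma> A) \<Gamma> A (pr C \<Gamma> A)) (vr C \<Gamma> A) =
      th_app (ext C \<Gamma> A) \<Gamma> A (pr C \<Gamma> A) ?FE (idn D ?FE) (tmsub D ?FE ?E ?T ?q \<rho>)) = ?\<rho>"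
  proof (rule the_equality, intro conjI)
    show "?\<rho> \<in> iso_sub D ?FE ?E"
      using rho_pair_iso mem fvr fpr_in by (auto simp: iso_sub_def fcalc)
    show "fpr \<Gamma> A = cmp D ?FE ?E ?F\<Gamma> ?p ?\<rho>"
      using mem fpr_in fvr by (simp add: fcalc)
    show "FM F (ext C \<Gamma> A) (tysub C (ext C \<Gamma> A) \<Gamma> A (pr C \<Gamma> A)) (vr C \<Gamma> A) =
      th_app (ext C \<Gamma> A) \<Gamma> A (pr C \<Gamma> A) ?FE (idn D ?FE) (tmsub D ?FE ?E ?T ?q ?\<rho>)"
      using mem fpr_in fvr by (simp add: fcalc th_app_fvr)
    fix \<rho> assume \<rho>: "\<rho> \<in> iso_sub D ?FE ?E \<and> fpr \<Gamma> A = cmp D ?FE ?E ?F\<Gamma> ?p \<rho> \<and>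
      FM F (ext C \<Gamma> A) (tysub C (ext C \<Gamma> A) \<Gamma> A (pr C \<Gamma> A)) (vr C \<Gamma> A) =
      th_app (ext C \<Gamma> A) \<Gamma> A (pr C \<Gamma> A) ?FE (idn D ?FE) (tmsub D ?FE ?E ?T ?q \<rho>)"
    then have in_Sub: "\<rho> \<in> Sub D ?FE ?E"
      by (simp add: iso_sub_def)
    have "tmsub D ?FE ?E ?T ?q \<rho> \<in> Tm D ?FE (tysub D ?FE ?F\<Gamma> ?FA (cmp D ?FE ?E ?F\<Gamma> ?p \<rho>))"
      using mem in_Sub by (simp add: fcalc target.vr_in)
    \<comment> \<open>Cancelling \<theta> in the equation for Fq determines q[\<rho>].\<close>
    then have "th_unapp (ext C \<Gamma> A) \<Gamma> A (pr C \<Gamma> A) ?FE (idn D ?FE)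
        (th_app (ext C \<Gamma> A) \<Gamma> A (pr C \<Gamma> A) ?FE (idn D ?FE) (tmsub D ?FE ?E ?T ?q \<rho>)) = tmsub D ?FE ?E ?T ?q \<rho>"
      using \<Gamma> A \<rho> fpr_in by (intro th_unapp_th_app) (simp_all add: fcalc fpr_def)
    then have "fvr \<Gamma> A = tmsub D ?FE ?E ?T ?q \<rho>"
      unfolding fvr_def using \<rho> by metis
    then show "\<rho> = ?\<rho>"
      using mem in_Sub \<rho> by (intro target.pair_eqI[symmetric]) auto
  qed
  then show ?thesis
    unfolding rho_def Let_def th_app_def fpr_def target.ty_app_eq .
qed

lemma rho_in: "rho C D F \<Gamma> A \<in> Sub D (FC F (ext C \<Gamma> A)) (ext D (FC F \<Gamma>) (FT F \<Gamma> A))"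
  unfolding rho_eq using \<Gamma> A fpr_in fvr_in by (simp add: fcalc)

lemma rho_inv_in: "rho_inv C D F \<Gamma> A \<in> Sub D (ext D (FC F \<Gamma>) (FT F \<Gamma> A)) (FC F (ext C \<Gamma> A))"
  and rho_inv_inverse: "inverse_sub D (FC F (ext C \<Gamma> A)) (ext D (FC F \<Gamma>) (FT F \<Gamma> A)) (rho C D F \<Gamma> A) (rho_inv C D F \<Gamma> A)"
proof -
  obtain \<sigma> where \<sigma>: "\<sigma> \<in> Sub D (ext D (FC F \<Gamma>) (FT F \<Gamma> A)) (FC F (ext C \<Gamma> A))"
    "inverse_sub D (FC F (ext C \<Gamma> A)) (ext D (FC F \<Gamma>) (FT F \<Gamma> A)) (rho C D F \<Gamma> A) \<sigma>"
    using rho_pair_iso unfolding rho_eq by blast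
  moreover have "rho_inv C D F \<Gamma> A = \<sigma>"
    unfolding rho_inv_def using \<sigma> \<Gamma> A rho_in by (intro target.inv_sub_eqI) (simp_all add: fcalc)
  ultimately show "rho_inv C D F \<Gamma> A \<in> Sub D (ext D (FC F \<Gamma>) (FT F \<Gamma> A)) (FC F (ext C \<Gamma> A))"
    "inverse_sub D (FC F (ext C \<Gamma> A)) (ext D (FC F \<Gamma>) (FT F \<Gamma> A)) (rho C D F \<Gamma> A) (rho_inv C D F \<Gamma> A)"
    by auto
qed

text \<open>Lets the law of a transformation at \<Gamma>.A, which is stated with the inverse of
  \<rho>, be compared with pairings.\<close>

lemma eq_rho_inv_iff:
  assumes "\<Delta> \<in> Ctx D" "\<sigma> \<in> Sub D \<Delta> (FC F (ext C \<Gamma> A))" "\<tau> \<in> Sub D \<Delta> (ext D (FC F \<Gamma>) (FT F \<Gamma> A))"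
  shows "\<sigma> = cmp D \<Delta> (ext D (FC F \<Gamma>) (FT F \<Gamma> A)) (FC F (ext C \<Gamma> A)) (rho_inv C D F \<Gamma> A) \<tau> \<longleftrightarrow>
    cmp D \<Delta> (FC F (ext C \<Gamma> A)) (ext D (FC F \<Gamma>) (FT F \<Gamma> A)) (rho C D F \<Gamma> A) \<sigma> = \<tau>"
proof -
  let ?FE = "FC F (ext C \<Gamma> A)" and ?E = "ext D (FC F \<Gamma>) (FT F \<Gamma> A)"
  have mem: "?FE \<in> Ctx D" "?E \<in> Ctx D"
    using \<Gamma> A by (simp_all add: fcalc)
  have "cmp D \<Delta> ?E ?FE (rho_inv C D F \<Gamma> A) (cmp D \<Delta> ?FE ?E (rho C D F \<Gamma> A) \<sigma>) = \<sigma>"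
    using assms mem rho_in rho_inv_in rho_inv_inverse
    by (subst target.cmp_assoc[symmetric]) (simp_all add: inverse_sub_def fcalc)
  moreover have "cmp D \<Delta> ?FE ?E (rho C D F \<Gamma> A) (cmp D \<Delta> ?E ?FE (rho_inv C D F \<Gamma> A) \<tau>) = \<tau>"
    using assms mem rho_in rho_inv_in rho_inv_inverse
    by (subst target.cmp_assoc[symmetric]) (simp_all add: inverse_sub_def fcalc)
  ultimately show ?thesis
    by metis
qed

lemma rho_cmp:
  assumes "\<Delta> \<in> Ctx D" "\<sigma> \<in> Sub D \<Delta> (FC F (ext C \<Gamma> A))"
  shows "cmp D \<Delta> (FC F (ext C \<Gamma> A)) (ext D (FC F \<Gamma>) (FT F \<Gamma> A)) (rho C D F \<Gamma> A) \<sigma> =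
    pair D \<Delta> (FC F \<Gamma>) (FT F \<Gamma> A) (cmp D \<Delta> (FC F (ext C \<Gamma> A)) (FC F \<Gamma>) (fpr \<Gamma> A) \<sigma>)
      (tmsub D \<Delta> (FC F (ext C \<Gamma> A)) (tysub D (FC F (ext C \<Gamma> A)) (FC F \<Gamma>) (FT F \<Gamma> A) (fpr \<Gamma> A)) (fvr \<Gamma> A) \<sigma>)"
  unfolding rho_eq using assms \<Gamma> A fpr_in fvr_in by (simp add: target.pair_cmp fcalc)

text \<open>F(q[\<sigma>]) is (Fq)[F\<sigma>] up to \<theta> at \<sigma>, and Fq is
  \<open>fvr\<close> up to \<theta> at p. By the law for composites the two isomorphisms merge into
  \<theta> at p o \<sigma>.\<close>

lemma th_app_fvr_FS:
  assumes \<Delta>: "\<Delta> \<in> Ctx C" and \<sigma>: "\<sigma> \<in> Sub C \<Delta> (ext C \<Gamma> A)" and \<gamma>: "cmp C \<Delta> (ext C \<Gamma> A) \<Gamma> (pr C \<Gamma> A) \<sigma> = \<gamma>"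
  shows "th_app \<Delta> \<Gamma> A \<gamma> (FC F \<Delta>) (idn D (FC F \<Delta>))
      (tmsub D (FC F \<Delta>) (FC F (ext C \<Gamma> A)) (tysub D (FC F (ext C \<Gamma> A)) (FC F \<Gamma>) (FT F \<Gamma> A) (fpr \<Gamma> A))
        (fvr \<Gamma> A) (FS F \<Delta> (ext C \<Gamma> A) \<sigma>))
    = FM F \<Delta> (tysub C \<Delta> \<Gamma> A \<gamma>)
        (tmsub C \<Delta> (ext C \<Gamma> A) (tysub C (ext C \<Gamma> A) \<Gamma> A (pr C \<Gamma> A)) (vr C \<Gamma> A) \<sigma>)"
proof -
  let ?E = "ext C \<Gamma> A" and ?p = "pr C \<Gamma> A" and ?F\<Delta> = "FC F \<Delta>"
  let ?A = "tysub C ?E \<Gamma> A ?p" and ?FE = "FC F ?E" and ?F\<sigma> = "FS F \<Delta> ?E \<sigma>"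
  let ?x = "tmsub D ?F\<Delta> ?FE (tysub D ?FE (FC F \<Gamma>) (FT F \<Gamma> A) (fpr \<Gamma> A)) (fvr \<Gamma> A) ?F\<sigma>"
  have fvr: "fvr \<Gamma> A \<in> Tm D ?FE (tysub D ?FE (FC F \<Gamma>) (FT F \<Gamma> A) (FS F ?E \<Gamma> ?p))"
    using fvr_in by (simp add: fpr_def)
  have "tysub C \<Delta> \<Gamma> A \<gamma> = tysub C \<Delta> ?E ?A \<sigma>"
    using assms \<Gamma> A by (simp add: fcalc)
  then have "FM F \<Delta> (tysub C \<Delta> \<Gamma> A \<gamma>) (tmsub C \<Delta> ?E ?A (vr C \<Gamma> A) \<sigma>)
      = th_app \<Delta> ?E ?A \<sigma> ?F\<Delta> (idn D ?F\<Delta>) (tmsub D ?F\<Delta> ?FE (FT F ?E ?A) (FM F ?E ?A (vr C \<Gamma> A)) ?F\<sigma>)"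
    using assms \<Gamma> A by (intro FM_tmsub') (simp_all add: fcalc source.vr_in)
  also have "tmsub D ?F\<Delta> ?FE (FT F ?E ?A) (FM F ?E ?A (vr C \<Gamma> A)) ?F\<sigma>
      = th_app ?E \<Gamma> A ?p ?F\<Delta> (cmp D ?F\<Delta> ?F\<Delta> ?FE ?F\<sigma> (idn D ?F\<Delta>)) ?x"
    unfolding th_app_fvr[symmetric] using assms \<Gamma> A fvr fpr_in
    by (subst th_app_tmsub) (simp_all add: fcalc fpr_def)
  also have "th_app \<Delta> ?E ?A \<sigma> ?F\<Delta> (idn D ?F\<Delta>) \<dots> = th_app \<Delta> \<Gamma> A (cmp C \<Delta> ?E \<Gamma> ?p \<sigma>) ?F\<Delta> (idn D ?F\<Delta>) ?x"
    using assms(1,2) \<Gamma> A fvr by (intro th_app_cmp[symmetric]) (simp_all add: fcalc fpr_def FS_cmp)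
  finally show ?thesis
    by (simp add: \<gamma>)
qed

end

end

section \<open>Strict cwf-morphisms\<close>

text \<open>Preservation on the nose is easy to check for the interpretation of variables. That it
  implies the laws up to isomorphism is proved once, in general.\<close>

locale strict_cwf_morphism = source: cwf C + target: cwf D
  for C :: "('c, 's, 't, 'm) cwf_data"
    and D :: "('d, 'u, 'v, 'n) cwf_data" +
  fixes F :: "('c, 's, 't, 'm, 'd, 'u, 'v, 'n) cwf_map"
  assumes FC_in: "\<Gamma> \<in> Ctx C \<Longrightarrow> FC F \<Gamma> \<in> Ctx D"
    and FS_in: "\<lbrakk>\<Delta> \<in> Ctx C; \<Gamma> \<in> Ctx C; \<gamma> \<in> Sub C \<Delta> \<Gamma>\<rbrakk>
      \<Longrightarrow> FS F \<Delta> \<Gamma> \<gamma> \<in> Sub D (FC F \<Delta>) (FC F \<Gamma>)"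
    and FS_idn: "\<Gamma> \<in> Ctx C \<Longrightarrow> FS F \<Gamma> \<Gamma> (idn C \<Gamma>) = idn D (FC F \<Gamma>)"
    and FS_cmp: "\<lbrakk>\<Xi> \<in> Ctx C; \<Delta> \<in> Ctx C; \<Gamma> \<in> Ctx C; \<delta> \<in> Sub C \<Xi> \<Delta>; \<gamma> \<in> Sub C \<Delta> \<Gamma>\<rbrakk>
      \<Longrightarrow> FS F \<Xi> \<Gamma> (cmp C \<Xi> \<Delta> \<Gamma> \<gamma> \<delta>)
            = cmp D (FC F \<Xi>) (FC F \<Delta>) (FC F \<Gamma>) (FS F \<Delta> \<Gamma> \<gamma>) (FS F \<Xi> \<Delta> \<delta>)"
    and FT_in: "\<lbrakk>\<Gamma> \<in> Ctx C; A \<in> Ty C \<Gamma>\<rbrakk> \<Longrightarrow> FT F \<Gamma> A \<in> Ty D (FC F \<Gamma>)"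
    and FM_in: "\<lbrakk>\<Gamma> \<in> Ctx C; A \<in> Ty C \<Gamma>; a \<in> Tm C \<Gamma> A\<rbrakk>
      \<Longrightarrow> FM F \<Gamma> A a \<in> Tm D (FC F \<Gamma>) (FT F \<Gamma> A)"
    and FT_tysub: "\<lbrakk>\<Delta> \<in> Ctx C; \<Gamma> \<in> Ctx C; \<gamma> \<in> Sub C \<Delta> \<Gamma>; A \<in> Ty C \<Gamma>\<rbrakk>
      \<Longrightarrow> FT F \<Delta> (tysub C \<Delta> \<Gamma> A \<gamma>) = tysub D (FC F \<Delta>) (FC F \<Gamma>) (FT F \<Gamma> A) (FS F \<Delta> \<Gamma> \<gamma>)"
    and FM_tmsub: "\<lbrakk>\<Delta> \<in> Ctx C; \<Gamma> \<in> Ctx C; \<gamma> \<in> Sub C \<Delta> \<Gamma>; A \<in> Ty C \<Gamma>; a \<in> Tm C \<Gamma> A\<rbrakk>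
      \<Longrightarrow> FM F \<Delta> (tysub C \<Delta> \<Gamma> A \<gamma>) (tmsub C \<Delta> \<Gamma> A a \<gamma>)
            = tmsub D (FC F \<Delta>) (FC F \<Gamma>) (FT F \<Gamma> A) (FM F \<Gamma> A a) (FS F \<Delta> \<Gamma> \<gamma>)"
    and FC_emp: "FC F (emp C) = emp D"
    and FC_ext: "\<lbrakk>\<Gamma> \<in> Ctx C; A \<in> Ty C \<Gamma>\<rbrakk> \<Longrightarrow> FC F (ext C \<Gamma> A) = ext D (FC F \<Gamma>) (FT F \<Gamma> A)"
    and FS_pr: "\<lbrakk>\<Gamma> \<in> Ctx C; A \<in> Ty C \<Gamma>\<rbrakk> \<Longrightarrow> FS F (ext C \<Gamma> A) \<Gamma> (pr C \<Gamma> A) = pr D (FC F \<Gamma>) (FT F \<Gamma> A)"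
    and FM_vr: "\<lbrakk>\<Gamma> \<in> Ctx C; A \<in> Ty C \<Gamma>\<rbrakk>
      \<Longrightarrow> FM F (ext C \<Gamma> A) (tysub C (ext C \<Gamma> A) \<Gamma> A (pr C \<Gamma> A)) (vr C \<Gamma> A) = vr D (FC F \<Gamma>) (FT F \<Gamma> A)"
    and th_strict: "\<lbrakk>\<Delta> \<in> Ctx C; \<Gamma> \<in> Ctx C; \<gamma> \<in> Sub C \<Delta> \<Gamma>; A \<in> Ty C \<Gamma>\<rbrakk>
      \<Longrightarrow> th F \<Delta> \<Gamma> A \<gamma> = idn D (ext D (FC F \<Delta>) (tysub D (FC F \<Delta>) (FC F \<Gamma>) (FT F \<Gamma> A) (FS F \<Delta> \<Gamma> \<gamma>)))"
begin

lemmas fcalc = FC_in FS_in FT_in FM_in source.calc target.calc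

text \<open>Here F(\<Gamma>.A) is the chosen extension and \<theta> at p is an identity, so any
  candidate for \<rho> has projections p and q and hence is <p, q> = id.\<close>

lemma rho_strict:
  assumes \<Gamma>: "\<Gamma> \<in> Ctx C" and A: "A \<in> Ty C \<Gamma>"
  shows "rho C D F \<Gamma> A = idn D (ext D (FC F \<Gamma>) (FT F \<Gamma> A))"
    and "rho_inv C D F \<Gamma> A = idn D (ext D (FC F \<Gamma>) (FT F \<Gamma> A))"
proof -
  let ?F\<Gamma> = "FC F \<Gamma>" and ?FA = "FT F \<Gamma> A"
  let ?E = "ext D ?F\<Gamma> ?FA" and ?p = "pr D ?F\<Gamma> ?FA" and ?q = "vr D ?F\<Gamma> ?FA"
  let ?T = "tysub D ?E ?F\<Gamma> ?FA ?p"
  have mem: "?F\<Gamma> \<in> Ctx D" "?FA \<in> Ty D ?F\<Gamma>" "?E \<in> Ctx D"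
    using \<Gamma> A by (simp_all add: fcalc)
  have T: "FT F (ext C \<Gamma> A) (tysub C (ext C \<Gamma> A) \<Gamma> A (pr C \<Gamma> A)) = ?T"
    using \<Gamma> A by (simp add: FT_tysub fcalc FS_pr FC_ext)
  have th: "th F (ext C \<Gamma> A) \<Gamma> A (pr C \<Gamma> A) = idn D (ext D ?E ?T)"
    using \<Gamma> A by (simp add: th_strict fcalc FS_pr FC_ext)
  have app: "target.app ?E ?T ?T ?E (idn D (ext D ?E ?T)) (idn D ?E) (tmsub D ?E ?E ?T ?q \<rho>) = tmsub D ?E ?E ?T ?q \<rho>"
    if "\<rho> \<in> Sub D ?E ?E" "cmp D ?E ?E ?F\<Gamma> ?p \<rho> = ?p" for \<rho>
    using mem that by (intro target.app_idn) (simp_all add: fcalc target.vr_in)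
  have "(THE \<rho>. \<rho> \<in> iso_sub D ?E ?E \<and> ?p = cmp D ?E ?E ?F\<Gamma> ?p \<rho> \<and>
      ?q = target.app ?E ?T ?T ?E (idn D (ext D ?E ?T)) (idn D ?E) (tmsub D ?E ?E ?T ?q \<rho>)) = idn D ?E"
  proof (rule the_equality, intro conjI)
    show "idn D ?E \<in> iso_sub D ?E ?E"
      using mem by (auto simp: iso_sub_def inverse_sub_def fcalc)
    show "?p = cmp D ?E ?E ?F\<Gamma> ?p (idn D ?E)"
      using mem by (simp add: fcalc)
    show "?q = target.app ?E ?T ?T ?E (idn D (ext D ?E ?T)) (idn D ?E) (tmsub D ?E ?E ?T ?q (idn D ?E))"
      using mem by (subst app) (simp_all add: fcalc target.vr_in)
    fix \<rho> assume \<rho>: "\<rho> \<in> iso_sub D ?E ?E \<and> ?p = cmp D ?E ?E ?F\<Gamma> ?p \<rho> \<and>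
      ?q = target.app ?E ?T ?T ?E (idn D (ext D ?E ?T)) (idn D ?E) (tmsub D ?E ?E ?T ?q \<rho>)"
    then have in_Sub: "\<rho> \<in> Sub D ?E ?E"
      by (simp add: iso_sub_def)
    with \<rho> app have "?p = cmp D ?E ?E ?F\<Gamma> ?p \<rho>" "?q = tmsub D ?E ?E ?T ?q \<rho>"
      by metis+
    then have "pair D ?E ?F\<Gamma> ?FA ?p ?q = \<rho>"
      using mem in_Sub by (intro target.pair_eqI) auto
    then show "\<rho> = idn D ?E"
      using mem by (simp add: target.pair_pr_vr)
  qed
  then show rho: "rho C D F \<Gamma> A = idn D ?E"
    using \<Gamma> A by (simp add: rho_def Let_def target.ty_app_eq FM_vr FS_pr FC_ext T th)
  show "rho_inv C D F \<Gamma> A = idn D ?E"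
    unfolding rho_inv_def rho using mem \<Gamma> A
    by (simp add: FC_ext, intro target.inv_sub_eqI) (simp_all add: inverse_sub_def fcalc)
qed

lemma map_hom_strict:
  assumes "\<Gamma> \<in> Ctx C" "A \<in> Ty C \<Gamma>" "B \<in> Ty C \<Gamma>" "f \<in> ty_hom C \<Gamma> A B"
  shows "map_hom C D F \<Gamma> A B f = FS F (ext C \<Gamma> A) (ext C \<Gamma> B) f"
proof -
  have "FS F (ext C \<Gamma> A) (ext C \<Gamma> B) f \<in> Sub D (FC F (ext C \<Gamma> A)) (FC F (ext C \<Gamma> B))"
    using assms by (simp add: fcalc source.hom_in)
  then show ?thesis
    using assms by (simp add: map_hom_def Let_def rho_strict FC_ext fcalc)
qed

lemma FS_hom:
  assumes "\<Gamma> \<in> Ctx C" "A \<in> Ty C \<Gamma>" "B \<in> Ty C \<Gamma>" "f \<in> ty_hom C \<Gamma> A B"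
  shows "FS F (ext C \<Gamma> A) (ext C \<Gamma> B) f \<in> ty_hom D (FC F \<Gamma>) (FT F \<Gamma> A) (FT F \<Gamma> B)"
proof (rule target.homI)
  show "FS F (ext C \<Gamma> A) (ext C \<Gamma> B) f \<in> Sub D (ext D (FC F \<Gamma>) (FT F \<Gamma> A)) (ext D (FC F \<Gamma>) (FT F \<Gamma> B))"
    using assms FS_in[of "ext C \<Gamma> A" "ext C \<Gamma> B" f] by (simp add: fcalc source.hom_in FC_ext)
  show "cmp D (ext D (FC F \<Gamma>) (FT F \<Gamma> A)) (ext D (FC F \<Gamma>) (FT F \<Gamma> B)) (FC F \<Gamma>) (pr D (FC F \<Gamma>) (FT F \<Gamma> B))
      (FS F (ext C \<Gamma> A) (ext C \<Gamma> B) f) = pr D (FC F \<Gamma>) (FT F \<Gamma> A)"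
    using assms FS_cmp[of "ext C \<Gamma> A" "ext C \<Gamma> B" \<Gamma> f "pr C \<Gamma> B"]
    by (simp add: fcalc source.hom_in source.pr_hom FC_ext FS_pr)
qed

lemma vr_FS:
  assumes "\<Gamma> \<in> Ctx C" "B \<in> Ty C \<Gamma>" "\<Delta> \<in> Ctx C" "\<sigma> \<in> Sub C \<Delta> (ext C \<Gamma> B)"
  shows "tmsub D (FC F \<Delta>) (ext D (FC F \<Gamma>) (FT F \<Gamma> B))
      (tysub D (ext D (FC F \<Gamma>) (FT F \<Gamma> B)) (FC F \<Gamma>) (FT F \<Gamma> B) (pr D (FC F \<Gamma>) (FT F \<Gamma> B)))
      (vr D (FC F \<Gamma>) (FT F \<Gamma> B)) (FS F \<Delta> (ext C \<Gamma> B) \<sigma>) =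
    FM F \<Delta> (tysub C \<Delta> (ext C \<Gamma> B) (tysub C (ext C \<Gamma> B) \<Gamma> B (pr C \<Gamma> B)) \<sigma>)
      (tmsub C \<Delta> (ext C \<Gamma> B) (tysub C (ext C \<Gamma> B) \<Gamma> B (pr C \<Gamma> B)) (vr C \<Gamma> B) \<sigma>)"
  using assms
    FM_tmsub[of \<Delta> "ext C \<Gamma> B" \<sigma> "tysub C (ext C \<Gamma> B) \<Gamma> B (pr C \<Gamma> B)" "vr C \<Gamma> B"]
  by (simp add: FT_tysub FS_pr FM_vr FC_ext source.calc source.vr_in)

text \<open>F(\<delta>^+) = (F\<delta>)^+, with the lift in the target written out as the pairing
  that arises from \<open>app_ty_reindex\<close> at the generic term.\<close>

lemma FS_lift:
  assumes "\<Gamma> \<in> Ctx C" "A \<in> Ty C \<Gamma>" "\<Delta> \<in> Ctx C" "\<delta> \<in> Sub C \<Delta> \<Gamma>"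
  defines "A' \<equiv> tysub C \<Delta> \<Gamma> A \<delta>"
  defines "FA' \<equiv> tysub D (FC F \<Delta>) (FC F \<Gamma>) (FT F \<Gamma> A) (FS F \<Delta> \<Gamma> \<delta>)"
  shows "pair D (ext D (FC F \<Delta>) FA') (FC F \<Gamma>) (FT F \<Gamma> A)
      (cmp D (ext D (FC F \<Delta>) FA') (FC F \<Delta>) (FC F \<Gamma>) (FS F \<Delta> \<Gamma> \<delta>) (pr D (FC F \<Delta>) FA')) (vr D (FC F \<Delta>) FA')
    = FS F (ext C \<Delta> A') (ext C \<Gamma> A) (lift C \<Delta> \<Gamma> A \<delta>)"
proof -
  have A': "A' \<in> Ty C \<Delta>" "FT F \<Delta> A' = FA'"
    using assms by (simp_all add: FT_tysub fcalc)
  then have E: "FC F (ext C \<Delta> A') = ext D (FC F \<Delta>) FA'"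
    using assms by (simp add: FC_ext)
  note lift = source.lift_in[OF assms(1-4) A'_def[THEN meta_eq_to_obj_eq]]
    source.lift_proj[OF assms(1-4) A'_def[THEN meta_eq_to_obj_eq]]
  show ?thesis
  proof (rule target.pair_eqI)
    show "FS F (ext C \<Delta> A') (ext C \<Gamma> A) (lift C \<Delta> \<Gamma> A \<delta>) \<in> Sub D (ext D (FC F \<Delta>) FA') (ext D (FC F \<Gamma>) (FT F \<Gamma> A))"
      using FS_in[OF _ _ lift(1)] assms(1-4) A' by (simp add: E FC_ext source.calc)
    show "cmp D (ext D (FC F \<Delta>) FA') (ext D (FC F \<Gamma>) (FT F \<Gamma> A)) (FC F \<Gamma>) (pr D (FC F \<Gamma>) (FT F \<Gamma> A))
        (FS F (ext C \<Delta> A') (ext C \<Gamma> A) (lift C \<Delta> \<Gamma> A \<delta>)) =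
      cmp D (ext D (FC F \<Delta>) FA') (FC F \<Delta>) (FC F \<Gamma>) (FS F \<Delta> \<Gamma> \<delta>) (pr D (FC F \<Delta>) FA')"
      using FS_cmp[OF _ _ _ lift(1), of \<Gamma> "pr C \<Gamma> A"] FS_cmp[of "ext C \<Delta> A'" \<Delta> \<Gamma> "pr C \<Delta> A'" \<delta>]
        assms(1-4) A' lift(2) by (simp add: E FC_ext FS_pr source.calc)
    have "FM F (ext C \<Delta> A') (tysub C (ext C \<Delta> A') \<Delta> A' (pr C \<Delta> A')) (vr C \<Delta> A') = vr D (FC F \<Delta>) FA'"
      using assms(1-4) A' by (simp add: FM_vr)
    moreover have "tysub C (ext C \<Delta> A') \<Delta> A' (pr C \<Delta> A') =
        tysub C (ext C \<Delta> A') (ext C \<Gamma> A) (tysub C (ext C \<Gamma> A) \<Gamma> A (pr C \<Gamma> A)) (lift C \<Delta> \<Gamma> A \<delta>)"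
      using assms(1-4) A' lift(1,2) by (simp add: source.calc) (simp add: A'_def source.calc)
    ultimately show "tmsub D (ext D (FC F \<Delta>) FA') (ext D (FC F \<Gamma>) (FT F \<Gamma> A))
        (tysub D (ext D (FC F \<Gamma>) (FT F \<Gamma> A)) (FC F \<Gamma>) (FT F \<Gamma> A) (pr D (FC F \<Gamma>) (FT F \<Gamma> A)))
        (vr D (FC F \<Gamma>) (FT F \<Gamma> A)) (FS F (ext C \<Delta> A') (ext C \<Gamma> A) (lift C \<Delta> \<Gamma> A \<delta>)) = vr D (FC F \<Delta>) FA'"
      using vr_FS[OF assms(1,2) _ lift(1)] assms(1-4) A' lift(3) by (simp add: E source.calc)
  qed (use assms in \<open>simp_all add: fcalc\<close>)
qed

text \<open>The content of the naturality law of \<theta> when \<theta> and \<rho> are identities.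
  On the generic term both sides give F(q[f o \<delta>^+]).\<close>

lemma FS_reindex:
  assumes "\<Gamma> \<in> Ctx C" "A \<in> Ty C \<Gamma>" "B \<in> Ty C \<Gamma>" "f \<in> ty_hom C \<Gamma> A B" "\<Delta> \<in> Ctx C" "\<delta> \<in> Sub C \<Delta> \<Gamma>"
  defines "A' \<equiv> tysub C \<Delta> \<Gamma> A \<delta>" and "B' \<equiv> tysub C \<Delta> \<Gamma> B \<delta>"
  shows "FS F (ext C \<Delta> A') (ext C \<Delta> B') (ty_reindex C \<Delta> \<Gamma> A B \<delta> f) =
    ty_reindex D (FC F \<Delta>) (FC F \<Gamma>) (FT F \<Gamma> A) (FT F \<Gamma> B) (FS F \<Delta> \<Gamma> \<delta>) (FS F (ext C \<Gamma> A) (ext C \<Gamma> B) f)"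
proof -
  let ?FA' = "tysub D (FC F \<Delta>) (FC F \<Gamma>) (FT F \<Gamma> A) (FS F \<Delta> \<Gamma> \<delta>)"
  let ?FB' = "tysub D (FC F \<Delta>) (FC F \<Gamma>) (FT F \<Gamma> B) (FS F \<Delta> \<Gamma> \<delta>)"
  let ?E = "ext D (FC F \<Delta>) ?FA'" and ?r = "ty_reindex C \<Delta> \<Gamma> A B \<delta> f" and ?l = "lift C \<Delta> \<Gamma> A \<delta>"
  let ?Ff = "FS F (ext C \<Gamma> A) (ext C \<Gamma> B) f"
  have A': "A' \<in> Ty C \<Delta>" "B' \<in> Ty C \<Delta>" "FT F \<Delta> A' = ?FA'" "FT F \<Delta> B' = ?FB'"
    using assms by (simp_all add: FT_tysub fcalc)
  then have E: "FC F (ext C \<Delta> A') = ?E"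
    using assms by (simp add: FC_ext)
  have mem: "FC F \<Delta> \<in> Ctx D" "FC F \<Gamma> \<in> Ctx D" "?FA' \<in> Ty D (FC F \<Delta>)" "?FB' \<in> Ty D (FC F \<Delta>)" "?E \<in> Ctx D"
    using assms by (simp_all add: fcalc)
  have r: "?r \<in> ty_hom C \<Delta> A' B'"
    using assms by (intro source.ty_reindex_hom) auto
  have Ff: "?Ff \<in> ty_hom D (FC F \<Gamma>) (FT F \<Gamma> A) (FT F \<Gamma> B)"
    using assms by (intro FS_hom)
  have l: "?l \<in> Sub C (ext C \<Delta> A') (ext C \<Gamma> A)"
    using assms by (intro source.lift_in) auto
  have ty: "tysub C (ext C \<Delta> A') (ext C \<Delta> B') (tysub C (ext C \<Delta> B') \<Delta> B' (pr C \<Delta> B')) ?r =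
      tysub C (ext C \<Delta> A') \<Gamma> B (cmp C (ext C \<Delta> A') \<Delta> \<Gamma> \<delta> (pr C \<Delta> A'))"
    using assms(1-6) A' source.hom_in[OF r] source.pr_hom[OF r]
    by (simp add: source.calc) (simp add: B'_def source.calc)
  note lp = source.lift_proj(1)[OF assms(1,2,5,6) A'_def[THEN meta_eq_to_obj_eq]]
  have ty': "tysub C (ext C \<Delta> A') (ext C \<Gamma> B) (tysub C (ext C \<Gamma> B) \<Gamma> B (pr C \<Gamma> B))
      (cmp C (ext C \<Delta> A') (ext C \<Gamma> A) (ext C \<Gamma> B) f ?l) =
      tysub C (ext C \<Delta> A') \<Gamma> B (cmp C (ext C \<Delta> A') \<Delta> \<Gamma> \<delta> (pr C \<Delta> A'))"
    using assms(1-6) A' l lp source.hom_in[OF assms(4)]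
    by (simp add: source.calc source.pr_hom_cmp)
  have q: "tmsub C (ext C \<Delta> A') (ext C \<Delta> B') (tysub C (ext C \<Delta> B') \<Delta> B' (pr C \<Delta> B')) (vr C \<Delta> B') ?r =
      tmsub C (ext C \<Delta> A') (ext C \<Gamma> B) (tysub C (ext C \<Gamma> B) \<Gamma> B (pr C \<Gamma> B)) (vr C \<Gamma> B)
        (cmp C (ext C \<Delta> A') (ext C \<Gamma> A) (ext C \<Gamma> B) f ?l)"
    unfolding ty_reindex_def Let_def A'_def[symmetric] B'_def[symmetric]
    using assms(1-6) A' l ty' source.hom_in[OF assms(4)]
    by (intro source.vr_pair) (simp_all add: source.calc source.vr_in source.pr_hom_cmp lp B'_def)
  show ?thesis
  proof (rule target.hom_eqI)
    show "FS F (ext C \<Delta> A') (ext C \<Delta> B') ?r \<in> ty_hom D (FC F \<Delta>) ?FA' ?FB'"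
      using FS_hom[OF _ _ _ r] assms(1-6) A' by simp
    show "ty_reindex D (FC F \<Delta>) (FC F \<Gamma>) (FT F \<Gamma> A) (FT F \<Gamma> B) (FS F \<Delta> \<Gamma> \<delta>) ?Ff \<in> ty_hom D (FC F \<Delta>) ?FA' ?FB'"
      using assms(1-6) Ff by (intro target.ty_reindex_hom) (simp_all add: fcalc)
    have "target.app (FC F \<Delta>) ?FA' ?FB' ?E (FS F (ext C \<Delta> A') (ext C \<Delta> B') ?r) (pr D (FC F \<Delta>) ?FA') (vr D (FC F \<Delta>) ?FA') =
      tmsub D ?E (ext D (FC F \<Delta>) ?FB') (tysub D (ext D (FC F \<Delta>) ?FB') (FC F \<Delta>) ?FB' (pr D (FC F \<Delta>) ?FB'))
        (vr D (FC F \<Delta>) ?FB') (FS F (ext C \<Delta> A') (ext C \<Delta> B') ?r)"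
      using mem target.hom_in[OF \<open>FS F (ext C \<Delta> A') (ext C \<Delta> B') ?r \<in> _\<close>]
      by (simp add: target.app_def target.pair_pr_vr target.calc)
    also have "\<dots> = FM F (ext C \<Delta> A') (tysub C (ext C \<Delta> A') \<Gamma> B (cmp C (ext C \<Delta> A') \<Delta> \<Gamma> \<delta> (pr C \<Delta> A')))
      (tmsub C (ext C \<Delta> A') (ext C \<Gamma> B) (tysub C (ext C \<Gamma> B) \<Gamma> B (pr C \<Gamma> B)) (vr C \<Gamma> B)
        (cmp C (ext C \<Delta> A') (ext C \<Gamma> A) (ext C \<Gamma> B) f ?l))"
      using vr_FS[OF assms(5) A'(2) _ source.hom_in[OF r]] A' assms(5) E
      unfolding ty q by (simp add: source.calc)
    also have "\<dots> = tmsub D ?E (ext D (FC F \<Gamma>) (FT F \<Gamma> B))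
      (tysub D (ext D (FC F \<Gamma>) (FT F \<Gamma> B)) (FC F \<Gamma>) (FT F \<Gamma> B) (pr D (FC F \<Gamma>) (FT F \<Gamma> B)))
      (vr D (FC F \<Gamma>) (FT F \<Gamma> B)) (cmp D ?E (ext D (FC F \<Gamma>) (FT F \<Gamma> A)) (ext D (FC F \<Gamma>) (FT F \<Gamma> B)) ?Ff
        (FS F (ext C \<Delta> A') (ext C \<Gamma> A) ?l))"
      using vr_FS[OF assms(1,3), of "ext C \<Delta> A'" "cmp C (ext C \<Delta> A') (ext C \<Gamma> A) (ext C \<Gamma> B) f ?l"]
        assms(1-6) A' l E source.hom_in[OF assms(4)] FS_cmp[OF _ _ _ l source.hom_in[OF assms(4)]]
      unfolding ty' by (simp add: source.calc FC_ext)
    also have "\<dots> = target.app (FC F \<Delta>) ?FA' ?FB' ?E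
        (ty_reindex D (FC F \<Delta>) (FC F \<Gamma>) (FT F \<Gamma> A) (FT F \<Gamma> B) (FS F \<Delta> \<Gamma> \<delta>) ?Ff)
        (pr D (FC F \<Delta>) ?FA') (vr D (FC F \<Delta>) ?FA')"
      using FS_lift[OF assms(1,2,5,6)] assms(1-6) mem Ff
      by (subst target.app_ty_reindex)
        (simp_all add: fcalc target.vr_in target.app_def A'_def)
    finally show "target.app (FC F \<Delta>) ?FA' ?FB' ?E (FS F (ext C \<Delta> A') (ext C \<Delta> B') ?r)
        (pr D (FC F \<Delta>) ?FA') (vr D (FC F \<Delta>) ?FA') =
      target.app (FC F \<Delta>) ?FA' ?FB' ?E
        (ty_reindex D (FC F \<Delta>) (FC F \<Gamma>) (FT F \<Gamma> A) (FT F \<Gamma> B) (FS F \<Delta> \<Gamma> \<delta>) ?Ff)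
        (pr D (FC F \<Delta>) ?FA') (vr D (FC F \<Delta>) ?FA')" .
  qed (use mem in auto)
qed

lemma reindex_idn:
  assumes "\<Gamma> \<in> Ctx D" "A \<in> Ty D \<Gamma>" "\<Delta> \<in> Ctx D" "\<gamma> \<in> Sub D \<Delta> \<Gamma>"
  shows "ty_reindex D \<Delta> \<Gamma> A A \<gamma> (idn D (ext D \<Gamma> A)) = idn D (ext D \<Delta> (tysub D \<Delta> \<Gamma> A \<gamma>))"
  by (rule target.hom_eqI[OF _ _ _ target.ty_reindex_hom target.idn_hom])
    (use assms in \<open>simp_all add: target.idn_hom target.app_idn target.app_ty_reindex target.calc target.vr_in\<close>)

sublocale pseudo_cwf_morphism C D F
proof
  show "th F \<Delta> \<Gamma> A \<gamma> \<in> ty_iso D (FC F \<Delta>)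
      (tysub D (FC F \<Delta>) (FC F \<Gamma>) (FT F \<Gamma> A) (FS F \<Delta> \<Gamma> \<gamma>)) (FT F \<Delta> (tysub C \<Delta> \<Gamma> A \<gamma>))"
    if "\<Delta> \<in> Ctx C" "\<Gamma> \<in> Ctx C" "\<gamma> \<in> Sub C \<Delta> \<Gamma>" "A \<in> Ty C \<Gamma>" for \<Delta> \<Gamma> \<gamma> A
    using that by (simp add: th_strict FT_tysub target.idn_iso fcalc)
  show "FM F \<Delta> (tysub C \<Delta> \<Gamma> A \<gamma>) (tmsub C \<Delta> \<Gamma> A a \<gamma>)
      = ty_app D (FC F \<Delta>) (tysub D (FC F \<Delta>) (FC F \<Gamma>) (FT F \<Gamma> A) (FS F \<Delta> \<Gamma> \<gamma>))
          (FT F \<Delta> (tysub C \<Delta> \<Gamma> A \<gamma>)) (th F \<Delta> \<Gamma> A \<gamma>)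
          (tmsub D (FC F \<Delta>) (FC F \<Gamma>) (FT F \<Gamma> A) (FM F \<Gamma> A a) (FS F \<Delta> \<Gamma> \<gamma>))"
    if "\<Delta> \<in> Ctx C" "\<Gamma> \<in> Ctx C" "\<gamma> \<in> Sub C \<Delta> \<Gamma>" "A \<in> Ty C \<Gamma>" "a \<in> Tm C \<Gamma> A" for \<Delta> \<Gamma> \<gamma> A a
    using that by (simp add: th_strict FT_tysub FM_tmsub target.ty_app_eq target.app_idn fcalc)
  show "terminal D (FC F (emp C))"
    by (simp add: FC_emp target.terminal_emp)
  show "th F \<Gamma> \<Gamma> A (idn C \<Gamma>) = idn D (ext D (FC F \<Gamma>) (FT F \<Gamma> A))" if "\<Gamma> \<in> Ctx C" "A \<in> Ty C \<Gamma>" for \<Gamma> A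
    using that by (simp add: th_strict fcalc FS_idn)
  show "comprehension D (FC F \<Gamma>) (FT F \<Gamma> A) (FC F E) (FS F E \<Gamma> p)
      (ty_app D (FC F E) (FT F E A') (tysub D (FC F E) (FC F \<Gamma>) (FT F \<Gamma> A) (FS F E \<Gamma> p))
         (ty_inv D (FC F E) (tysub D (FC F E) (FC F \<Gamma>) (FT F \<Gamma> A) (FS F E \<Gamma> p)) (FT F E A') (th F E \<Gamma> A p))
         (FM F E A' (vr C \<Gamma> A)))"
    if "\<Gamma> \<in> Ctx C" "A \<in> Ty C \<Gamma>" "E = ext C \<Gamma> A" "p = pr C \<Gamma> A" "A' = tysub C E \<Gamma> A p" for \<Gamma> A E p A'
    using that target.comprehension_ext[of "FC F \<Gamma>" "FT F \<Gamma> A"]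
    by (simp add: th_strict FT_tysub FM_vr FS_pr FC_ext target.ty_app_eq target.app_idn target.ty_inv_idn
        target.vr_in fcalc)
  show "th F \<Xi> \<Gamma> A (cmp C \<Xi> \<Delta> \<Gamma> \<gamma> \<delta>)
      = ty_cmp D (FC F \<Xi>) (tysub D (FC F \<Xi>) (FC F \<Delta>) FA\<gamma> (FS F \<Xi> \<Delta> \<delta>))
          (tysub D (FC F \<Xi>) (FC F \<Delta>) (FT F \<Delta> A\<gamma>) (FS F \<Xi> \<Delta> \<delta>))
          (FT F \<Xi> (tysub C \<Xi> \<Delta> A\<gamma> \<delta>))
          (th F \<Xi> \<Delta> A\<gamma> \<delta>)
          (ty_reindex D (FC F \<Xi>) (FC F \<Delta>) FA\<gamma> (FT F \<Delta> A\<gamma>) (FS F \<Xi> \<Delta> \<delta>) (th F \<Delta> \<Gamma> A \<gamma>))"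
    if "\<Xi> \<in> Ctx C" "\<Delta> \<in> Ctx C" "\<Gamma> \<in> Ctx C" "\<delta> \<in> Sub C \<Xi> \<Delta>" "\<gamma> \<in> Sub C \<Delta> \<Gamma>" "A \<in> Ty C \<Gamma>"
      "A\<gamma> = tysub C \<Delta> \<Gamma> A \<gamma>" "FA\<gamma> = tysub D (FC F \<Delta>) (FC F \<Gamma>) (FT F \<Gamma> A) (FS F \<Delta> \<Gamma> \<gamma>)"
    for \<Xi> \<Delta> \<Gamma> \<delta> \<gamma> A A\<gamma> FA\<gamma>
  proof -
    have "A\<gamma> \<in> Ty C \<Delta>" "FA\<gamma> \<in> Ty D (FC F \<Delta>)" "FT F \<Delta> A\<gamma> = FA\<gamma>"
      using that by (simp_all add: FT_tysub fcalc)
    then show ?thesis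
      \<comment> \<open>With \<open>A\<gamma>\<close> and \<open>FA\<gamma>\<close> kept opaque all
        isomorphisms become identities. The two names are unfolded only afterwards, to match the
        types.\<close>
      using that(1-6)
      by (simp add: th_strict reindex_idn ty_cmp_def FT_tysub fcalc)
        (simp add: that(7,8) fcalc FS_cmp reindex_idn)
  qed
  show "ty_cmp D (FC F \<Delta>) FA\<delta> (FT F \<Delta> A\<delta>) (FT F \<Delta> B\<delta>)
        (map_hom C D F \<Delta> A\<delta> B\<delta> (ty_reindex C \<Delta> \<Gamma> A B \<delta> f)) (th F \<Delta> \<Gamma> A \<delta>)
      = ty_cmp D (FC F \<Delta>) FA\<delta> FB\<delta> (FT F \<Delta> B\<delta>) (th F \<Delta> \<Gamma> B \<delta>)
        (ty_reindex D (FC F \<Delta>) (FC F \<Gamma>) (FT F \<Gamma> A) (FT F \<Gamma> B) (FS F \<Delta> \<Gamma> \<delta>) (map_hom C D F \<Gamma> A B f))"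
    if "\<Delta> \<in> Ctx C" "\<Gamma> \<in> Ctx C" "\<delta> \<in> Sub C \<Delta> \<Gamma>" "A \<in> Ty C \<Gamma>" "B \<in> Ty C \<Gamma>" "f \<in> ty_hom C \<Gamma> A B"
      "A\<delta> = tysub C \<Delta> \<Gamma> A \<delta>" "B\<delta> = tysub C \<Delta> \<Gamma> B \<delta>"
      "FA\<delta> = tysub D (FC F \<Delta>) (FC F \<Gamma>) (FT F \<Gamma> A) (FS F \<Delta> \<Gamma> \<delta>)"
      "FB\<delta> = tysub D (FC F \<Delta>) (FC F \<Gamma>) (FT F \<Gamma> B) (FS F \<Delta> \<Gamma> \<delta>)"
    for \<Delta> \<Gamma> \<delta> A B f A\<delta> B\<delta> FA\<delta> FB\<delta>
  proof -
    let ?r = "ty_reindex C \<Delta> \<Gamma> A B \<delta> f" and ?Ff = "FS F (ext C \<Gamma> A) (ext C \<Gamma> B) f"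
    let ?R = "ty_reindex D (FC F \<Delta>) (FC F \<Gamma>) (FT F \<Gamma> A) (FT F \<Gamma> B) (FS F \<Delta> \<Gamma> \<delta>) ?Ff"
    have ty: "A\<delta> \<in> Ty C \<Delta>" "B\<delta> \<in> Ty C \<Delta>" "FT F \<Delta> A\<delta> = FA\<delta>" "FT F \<Delta> B\<delta> = FB\<delta>"
        "FA\<delta> \<in> Ty D (FC F \<Delta>)" "FB\<delta> \<in> Ty D (FC F \<Delta>)"
      using that by (simp_all add: FT_tysub fcalc)
    have "?r \<in> ty_hom C \<Delta> A\<delta> B\<delta>"
      using that by (intro source.ty_reindex_hom) auto
    then have "map_hom C D F \<Delta> A\<delta> B\<delta> ?r = ?R"
      using that ty by (simp add: map_hom_strict FS_reindex)
    moreover have "?R \<in> ty_hom D (FC F \<Delta>) FA\<delta> FB\<delta>"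
      using that ty FS_hom[of \<Gamma> A B f] by (intro target.ty_reindex_hom) (simp_all add: fcalc)
    ultimately show ?thesis
      using that(1-6) ty target.hom_in
      by (simp add: ty_cmp_def map_hom_strict th_strict fcalc flip: that(9,10))
  qed
qed (simp_all add: FC_in FS_in FS_idn FS_cmp FT_in FM_in)

end

section \<open>Interpretation of variables\<close>

locale pointed_cwf = cwf D for D :: "('d, 'u, 'v, 'n) cwf_data" +
  fixes oD :: 'v
  assumes base_in_emp: "oD \<in> Ty D (emp D)"
begin

definition base :: "'d \<Rightarrow> 'v" where
  "base \<Gamma> = tysub D \<Gamma> (emp D) oD (bang \<Gamma>)"

lemma base_in: "\<Gamma> \<in> Ctx D \<Longrightarrow> base \<Gamma> \<in> Ty D \<Gamma>"
  by (simp add: base_def calc bang_in base_in_emp)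

text \<open>Since ! o \<gamma> = !, the types o[!] are stable under substitution on the nose. This
  is why the interpretation can be strict.\<close>

lemma base_tysub: "\<lbrakk>\<Delta> \<in> Ctx D; \<Gamma> \<in> Ctx D; \<gamma> \<in> Sub D \<Delta> \<Gamma>\<rbrakk> \<Longrightarrow> tysub D \<Delta> \<Gamma> (base \<Gamma>) \<gamma> = base \<Delta>"
  by (simp add: base_def calc bang_in base_in_emp bang_cmp)

lemma base_emp: "base (emp D) = oD"
proof -
  have "bang (emp D) = idn D (emp D)"
    by (rule terminal_unique[OF terminal_emp emp_in]) (simp_all add: emp_in bang_in idn_in)
  then show ?thesis
    by (simp add: base_def tysub_idn emp_in base_in_emp)
qed

text \<open>The semantic counterparts of \<open>nf_ctx\<close>, \<open>nf_tm\<close> and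
  \<open>nf_sub\<close>, with the same numbering of variables.\<close>

primrec var_ctx :: "nat \<Rightarrow> 'd" where
  "var_ctx 0 = emp D"
| "var_ctx (Suc n) = ext D (var_ctx n) (base (var_ctx n))"

fun var_tm :: "nat \<Rightarrow> nat \<Rightarrow> 'n" where
  "var_tm 0 i = undefined"
| "var_tm (Suc n) 0 = vr D (var_ctx n) (base (var_ctx n))"
| "var_tm (Suc n) (Suc i) = tmsub D (var_ctx (Suc n)) (var_ctx n) (base (var_ctx n)) (var_tm n i)
     (pr D (var_ctx n) (base (var_ctx n)))"

primrec var_sub :: "nat \<Rightarrow> nat \<Rightarrow> (nat \<Rightarrow> nat) \<Rightarrow> 'u" where
  "var_sub m 0 f = bang (var_ctx m)"
| "var_sub m (Suc n) f =
     pair D (var_ctx m) (var_ctx n) (base (var_ctx n)) (var_sub m n (f \<circ> Suc)) (var_tm m (f 0))"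

lemma var_ctx_in: "var_ctx n \<in> Ctx D"
  by (induction n) (simp_all add: calc base_in)

lemma var_tm_in: "i < n \<Longrightarrow> var_tm n i \<in> Tm D (var_ctx n) (base (var_ctx n))"
  by (induction n i rule: var_tm.induct) (simp_all add: calc vr_in base_in base_tysub var_ctx_in)

lemma var_sub_in: "\<forall>i<n. f i < m \<Longrightarrow> var_sub m n f \<in> Sub D (var_ctx m) (var_ctx n)"
  by (induction n arbitrary: f) (simp_all add: calc base_in base_tysub var_ctx_in bang_in var_tm_in)

text \<open>Substitutions into a context of base types are determined by the images of its
  variables: index 0 gives q[\<sigma>], the others give p o \<sigma>, and pairing is unique. The
  equations between substitutions required of the interpretation thereby reduce to
  variables.\<close>

lemma var_sub_unique:
  assumes "\<sigma> \<in> Sub D (var_ctx m) (var_ctx n)"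
    and "\<forall>i<n. tmsub D (var_ctx m) (var_ctx n) (base (var_ctx n)) (var_tm n i) \<sigma> = var_tm m (f i)"
  shows "\<sigma> = var_sub m n f"
  using assms
proof (induction n arbitrary: \<sigma> f)
  case 0
  then show ?case
    using terminal_unique[OF terminal_emp var_ctx_in[of m]] bang_in var_ctx_in by simp
next
  case (Suc n)
  let ?E = "ext D (var_ctx n) (base (var_ctx n))" and ?p = "pr D (var_ctx n) (base (var_ctx n))"
  have mem: "var_ctx m \<in> Ctx D" "var_ctx n \<in> Ctx D" "base (var_ctx n) \<in> Ty D (var_ctx n)" "?E \<in> Ctx D"
    by (simp_all add: var_ctx_in base_in calc)
  have \<sigma>: "\<sigma> \<in> Sub D (var_ctx m) ?E"
    using Suc.prems(1) by simp
  have base_E: "tysub D ?E (var_ctx n) (base (var_ctx n)) ?p = base ?E"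
    using mem by (simp add: base_tysub calc)
  have "cmp D (var_ctx m) ?E (var_ctx n) ?p \<sigma> = var_sub m n (f \<circ> Suc)"
  proof (rule Suc.IH)
    show "cmp D (var_ctx m) ?E (var_ctx n) ?p \<sigma> \<in> Sub D (var_ctx m) (var_ctx n)"
      using mem \<sigma> by (simp add: calc)
    show "\<forall>i<n. tmsub D (var_ctx m) (var_ctx n) (base (var_ctx n)) (var_tm n i)
        (cmp D (var_ctx m) ?E (var_ctx n) ?p \<sigma>) = var_tm m ((f \<circ> Suc) i)"
    proof (intro allI impI)
      fix i assume "i < n"
      then have "tmsub D (var_ctx m) ?E (base ?E)
          (tmsub D ?E (var_ctx n) (base (var_ctx n)) (var_tm n i) ?p) \<sigma> = var_tm m (f (Suc i))"
        using Suc.prems(2)[rule_format, of "Suc i"] by simp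
      then show "tmsub D (var_ctx m) (var_ctx n) (base (var_ctx n)) (var_tm n i)
          (cmp D (var_ctx m) ?E (var_ctx n) ?p \<sigma>) = var_tm m ((f \<circ> Suc) i)"
        using mem \<sigma> \<open>i < n\<close> var_tm_in base_E by (subst (asm) tmsub_tmsub) (simp_all add: calc)
    qed
  qed
  moreover have "tmsub D (var_ctx m) ?E (base ?E) (vr D (var_ctx n) (base (var_ctx n))) \<sigma> = var_tm m (f 0)"
    using Suc.prems(2)[rule_format, of 0] by simp
  ultimately have "pair D (var_ctx m) (var_ctx n) (base (var_ctx n)) (var_sub m n (f \<circ> Suc)) (var_tm m (f 0)) = \<sigma>"
    using mem \<sigma> base_E by (intro pair_eqI) simp_all
  then show ?case
    by simp
qed

lemma var_tm_sub:
  "\<lbrakk>\<forall>i<n. f i < m; i < n\<rbrakk>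
    \<Longrightarrow> tmsub D (var_ctx m) (var_ctx n) (base (var_ctx n)) (var_tm n i) (var_sub m n f) = var_tm m (f i)"
proof (induction n arbitrary: i f)
  case (Suc n)
  let ?E = "ext D (var_ctx n) (base (var_ctx n))" and ?p = "pr D (var_ctx n) (base (var_ctx n))"
  have mem: "var_ctx m \<in> Ctx D" "var_ctx n \<in> Ctx D" "base (var_ctx n) \<in> Ty D (var_ctx n)" "?E \<in> Ctx D"
    by (simp_all add: var_ctx_in base_in calc)
  have base_E: "base ?E = tysub D ?E (var_ctx n) (base (var_ctx n)) ?p"
    using mem by (simp add: base_tysub calc)
  have f: "\<forall>i<n. (f \<circ> Suc) i < m" "f 0 < m"
    using Suc.prems by auto
  have args: "var_sub m n (f \<circ> Suc) \<in> Sub D (var_ctx m) (var_ctx n)"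
    "var_tm m (f 0) \<in> Tm D (var_ctx m) (tysub D (var_ctx m) (var_ctx n) (base (var_ctx n)) (var_sub m n (f \<circ> Suc)))"
    using f mem var_tm_in by (simp_all add: var_sub_in base_tysub)
  show ?case
  proof (cases i)
    case 0
    then show ?thesis
      using mem args base_E by (simp add: vr_pair)
  next
    case (Suc j)
    then have "j < n"
      using Suc.prems by simp
    then show ?thesis
      using mem args base_E Suc.IH[OF f(1), of j] Suc var_tm_in by (simp add: calc comp_def)
  qed
qed simp

end

subsection \<open>Cwfs of variables\<close>

text \<open>All that is used of the syntactic cwf from here on: numbered contexts, a single type
  \<open>T n\<close> over each, and the n distinct terms \<open>V n i\<close>. Classes of raw
  expressions no longer appear.\<close>

locale variable_cwf = cwf C for C :: "('c, 's, 't, 'm) cwf_data" +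
  fixes N :: "nat \<Rightarrow> 'c" and T :: "nat \<Rightarrow> 't" and V :: "nat \<Rightarrow> nat \<Rightarrow> 'm"
  assumes Ctx_N: "Ctx C = range N"
    and N_inj: "N m = N n \<longleftrightarrow> m = n"
    and Ty_N: "Ty C (N n) = {T n}"
    and Tm_N: "Tm C (N n) (T n) = V n ` {..<n}"
    and V_inj: "\<lbrakk>i < n; j < n\<rbrakk> \<Longrightarrow> V n i = V n j \<longleftrightarrow> i = j"
    and emp_N: "emp C = N 0"
    and ext_N: "ext C (N n) (T n) = N (Suc n)"
    and vr_N: "vr C (N n) (T n) = V (Suc n) 0"
    and V_pr: "i < n \<Longrightarrow> tmsub C (N (Suc n)) (N n) (T n) (V n i) (pr C (N n) (T n)) = V (Suc n) (Suc i)"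
begin

lemma N_in [simp]: "N n \<in> Ctx C"
  by (simp add: Ctx_N)

lemma T_in [simp]: "T n \<in> Ty C (N n)"
  by (simp add: Ty_N)

lemma V_in: "i < n \<Longrightarrow> V n i \<in> Tm C (N n) (T n)"
  by (simp add: Tm_N)

lemma tysub_N [simp]: "\<gamma> \<in> Sub C (N m) (N n) \<Longrightarrow> tysub C (N m) (N n) (T n) \<gamma> = T m"
  using tysub_in[of "N m" "N n" \<gamma> "T n"] by (simp add: Ty_N)

lemma Ctx_cases: assumes "\<Gamma> \<in> Ctx C" obtains n where "\<Gamma> = N n"
  using assms by (auto simp: Ctx_N)

lemma Ty_cases: assumes "A \<in> Ty C (N n)" shows "A = T n"
  using assms by (simp add: Ty_N)

lemma Tm_cases: assumes "a \<in> Tm C (N n) (T n)" obtains i where "i < n" "a = V n i"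
  using assms by (auto simp: Tm_N)

section \<open>Decoding contexts, terms and substitutions\<close>

definition ctx_len :: "'c \<Rightarrow> nat" where
  "ctx_len \<Gamma> = (THE n. \<Gamma> = N n)"

definition var_index :: "nat \<Rightarrow> 'm \<Rightarrow> nat" where
  "var_index n a = (THE i. i < n \<and> a = V n i)"

lemma ctx_len_N [simp]: "ctx_len (N n) = n"
  by (simp add: ctx_len_def N_inj)

lemma var_index_V [simp]: "i < n \<Longrightarrow> var_index n (V n i) = i"
  unfolding var_index_def by (rule the_equality) (auto simp: V_inj)

definition sub_index :: "nat \<Rightarrow> nat \<Rightarrow> 's \<Rightarrow> nat \<Rightarrow> nat" where
  "sub_index m n \<gamma> i = var_index m (tmsub C (N m) (N n) (T n) (V n i) \<gamma>)"

lemma sub_index: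
  assumes "\<gamma> \<in> Sub C (N m) (N n)" "i < n"
  shows "tmsub C (N m) (N n) (T n) (V n i) \<gamma> = V m (sub_index m n \<gamma> i)" and "sub_index m n \<gamma> i < m"
proof -
  have "tmsub C (N m) (N n) (T n) (V n i) \<gamma> \<in> Tm C (N m) (T m)"
    using assms by (simp add: tmsub_in_eq V_in)
  then show "tmsub C (N m) (N n) (T n) (V n i) \<gamma> = V m (sub_index m n \<gamma> i)" "sub_index m n \<gamma> i < m"
    unfolding sub_index_def by (auto elim!: Tm_cases)
qed

lemma pr_N: "pr C (N n) (T n) \<in> Sub C (N (Suc n)) (N n)"
  using pr_in[of "N n" "T n"] by (simp add: ext_N)

text \<open>The successor in \<open>th\<close> comes from \<theta> being the identity of the
  extension of the image of \<Delta> by o[!], which is the context of variables one longer.\<close>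

definition interp :: "('d, 'u, 'v, 'n) cwf_data \<Rightarrow> 'v \<Rightarrow> ('c, 's, 't, 'm, 'd, 'u, 'v, 'n) cwf_map" where
  "interp D oD = \<lparr>
     FC = (\<lambda>\<Gamma>. pointed_cwf.var_ctx D oD (ctx_len \<Gamma>)),
     FS = (\<lambda>\<Delta> \<Gamma> \<gamma>. pointed_cwf.var_sub D oD (ctx_len \<Delta>) (ctx_len \<Gamma>) (sub_index (ctx_len \<Delta>) (ctx_len \<Gamma>) \<gamma>)),
     FT = (\<lambda>\<Gamma> A. pointed_cwf.base D oD (pointed_cwf.var_ctx D oD (ctx_len \<Gamma>))),
     FM = (\<lambda>\<Gamma> A a. pointed_cwf.var_tm D oD (ctx_len \<Gamma>) (var_index (ctx_len \<Gamma>) a)),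
     th = (\<lambda>\<Delta> \<Gamma> A \<gamma>. idn D (pointed_cwf.var_ctx D oD (Suc (ctx_len \<Delta>))))\<rparr>"

text \<open>Identities, composites and projections are preserved because both sides have the same
  effect on variables, by \<open>var_sub_unique\<close>.\<close>

lemma strict_interp:
  assumes "pointed_cwf D oD"
  shows "strict_cwf_morphism C D (interp D oD)"
proof -
  interpret D: pointed_cwf D oD by fact
  let ?F = "interp D oD"
  have FC: "FC ?F (N n) = D.var_ctx n" and FT: "FT ?F (N n) A = D.base (D.var_ctx n)"
    and FM: "FM ?F (N n) A a = D.var_tm n (var_index n a)"
    and FS: "FS ?F (N m) (N n) \<gamma> = D.var_sub m n (sub_index m n \<gamma>)"
    and th: "th ?F (N m) \<Gamma> A \<gamma> = idn D (ext D (D.var_ctx m) (D.base (D.var_ctx m)))" for m n A a \<gamma> \<Gamma>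
    by (simp_all add: interp_def)
  note F = FC FT FM FS th
  have var_sub: "D.var_sub m n (sub_index m n \<gamma>) \<in> Sub D (D.var_ctx m) (D.var_ctx n)"
    if "\<gamma> \<in> Sub C (N m) (N n)" for m n \<gamma>
    using that by (intro D.var_sub_in) (simp add: sub_index)
  have var_tm_sub: "tmsub D (D.var_ctx m) (D.var_ctx n) (D.base (D.var_ctx n)) (D.var_tm n i)
      (D.var_sub m n (sub_index m n \<gamma>)) = D.var_tm m (sub_index m n \<gamma> i)"
    if "\<gamma> \<in> Sub C (N m) (N n)" "i < n" for m n \<gamma> i
    using that by (intro D.var_tm_sub) (simp_all add: sub_index)
  have pr_index: "sub_index (Suc n) n (pr C (N n) (T n)) i = Suc i" if "i < n" for n i
    using that by (simp add: sub_index_def V_pr)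
  note D_in = D.var_ctx_in D.base_in D.calc
  show ?thesis
  proof
    show "FC ?F \<Gamma> \<in> Ctx D" if "\<Gamma> \<in> Ctx C" for \<Gamma>
      using that by (auto elim!: Ctx_cases simp: F D_in)
    show "FS ?F \<Delta> \<Gamma> \<gamma> \<in> Sub D (FC ?F \<Delta>) (FC ?F \<Gamma>)"
      if "\<Delta> \<in> Ctx C" "\<Gamma> \<in> Ctx C" "\<gamma> \<in> Sub C \<Delta> \<Gamma>" for \<Delta> \<Gamma> \<gamma>
      using that by (auto elim!: Ctx_cases simp: F var_sub)
    show "FS ?F \<Gamma> \<Gamma> (idn C \<Gamma>) = idn D (FC ?F \<Gamma>)" if "\<Gamma> \<in> Ctx C" for \<Gamma>
    proof -
      from that obtain n where \<Gamma>: "\<Gamma> = N n"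
        by (rule Ctx_cases)
      have "idn D (D.var_ctx n) = D.var_sub n n (sub_index n n (idn C (N n)))"
        by (rule D.var_sub_unique) (simp_all add: D_in D.var_tm_in sub_index_def tmsub_idn V_in)
      then show ?thesis
        by (simp add: \<Gamma> F)
    qed
    show "FS ?F \<Xi> \<Gamma> (cmp C \<Xi> \<Delta> \<Gamma> \<gamma> \<delta>) =
        cmp D (FC ?F \<Xi>) (FC ?F \<Delta>) (FC ?F \<Gamma>) (FS ?F \<Delta> \<Gamma> \<gamma>) (FS ?F \<Xi> \<Delta> \<delta>)"
      if "\<Xi> \<in> Ctx C" "\<Delta> \<in> Ctx C" "\<Gamma> \<in> Ctx C" "\<delta> \<in> Sub C \<Xi> \<Delta>" "\<gamma> \<in> Sub C \<Delta> \<Gamma>" for \<Xi> \<Delta> \<Gamma> \<delta> \<gamma>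
    proof -
      from that obtain k m n where ctx: "\<Xi> = N k" "\<Delta> = N m" "\<Gamma> = N n"
        by (metis Ctx_cases)
      note [simp] = that(4,5)[unfolded ctx]
      have "cmp D (D.var_ctx k) (D.var_ctx m) (D.var_ctx n) (D.var_sub m n (sub_index m n \<gamma>)) (D.var_sub k m (sub_index k m \<delta>))
        = D.var_sub k n (sub_index k n (cmp C (N k) (N m) (N n) \<gamma> \<delta>))" (is "?\<sigma> = _")
      proof (rule D.var_sub_unique)
        show "?\<sigma> \<in> Sub D (D.var_ctx k) (D.var_ctx n)"
          by (simp add: D_in var_sub)
        show "\<forall>i<n. tmsub D (D.var_ctx k) (D.var_ctx n) (D.base (D.var_ctx n)) (D.var_tm n i) ?\<sigma>
            = D.var_tm k (sub_index k n (cmp C (N k) (N m) (N n) \<gamma> \<delta>) i)"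
        proof (intro allI impI)
          fix i assume i: "i < n"
          have "tmsub C (N k) (N n) (T n) (V n i) (cmp C (N k) (N m) (N n) \<gamma> \<delta>)
              = tmsub C (N k) (N m) (T m) (tmsub C (N m) (N n) (T n) (V n i) \<gamma>) \<delta>"
            using i by (simp add: tmsub_cmp V_in)
          then have "sub_index k n (cmp C (N k) (N m) (N n) \<gamma> \<delta>) i = sub_index k m \<delta> (sub_index m n \<gamma> i)"
            using i by (simp add: sub_index_def[of k n] sub_index)
          moreover have "tmsub D (D.var_ctx k) (D.var_ctx n) (D.base (D.var_ctx n)) (D.var_tm n i) ?\<sigma> =
              tmsub D (D.var_ctx k) (D.var_ctx m) (D.base (D.var_ctx m))
                (tmsub D (D.var_ctx m) (D.var_ctx n) (D.base (D.var_ctx n)) (D.var_tm n i) (D.var_sub m n (sub_index m n \<gamma>)))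
                (D.var_sub k m (sub_index k m \<delta>))"
            using i by (subst D.tmsub_cmp) (simp_all add: D_in var_sub D.var_tm_in D.base_tysub)
          ultimately show "tmsub D (D.var_ctx k) (D.var_ctx n) (D.base (D.var_ctx n)) (D.var_tm n i) ?\<sigma>
            = D.var_tm k (sub_index k n (cmp C (N k) (N m) (N n) \<gamma> \<delta>) i)"
            using i by (simp add: var_tm_sub sub_index)
        qed
      qed
      then show ?thesis
        by (simp add: ctx F)
    qed
    show "FT ?F \<Gamma> A \<in> Ty D (FC ?F \<Gamma>)" if "\<Gamma> \<in> Ctx C" "A \<in> Ty C \<Gamma>" for \<Gamma> A
      using that by (auto elim!: Ctx_cases simp: F D_in)
    show "FM ?F \<Gamma> A a \<in> Tm D (FC ?F \<Gamma>) (FT ?F \<Gamma> A)" if "\<Gamma> \<in> Ctx C" "A \<in> Ty C \<Gamma>" "a \<in> Tm C \<Gamma> A" for \<Gamma> A a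
      using that by (auto elim!: Ctx_cases dest!: Ty_cases simp: F D.var_tm_in Tm_N)
    show "FT ?F \<Delta> (tysub C \<Delta> \<Gamma> A \<gamma>) = tysub D (FC ?F \<Delta>) (FC ?F \<Gamma>) (FT ?F \<Gamma> A) (FS ?F \<Delta> \<Gamma> \<gamma>)"
      if "\<Delta> \<in> Ctx C" "\<Gamma> \<in> Ctx C" "\<gamma> \<in> Sub C \<Delta> \<Gamma>" "A \<in> Ty C \<Gamma>" for \<Delta> \<Gamma> \<gamma> A
      using that by (auto elim!: Ctx_cases simp: F D.base_tysub D_in var_sub)
    show "FM ?F \<Delta> (tysub C \<Delta> \<Gamma> A \<gamma>) (tmsub C \<Delta> \<Gamma> A a \<gamma>) =
        tmsub D (FC ?F \<Delta>) (FC ?F \<Gamma>) (FT ?F \<Gamma> A) (FM ?F \<Gamma> A a) (FS ?F \<Delta> \<Gamma> \<gamma>)"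
      if "\<Delta> \<in> Ctx C" "\<Gamma> \<in> Ctx C" "\<gamma> \<in> Sub C \<Delta> \<Gamma>" "A \<in> Ty C \<Gamma>" "a \<in> Tm C \<Gamma> A" for \<Delta> \<Gamma> \<gamma> A a
      using that by (auto elim!: Ctx_cases dest!: Ty_cases simp: F Tm_N var_tm_sub sub_index)
    show "FC ?F (emp C) = emp D"
      by (simp add: emp_N F)
    show "FC ?F (ext C \<Gamma> A) = ext D (FC ?F \<Gamma>) (FT ?F \<Gamma> A)" if "\<Gamma> \<in> Ctx C" "A \<in> Ty C \<Gamma>" for \<Gamma> A
      using that by (auto elim!: Ctx_cases dest!: Ty_cases simp: F ext_N)
    show "FS ?F (ext C \<Gamma> A) \<Gamma> (pr C \<Gamma> A) = pr D (FC ?F \<Gamma>) (FT ?F \<Gamma> A)" if "\<Gamma> \<in> Ctx C" "A \<in> Ty C \<Gamma>" for \<Gamma> A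
    proof -
      from that obtain n where \<Gamma>: "\<Gamma> = N n" "A = T n"
        by (metis Ctx_cases Ty_cases)
      have "pr D (D.var_ctx n) (D.base (D.var_ctx n)) = D.var_sub (Suc n) n (sub_index (Suc n) n (pr C (N n) (T n)))"
        by (rule D.var_sub_unique) (simp_all add: D_in pr_index)
      then show ?thesis
        by (simp add: \<Gamma> F ext_N)
    qed
    show "FM ?F (ext C \<Gamma> A) (tysub C (ext C \<Gamma> A) \<Gamma> A (pr C \<Gamma> A)) (vr C \<Gamma> A) = vr D (FC ?F \<Gamma>) (FT ?F \<Gamma> A)"
      if "\<Gamma> \<in> Ctx C" "A \<in> Ty C \<Gamma>" for \<Gamma> A
      using that by (auto elim!: Ctx_cases dest!: Ty_cases simp: F ext_N vr_N)
    show "th ?F \<Delta> \<Gamma> A \<gamma> = idn D (ext D (FC ?F \<Delta>) (tysub D (FC ?F \<Delta>) (FC ?F \<Gamma>) (FT ?F \<Gamma> A) (FS ?F \<Delta> \<Gamma> \<gamma>)))"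
      if "\<Delta> \<in> Ctx C" "\<Gamma> \<in> Ctx C" "\<gamma> \<in> Sub C \<Delta> \<Gamma>" "A \<in> Ty C \<Gamma>" for \<Delta> \<Gamma> \<gamma> A
      using that by (auto elim!: Ctx_cases simp: F D.base_tysub D_in var_sub)
  qed
qed

lemma arrow_exists:
  assumes "pointed_cwf D oD"
  shows "(interp D oD, idn D (ext D (emp D) oD)) \<in> cwfo_arr (C, T 0) (D, oD)"
proof -
  interpret D: pointed_cwf D oD by fact
  interpret strict_cwf_morphism C D "interp D oD"
    using assms by (rule strict_interp)
  have "FC (interp D oD) (emp C) = emp D" "FT (interp D oD) (emp C) (T 0) = oD"
    by (simp_all add: interp_def emp_N D.base_emp)
  \<comment> \<open>The empty context is preserved strictly, so \<open>!_F\<close> is an identity,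
    F(o)[\<open>!_F\<close>] is the given base type, and the identity serves as the required
    isomorphism.\<close>
  moreover have "bang_map C D (interp D oD) = idn D (emp D)"
  proof (rule D.terminal_unique[OF D.terminal_emp])
    show "bang_map C D (interp D oD) \<in> Sub D (emp D) (emp D)"
      unfolding bang_map_def FC_emp by (rule D.terminal_the[OF D.terminal_emp D.emp_in])
  qed (simp_all add: D.calc)
  ultimately have "base_image C (T 0) D (interp D oD) = oD"
    by (simp add: base_image_def D.calc D.base_in_emp)
  then show ?thesis
    using pseudo_cwf_morphism_axioms by (simp add: cwfo_arr_def D.idn_iso D.emp_in D.base_in_emp)
qed

end

lemma variable_cwf_syn: "variable_cwf syn_cwf syn_ctx syn_ty syn_tm"
proof -
  interpret cwf syn_cwf by (rule cwf_syn)
  show ?thesis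
    by unfold_locales (auto simp: syn_simps Tm_syn syn_tm_eq_iff)
qed

lemma syn_base_eq: "syn_base = syn_ty 0"
proof -
  have "CEmp \<turnstile>\<^sub>t TBase \<approx> base_ty CEmp"
    by (rule ty_base[OF base_cong])
  then show ?thesis
    unfolding syn_base_def emp_syn syn_ty_def ty_rel_eq by (auto intro: ty_sym ty_trans)
qed

section \<open>Pseudo cwf-transformations\<close>

context pseudo_cwf_morphism
begin

lemma th_app_idn:
  assumes "\<Gamma> \<in> Ctx C" "A \<in> Ty C \<Gamma>" "\<Xi> \<in> Ctx D" "\<delta> \<in> Sub D \<Xi> (FC F \<Gamma>)"
    "x \<in> Tm D \<Xi> (tysub D \<Xi> (FC F \<Gamma>) (FT F \<Gamma> A) \<delta>)"
  shows "th_app \<Gamma> \<Gamma> A (idn C \<Gamma>) \<Xi> \<delta> x = x"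
  using assms by (simp add: th_app_def th_idn FS_idn fcalc target.app_idn)

text \<open>Variant of \<open>hom_eqI\<close> testing on the generic term over F(\<Gamma>.A), where
  the equations of a transformation live, instead of over F\<Gamma>.FA. The substitution between the
  two comprehensions carries one test to the other.\<close>

lemma hom_eqI_fpr:
  assumes \<Gamma>: "\<Gamma> \<in> Ctx C" and A: "A \<in> Ty C \<Gamma>" and B: "B \<in> Ty D (FC F \<Gamma>)"
    and f: "f \<in> ty_hom D (FC F \<Gamma>) (FT F \<Gamma> A) B" and g: "g \<in> ty_hom D (FC F \<Gamma>) (FT F \<Gamma> A) B"
    and eq: "target.app (FC F \<Gamma>) (FT F \<Gamma> A) B (FC F (ext C \<Gamma> A)) f (fpr \<Gamma> A) (fvr \<Gamma> A)
      = target.app (FC F \<Gamma>) (FT F \<Gamma> A) B (FC F (ext C \<Gamma> A)) g (fpr \<Gamma> A) (fvr \<Gamma> A)"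
  shows "f = g"
proof -
  let ?F\<Gamma> = "FC F \<Gamma>" and ?FA = "FT F \<Gamma> A" and ?FE = "FC F (ext C \<Gamma> A)"
  let ?E = "ext D ?F\<Gamma> ?FA"
  have mem: "?F\<Gamma> \<in> Ctx D" "?FA \<in> Ty D ?F\<Gamma>" "?FE \<in> Ctx D" "?E \<in> Ctx D"
    using \<Gamma> A by (simp_all add: fcalc)
  note fp = fpr_in[OF \<Gamma> A] fvr_in[OF \<Gamma> A]
  obtain \<sigma> where \<sigma>: "\<sigma> \<in> Sub D ?E ?FE" "cmp D ?E ?FE ?F\<Gamma> (fpr \<Gamma> A) \<sigma> = pr D ?F\<Gamma> ?FA"
    "tmsub D ?E ?FE (tysub D ?FE ?F\<Gamma> ?FA (fpr \<Gamma> A)) (fvr \<Gamma> A) \<sigma> = vr D ?F\<Gamma> ?FA"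
    using mem by (elim comprehension_ex[OF fcomprehension[OF \<Gamma> A], of ?E "pr D ?F\<Gamma> ?FA" "vr D ?F\<Gamma> ?FA"])
      (simp_all add: fcalc target.vr_in)
  have "target.app ?F\<Gamma> ?FA B ?E h (pr D ?F\<Gamma> ?FA) (vr D ?F\<Gamma> ?FA) =
      tmsub D ?E ?FE (tysub D ?FE ?F\<Gamma> B (fpr \<Gamma> A)) (target.app ?F\<Gamma> ?FA B ?FE h (fpr \<Gamma> A) (fvr \<Gamma> A)) \<sigma>"
    if "h \<in> ty_hom D ?F\<Gamma> ?FA B" for h
    using mem fp B that \<sigma> by (simp add: target.app_tmsub)
  then show ?thesis
    using mem B f g eq by (intro target.hom_eqI[of ?F\<Gamma> ?FA B f g]) simp_all
qed

text \<open>Relates the generic terms for A and A[\<gamma>] through F(\<gamma>^+). After applying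
  \<theta> at p both sides become the image of q, because q[\<gamma>^+] = q, and \<theta> at p can
  be cancelled.\<close>

lemma th_app_fvr_lift:
  assumes \<Gamma>: "\<Gamma> \<in> Ctx C" and A: "A \<in> Ty C \<Gamma>" and \<Delta>: "\<Delta> \<in> Ctx C" and \<gamma>: "\<gamma> \<in> Sub C \<Delta> \<Gamma>"
    and A': "A' = tysub C \<Delta> \<Gamma> A \<gamma>"
  shows "th_app \<Delta> \<Gamma> A \<gamma> (FC F (ext C \<Delta> A')) (fpr \<Delta> A')
      (tmsub D (FC F (ext C \<Delta> A')) (FC F (ext C \<Gamma> A)) (tysub D (FC F (ext C \<Gamma> A)) (FC F \<Gamma>) (FT F \<Gamma> A) (fpr \<Gamma> A))
        (fvr \<Gamma> A) (FS F (ext C \<Delta> A') (ext C \<Gamma> A) (lift C \<Delta> \<Gamma> A \<gamma>))) = fvr \<Delta> A'"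
proof -
  let ?E' = "ext C \<Delta> A'" and ?E = "ext C \<Gamma> A" and ?l = "lift C \<Delta> \<Gamma> A \<gamma>"
  define y where "y = tmsub D (FC F ?E') (FC F ?E) (tysub D (FC F ?E) (FC F \<Gamma>) (FT F \<Gamma> A) (fpr \<Gamma> A))
        (fvr \<Gamma> A) (FS F ?E' ?E ?l)"
  note l = source.lift_in[OF \<Gamma> A \<Delta> \<gamma> A'] source.lift_proj[OF \<Gamma> A \<Delta> \<gamma> A']
  have A'_in: "A' \<in> Ty C \<Delta>"
    using assms by (simp add: fcalc)
  have mem: "?E' \<in> Ctx C" "?E \<in> Ctx C"
    using assms by (simp_all add: fcalc)
  have Fpl: "cmp D (FC F ?E') (FC F ?E) (FC F \<Gamma>) (fpr \<Gamma> A) (FS F ?E' ?E ?l)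
      = cmp D (FC F ?E') (FC F \<Delta>) (FC F \<Gamma>) (FS F \<Delta> \<Gamma> \<gamma>) (fpr \<Delta> A')"
    using mem assms l A'_in by (simp add: fpr_def FS_cmp' source.calc)
  note fp = fpr_in[OF \<Gamma> A] fvr_in[OF \<Gamma> A] fpr_in[OF \<Delta> A'_in] fvr_in[OF \<Delta> A'_in]
  have y: "y \<in> Tm D (FC F ?E') (tysub D (FC F ?E') (FC F \<Gamma>) (FT F \<Gamma> A)
      (cmp D (FC F ?E') (FC F \<Delta>) (FC F \<Gamma>) (FS F \<Delta> \<Gamma> \<gamma>) (fpr \<Delta> A')))"
    unfolding y_def using mem assms(1-4) l fp by (simp add: fcalc Fpl)
  let ?x = "th_app \<Delta> \<Gamma> A \<gamma> (FC F ?E') (fpr \<Delta> A') y"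
  have x: "?x \<in> Tm D (FC F ?E') (tysub D (FC F ?E') (FC F \<Delta>) (FT F \<Delta> A') (fpr \<Delta> A'))"
    using mem assms(1-4) fp y A' by (intro th_app_in) (simp_all add: fcalc)
  have "th_app ?E' \<Delta> A' (pr C \<Delta> A') (FC F ?E') (idn D (FC F ?E')) ?x
    = th_app ?E' \<Gamma> A (cmp C ?E' \<Delta> \<Gamma> \<gamma> (pr C \<Delta> A')) (FC F ?E') (idn D (FC F ?E')) y"
    using mem assms A'_in y fp
    by (subst th_app_cmp[of ?E' \<Delta> \<Gamma>]) (simp_all add: fcalc FS_cmp fpr_def)
  also have "\<dots> = FM F ?E' (tysub C ?E' \<Gamma> A (cmp C ?E' \<Delta> \<Gamma> \<gamma> (pr C \<Delta> A'))) (vr C \<Delta> A')"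
    using th_app_fvr_FS[OF \<Gamma> A mem(1) l(1,2)] l(3) by (simp add: y_def)
  also have "\<dots> = FM F ?E' (tysub C ?E' \<Delta> A' (pr C \<Delta> A')) (vr C \<Delta> A')"
    using assms by (simp add: source.calc)
  also have "\<dots> = th_app ?E' \<Delta> A' (pr C \<Delta> A') (FC F ?E') (idn D (FC F ?E')) (fvr \<Delta> A')"
    by (rule th_app_fvr[OF \<Delta> A'_in, symmetric])
  finally have eq: "th_app ?E' \<Delta> A' (pr C \<Delta> A') (FC F ?E') (idn D (FC F ?E')) ?x
    = th_app ?E' \<Delta> A' (pr C \<Delta> A') (FC F ?E') (idn D (FC F ?E')) (fvr \<Delta> A')" .
  have inv: "th_unapp ?E' \<Delta> A' (pr C \<Delta> A') (FC F ?E') (idn D (FC F ?E'))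
      (th_app ?E' \<Delta> A' (pr C \<Delta> A') (FC F ?E') (idn D (FC F ?E')) z) = z"
    if "z \<in> Tm D (FC F ?E') (tysub D (FC F ?E') (FC F \<Delta>) (FT F \<Delta> A') (fpr \<Delta> A'))" for z
    using mem assms(1-4) A'_in that by (intro th_unapp_th_app) (simp_all add: fcalc fpr_def)
  show ?thesis
    using inv[OF x] inv[OF fp(4)[OF refl]] eq unfolding y_def by metis
qed

section \<open>The isomorphism between the terminal contexts\<close>

lemma bang_map_in: "bang_map C D F \<in> Sub D (emp D) (FC F (emp C))"
  unfolding bang_map_def by (rule target.terminal_the[OF FC_terminal target.emp_in])

lemma FC_emp_in: "FC F (emp C) \<in> Ctx D"
  using FC_in source.emp_in by blast

lemma bang_bang_map: "cmp D (emp D) (FC F (emp C)) (emp D) (target.bang (FC F (emp C))) (bang_map C D F) = idn D (emp D)"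
  by (rule target.terminal_unique[OF target.terminal_emp target.emp_in])
    (simp_all add: target.calc target.bang_in bang_map_in FC_emp_in)

lemma bang_map_bang: "cmp D (FC F (emp C)) (emp D) (FC F (emp C)) (bang_map C D F) (target.bang (FC F (emp C))) = idn D (FC F (emp C))"
  by (rule target.terminal_unique[OF FC_terminal FC_emp_in])
    (simp_all add: target.calc target.bang_in bang_map_in FC_emp_in)

end

locale parallel_morphisms = variable_cwf C N T V + target: cwf D +
    F: pseudo_cwf_morphism C D F + G: pseudo_cwf_morphism C D G
  for C :: "('c, 's, 't, 'm) cwf_data" and N T V
    and D :: "('d, 'u, 'v, 'n) cwf_data"
    and F G :: "('c, 's, 't, 'm, 'd, 'u, 'v, 'n) cwf_map"
begin

lemmas pcalc = F.FC_in F.FS_in F.FT_in F.FM_in G.FC_in G.FS_in G.FT_in G.FM_in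
  F.fpr_in F.fvr_in G.fpr_in G.fvr_in calc target.calc

text \<open>The action on terms of the component at \<open>A\<close>, a type over \<open>\<Gamma>\<close>, of a transformation whose
  component at \<open>\<Gamma>\<close> is \<open>\<phi>\<close>.\<close>

abbreviation cell_app :: "'c \<Rightarrow> 't \<Rightarrow> 'u \<Rightarrow> 'u \<Rightarrow> 'd \<Rightarrow> 'u \<Rightarrow> 'n \<Rightarrow> 'n" where
  "cell_app \<Gamma> A \<phi> \<psi> \<equiv> \<lambda>\<Delta>. target.app (FC F \<Gamma>) (FT F \<Gamma> A) (tysub D (FC F \<Gamma>) (FC G \<Gamma>) (FT G \<Gamma> A) \<phi>) \<Delta> \<psi>"

text \<open>The component at \<Gamma>.A that the law of a transformation dictates, given those at
  \<Gamma> and A.\<close>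

definition ext_cell :: "'c \<Rightarrow> 't \<Rightarrow> 'u \<Rightarrow> 'u \<Rightarrow> 'u" where
  "ext_cell \<Gamma> A \<phi> \<psi> =
     cmp D (FC F (ext C \<Gamma> A)) (ext D (FC G \<Gamma>) (FT G \<Gamma> A)) (FC G (ext C \<Gamma> A)) (rho_inv C D G \<Gamma> A)
       (cmp D (FC F (ext C \<Gamma> A)) (ext D (FC F \<Gamma>) (tysub D (FC F \<Gamma>) (FC G \<Gamma>) (FT G \<Gamma> A) \<phi>)) (ext D (FC G \<Gamma>) (FT G \<Gamma> A))
         (lift D (FC F \<Gamma>) (FC G \<Gamma>) (FT G \<Gamma> A) \<phi>)
         (cmp D (FC F (ext C \<Gamma> A)) (ext D (FC F \<Gamma>) (FT F \<Gamma> A))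
           (ext D (FC F \<Gamma>) (tysub D (FC F \<Gamma>) (FC G \<Gamma>) (FT G \<Gamma> A) \<phi>)) \<psi> (rho C D F \<Gamma> A)))"

context
  fixes \<Gamma> A \<phi> \<psi>
  assumes \<Gamma>: "\<Gamma> \<in> Ctx C" and A: "A \<in> Ty C \<Gamma>" and \<phi>: "\<phi> \<in> Sub D (FC F \<Gamma>) (FC G \<Gamma>)"
    and \<psi>: "\<psi> \<in> ty_hom D (FC F \<Gamma>) (FT F \<Gamma> A) (tysub D (FC F \<Gamma>) (FC G \<Gamma>) (FT G \<Gamma> A) \<phi>)"
begin

lemma lift_psi_rho:
  defines "a \<equiv> cell_app \<Gamma> A \<phi> \<psi> (FC F (ext C \<Gamma> A)) (F.fpr \<Gamma> A) (F.fvr \<Gamma> A)"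
  shows "cmp D (FC F (ext C \<Gamma> A)) (ext D (FC F \<Gamma>) (tysub D (FC F \<Gamma>) (FC G \<Gamma>) (FT G \<Gamma> A) \<phi>)) (ext D (FC G \<Gamma>) (FT G \<Gamma> A))
         (lift D (FC F \<Gamma>) (FC G \<Gamma>) (FT G \<Gamma> A) \<phi>)
         (cmp D (FC F (ext C \<Gamma> A)) (ext D (FC F \<Gamma>) (FT F \<Gamma> A))
           (ext D (FC F \<Gamma>) (tysub D (FC F \<Gamma>) (FC G \<Gamma>) (FT G \<Gamma> A) \<phi>)) \<psi> (rho C D F \<Gamma> A))
    = pair D (FC F (ext C \<Gamma> A)) (FC G \<Gamma>) (FT G \<Gamma> A)
        (cmp D (FC F (ext C \<Gamma> A)) (FC F \<Gamma>) (FC G \<Gamma>) \<phi> (F.fpr \<Gamma> A)) a"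
    and "a \<in> Tm D (FC F (ext C \<Gamma> A)) (tysub D (FC F (ext C \<Gamma> A)) (FC G \<Gamma>) (FT G \<Gamma> A)
        (cmp D (FC F (ext C \<Gamma> A)) (FC F \<Gamma>) (FC G \<Gamma>) \<phi> (F.fpr \<Gamma> A)))"
proof -
  show a: "a \<in> Tm D (FC F (ext C \<Gamma> A)) (tysub D (FC F (ext C \<Gamma> A)) (FC G \<Gamma>) (FT G \<Gamma> A)
        (cmp D (FC F (ext C \<Gamma> A)) (FC F \<Gamma>) (FC G \<Gamma>) \<phi> (F.fpr \<Gamma> A)))"
    unfolding a_def using \<Gamma> A \<phi> \<psi> by (intro target.app_in) (simp_all add: pcalc)
  have "cmp D (FC F (ext C \<Gamma> A)) (ext D (FC F \<Gamma>) (FT F \<Gamma> A))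
      (ext D (FC F \<Gamma>) (tysub D (FC F \<Gamma>) (FC G \<Gamma>) (FT G \<Gamma> A) \<phi>)) \<psi> (rho C D F \<Gamma> A) =
    pair D (FC F (ext C \<Gamma> A)) (FC F \<Gamma>) (tysub D (FC F \<Gamma>) (FC G \<Gamma>) (FT G \<Gamma> A) \<phi>) (F.fpr \<Gamma> A) a"
    unfolding F.rho_eq[OF \<Gamma> A] a_def using \<Gamma> A \<phi> \<psi> by (intro target.hom_pair) (simp_all add: pcalc)
  then show "cmp D (FC F (ext C \<Gamma> A)) (ext D (FC F \<Gamma>) (tysub D (FC F \<Gamma>) (FC G \<Gamma>) (FT G \<Gamma> A) \<phi>)) (ext D (FC G \<Gamma>) (FT G \<Gamma> A))
         (lift D (FC F \<Gamma>) (FC G \<Gamma>) (FT G \<Gamma> A) \<phi>)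
         (cmp D (FC F (ext C \<Gamma> A)) (ext D (FC F \<Gamma>) (FT F \<Gamma> A))
           (ext D (FC F \<Gamma>) (tysub D (FC F \<Gamma>) (FC G \<Gamma>) (FT G \<Gamma> A) \<phi>)) \<psi> (rho C D F \<Gamma> A))
    = pair D (FC F (ext C \<Gamma> A)) (FC G \<Gamma>) (FT G \<Gamma> A)
        (cmp D (FC F (ext C \<Gamma> A)) (FC F \<Gamma>) (FC G \<Gamma>) \<phi> (F.fpr \<Gamma> A)) a"
    using \<Gamma> A \<phi> a by (simp add: pcalc target.lift_pair)
qed

lemma ext_cell_in: "ext_cell \<Gamma> A \<phi> \<psi> \<in> Sub D (FC F (ext C \<Gamma> A)) (FC G (ext C \<Gamma> A))"
  unfolding ext_cell_def lift_psi_rho(1) using \<Gamma> A \<phi> lift_psi_rho(2) by (simp add: pcalc G.rho_inv_in)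

text \<open>The component at \<Gamma>.A described by its two projections in the comprehension
  G(\<Gamma>.A). Later arguments use this description and no longer mention \<rho>.\<close>

lemma ext_cell:
  shows fpr_ext_cell: "cmp D (FC F (ext C \<Gamma> A)) (FC G (ext C \<Gamma> A)) (FC G \<Gamma>) (G.fpr \<Gamma> A) (ext_cell \<Gamma> A \<phi> \<psi>)
      = cmp D (FC F (ext C \<Gamma> A)) (FC F \<Gamma>) (FC G \<Gamma>) \<phi> (F.fpr \<Gamma> A)"
    and fvr_ext_cell: "tmsub D (FC F (ext C \<Gamma> A)) (FC G (ext C \<Gamma> A))
        (tysub D (FC G (ext C \<Gamma> A)) (FC G \<Gamma>) (FT G \<Gamma> A) (G.fpr \<Gamma> A)) (G.fvr \<Gamma> A) (ext_cell \<Gamma> A \<phi> \<psi>)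
      = cell_app \<Gamma> A \<phi> \<psi> (FC F (ext C \<Gamma> A)) (F.fpr \<Gamma> A) (F.fvr \<Gamma> A)"
proof -
  let ?FE = "FC F (ext C \<Gamma> A)" and ?GE = "FC G (ext C \<Gamma> A)" and ?\<chi> = "ext_cell \<Gamma> A \<phi> \<psi>"
  let ?E = "ext D (FC G \<Gamma>) (FT G \<Gamma> A)" and ?p = "pr D (FC G \<Gamma>) (FT G \<Gamma> A)"
  let ?a = "cell_app \<Gamma> A \<phi> \<psi> ?FE (F.fpr \<Gamma> A) (F.fvr \<Gamma> A)"
  let ?\<gamma> = "cmp D ?FE (FC F \<Gamma>) (FC G \<Gamma>) \<phi> (F.fpr \<Gamma> A)"
  have a: "?a \<in> Tm D ?FE (tysub D ?FE (FC G \<Gamma>) (FT G \<Gamma> A) ?\<gamma>)"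
    by (rule lift_psi_rho)
  have mem: "?FE \<in> Ctx D" "?GE \<in> Ctx D" "FC G \<Gamma> \<in> Ctx D" "FC F \<Gamma> \<in> Ctx D" "FT G \<Gamma> A \<in> Ty D (FC G \<Gamma>)" "?\<gamma> \<in> Sub D ?FE (FC G \<Gamma>)"
    using \<Gamma> A \<phi> by (simp_all add: pcalc)
  have "cmp D ?FE ?GE ?E (rho C D G \<Gamma> A) ?\<chi> = pair D ?FE (FC G \<Gamma>) (FT G \<Gamma> A) ?\<gamma> ?a"
    using \<Gamma> A mem a ext_cell_in
    by (subst G.eq_rho_inv_iff[symmetric]) (simp_all add: ext_cell_def lift_psi_rho(1) target.pair_in)
  then have eq: "pair D ?FE (FC G \<Gamma>) (FT G \<Gamma> A) (cmp D ?FE ?GE (FC G \<Gamma>) (G.fpr \<Gamma> A) ?\<chi>)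
      (tmsub D ?FE ?GE (tysub D ?GE (FC G \<Gamma>) (FT G \<Gamma> A) (G.fpr \<Gamma> A)) (G.fvr \<Gamma> A) ?\<chi>)
    = pair D ?FE (FC G \<Gamma>) (FT G \<Gamma> A) ?\<gamma> ?a" (is "pair D _ _ _ ?\<gamma>' ?a' = _")
    using \<Gamma> A mem ext_cell_in by (simp add: G.rho_cmp)
  have mem': "?\<gamma>' \<in> Sub D ?FE (FC G \<Gamma>)" "?a' \<in> Tm D ?FE (tysub D ?FE (FC G \<Gamma>) (FT G \<Gamma> A) ?\<gamma>')"
    using \<Gamma> A mem ext_cell_in by (simp_all add: pcalc)
  show "?\<gamma>' = ?\<gamma>"
    using arg_cong[OF eq, of "cmp D ?FE ?E (FC G \<Gamma>) ?p"] mem mem' a by (simp add: target.pr_pair)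
  show "?a' = ?a"
    using arg_cong[OF eq, of "tmsub D ?FE ?E (tysub D ?E (FC G \<Gamma>) (FT G \<Gamma> A) ?p) (vr D (FC G \<Gamma>) (FT G \<Gamma> A))"]
      mem mem' a by (simp add: target.vr_pair)
qed

end

lemma transformation_iff:
  "pseudo_cwf_transformation C D F G \<phi> \<psi> \<longleftrightarrow>
     \<phi> \<in> (\<Pi>\<^sub>E \<Gamma>\<in>Ctx C. Sub D (FC F \<Gamma>) (FC G \<Gamma>)) \<and>
     (\<forall>\<Delta>\<in>Ctx C. \<forall>\<Gamma>\<in>Ctx C. \<forall>\<gamma>\<in>Sub C \<Delta> \<Gamma>.
        cmp D (FC F \<Delta>) (FC F \<Gamma>) (FC G \<Gamma>) (\<phi> \<Gamma>) (FS F \<Delta> \<Gamma> \<gamma>)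
          = cmp D (FC F \<Delta>) (FC G \<Delta>) (FC G \<Gamma>) (FS G \<Delta> \<Gamma> \<gamma>) (\<phi> \<Delta>)) \<and>
     \<psi> \<in> (\<Pi>\<^sub>E \<Gamma>\<in>Ctx C. \<Pi>\<^sub>E A\<in>Ty C \<Gamma>.
            ty_iso D (FC F \<Gamma>) (FT F \<Gamma> A) (tysub D (FC F \<Gamma>) (FC G \<Gamma>) (FT G \<Gamma> A) (\<phi> \<Gamma>))) \<and>
     (\<forall>\<Gamma>\<in>Ctx C. \<forall>A\<in>Ty C \<Gamma>. \<phi> (ext C \<Gamma> A) = ext_cell \<Gamma> A (\<phi> \<Gamma>) (\<psi> \<Gamma> A))"
  unfolding pseudo_cwf_transformation_def ext_cell_def Let_def ..

subsection \<open>Uniqueness\<close>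

text \<open>Naturality at \<open>\<gamma>\<^sup>+\<close> expresses the component at \<open>A[\<gamma>]\<close> through the one at \<open>A\<close>.\<close>

lemma transformation_tysub:
  assumes cell: "pseudo_cwf_transformation C D F G \<phi> \<psi>"
    and \<Gamma>: "\<Gamma> \<in> Ctx C" and A: "A \<in> Ty C \<Gamma>" and \<Delta>: "\<Delta> \<in> Ctx C" and \<gamma>: "\<gamma> \<in> Sub C \<Delta> \<Gamma>"
    and A': "A' = tysub C \<Delta> \<Gamma> A \<gamma>"
  shows "cell_app \<Delta> A' (\<phi> \<Delta>) (\<psi> \<Delta> A') (FC F (ext C \<Delta> A')) (F.fpr \<Delta> A') (F.fvr \<Delta> A') =
    G.th_app \<Delta> \<Gamma> A \<gamma> (FC F (ext C \<Delta> A')) (cmp D (FC F (ext C \<Delta> A')) (FC F \<Delta>) (FC G \<Delta>) (\<phi> \<Delta>) (F.fpr \<Delta> A'))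
      (cell_app \<Gamma> A (\<phi> \<Gamma>) (\<psi> \<Gamma> A) (FC F (ext C \<Delta> A'))
        (cmp D (FC F (ext C \<Delta> A')) (FC F \<Delta>) (FC F \<Gamma>) (FS F \<Delta> \<Gamma> \<gamma>) (F.fpr \<Delta> A'))
        (tmsub D (FC F (ext C \<Delta> A')) (FC F (ext C \<Gamma> A)) (tysub D (FC F (ext C \<Gamma> A)) (FC F \<Gamma>) (FT F \<Gamma> A) (F.fpr \<Gamma> A))
          (F.fvr \<Gamma> A) (FS F (ext C \<Delta> A') (ext C \<Gamma> A) (lift C \<Delta> \<Gamma> A \<gamma>))))"
proof -
  let ?E' = "ext C \<Delta> A'" and ?E = "ext C \<Gamma> A" and ?l = "lift C \<Delta> \<Gamma> A \<gamma>"
  have A'_in: "A' \<in> Ty C \<Delta>"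
    using assms by (simp add: calc)
  have mem: "?E' \<in> Ctx C" "?E \<in> Ctx C"
    using \<Gamma> A \<Delta> A'_in by (simp_all add: calc)
  note l = lift_in[OF \<Gamma> A \<Delta> \<gamma> A'] lift_proj[OF \<Gamma> A \<Delta> \<gamma> A']
  have \<phi>: "\<phi> X \<in> Sub D (FC F X) (FC G X)" if "X \<in> Ctx C" for X
    using cell that unfolding transformation_iff by blast
  have \<psi>: "\<psi> X B \<in> ty_hom D (FC F X) (FT F X B) (tysub D (FC F X) (FC G X) (FT G X B) (\<phi> X))"
    if "X \<in> Ctx C" "B \<in> Ty C X" for X B
    using cell that unfolding transformation_iff by (blast intro: target.iso_hom)
  have ext: "\<phi> (ext C X B) = ext_cell X B (\<phi> X) (\<psi> X B)" if "X \<in> Ctx C" "B \<in> Ty C X" for X B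
    using cell that unfolding transformation_iff by blast
  have nat: "cmp D (FC F ?E') (FC F ?E) (FC G ?E) (\<phi> ?E) (FS F ?E' ?E ?l)
      = cmp D (FC F ?E') (FC G ?E') (FC G ?E) (FS G ?E' ?E ?l) (\<phi> ?E')"
    using cell mem l(1) unfolding transformation_iff by blast
  note in_D = \<phi> \<psi> mem \<Gamma> A \<Delta> \<gamma> A'_in l(1)
  have Gpl: "cmp D (FC G ?E') (FC G ?E) (FC G \<Gamma>) (G.fpr \<Gamma> A) (FS G ?E' ?E ?l)
      = cmp D (FC G ?E') (FC G \<Delta>) (FC G \<Gamma>) (FS G \<Delta> \<Gamma> \<gamma>) (G.fpr \<Delta> A')"
    using in_D l by (simp add: G.fpr_def G.FS_cmp' calc)
  have Fpl: "cmp D (FC F ?E') (FC F ?E) (FC F \<Gamma>) (F.fpr \<Gamma> A) (FS F ?E' ?E ?l)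
      = cmp D (FC F ?E') (FC F \<Delta>) (FC F \<Gamma>) (FS F \<Delta> \<Gamma> \<gamma>) (F.fpr \<Delta> A')"
    using in_D l by (simp add: F.fpr_def F.FS_cmp' calc)
  let ?TG = "tysub D (FC G ?E) (FC G \<Gamma>) (FT G \<Gamma> A) (G.fpr \<Gamma> A)"
  let ?TF = "tysub D (FC F ?E) (FC F \<Gamma>) (FT F \<Gamma> A) (F.fpr \<Gamma> A)"
  let ?TG' = "tysub D (FC G ?E') (FC G \<Delta>) (FT G \<Delta> A') (G.fpr \<Delta> A')"
  have pE': "cmp D (FC F ?E') (FC G ?E') (FC G \<Delta>) (G.fpr \<Delta> A') (\<phi> ?E')
      = cmp D (FC F ?E') (FC F \<Delta>) (FC G \<Delta>) (\<phi> \<Delta>) (F.fpr \<Delta> A')"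
    using in_D by (simp add: ext fpr_ext_cell)
  have pE: "cmp D (FC F ?E) (FC G ?E) (FC G \<Gamma>) (G.fpr \<Gamma> A) (\<phi> ?E)
      = cmp D (FC F ?E) (FC F \<Gamma>) (FC G \<Gamma>) (\<phi> \<Gamma>) (F.fpr \<Gamma> A)"
    using in_D by (simp add: ext fpr_ext_cell)
  have tyG: "tysub D (FC G ?E') (FC G ?E) ?TG (FS G ?E' ?E ?l) =
     tysub D (FC G ?E') (FC G \<Gamma>) (FT G \<Gamma> A) (cmp D (FC G ?E') (FC G \<Delta>) (FC G \<Gamma>) (FS G \<Delta> \<Gamma> \<gamma>) (G.fpr \<Delta> A'))"
    using in_D by (simp add: pcalc Gpl)
  have yG: "tmsub D (FC G ?E') (FC G ?E) ?TG (G.fvr \<Gamma> A) (FS G ?E' ?E ?l) \<in> Tm D (FC G ?E')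
     (tysub D (FC G ?E') (FC G \<Gamma>) (FT G \<Gamma> A) (cmp D (FC G ?E') (FC G \<Delta>) (FC G \<Gamma>) (FS G \<Delta> \<Gamma> \<gamma>) (G.fpr \<Delta> A')))"
    using in_D by (simp add: pcalc Gpl)
  \<comment> \<open>The component at A' is the generic term of G substituted along \<phi> at
    \<Delta>.A'. That term comes from the generic term for A by G(\<gamma>^+) and \<theta>, and
    naturality at \<gamma>^+ moves \<phi> inside, where the component at A appears.\<close>
  have "cell_app \<Delta> A' (\<phi> \<Delta>) (\<psi> \<Delta> A') (FC F ?E') (F.fpr \<Delta> A') (F.fvr \<Delta> A')
      = tmsub D (FC F ?E') (FC G ?E') ?TG' (G.fvr \<Delta> A') (\<phi> ?E')"
    using in_D by (simp add: ext fvr_ext_cell)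
  also have "\<dots> = tmsub D (FC F ?E') (FC G ?E') ?TG'
      (G.th_app \<Delta> \<Gamma> A \<gamma> (FC G ?E') (G.fpr \<Delta> A')
        (tmsub D (FC G ?E') (FC G ?E) ?TG (G.fvr \<Gamma> A) (FS G ?E' ?E ?l))) (\<phi> ?E')"
    by (simp add: G.th_app_fvr_lift[OF \<Gamma> A \<Delta> \<gamma> A'])
  also have "\<dots> = G.th_app \<Delta> \<Gamma> A \<gamma> (FC F ?E') (cmp D (FC F ?E') (FC G ?E') (FC G \<Delta>) (G.fpr \<Delta> A') (\<phi> ?E'))
      (tmsub D (FC F ?E') (FC G ?E') (tysub D (FC G ?E') (FC G ?E) ?TG (FS G ?E' ?E ?l))
        (tmsub D (FC G ?E') (FC G ?E) ?TG (G.fvr \<Gamma> A) (FS G ?E' ?E ?l)) (\<phi> ?E'))"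
    by (rule G.th_app_tmsub[OF \<Delta> \<Gamma> \<gamma> A])
      (use in_D yG tyG in \<open>simp_all add: pcalc Gpl flip: A'\<close>)
  also have "tmsub D (FC F ?E') (FC G ?E') (tysub D (FC G ?E') (FC G ?E) ?TG (FS G ?E' ?E ?l))
        (tmsub D (FC G ?E') (FC G ?E) ?TG (G.fvr \<Gamma> A) (FS G ?E' ?E ?l)) (\<phi> ?E')
      = tmsub D (FC F ?E') (FC G ?E) ?TG (G.fvr \<Gamma> A) (cmp D (FC F ?E') (FC F ?E) (FC G ?E) (\<phi> ?E) (FS F ?E' ?E ?l))"
    unfolding nat using in_D by (intro target.tmsub_cmp[symmetric]) (simp_all add: pcalc)
  also have "\<dots> = tmsub D (FC F ?E') (FC F ?E) (tysub D (FC F ?E) (FC G ?E) ?TG (\<phi> ?E))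
      (tmsub D (FC F ?E) (FC G ?E) ?TG (G.fvr \<Gamma> A) (\<phi> ?E)) (FS F ?E' ?E ?l)"
    using in_D by (intro target.tmsub_cmp) (simp_all add: pcalc)
  also have "tmsub D (FC F ?E) (FC G ?E) ?TG (G.fvr \<Gamma> A) (\<phi> ?E)
      = cell_app \<Gamma> A (\<phi> \<Gamma>) (\<psi> \<Gamma> A) (FC F ?E) (F.fpr \<Gamma> A) (F.fvr \<Gamma> A)"
    using in_D by (simp add: ext fvr_ext_cell)
  also have "tmsub D (FC F ?E') (FC F ?E) (tysub D (FC F ?E) (FC G ?E) ?TG (\<phi> ?E)) \<dots> (FS F ?E' ?E ?l) =
      cell_app \<Gamma> A (\<phi> \<Gamma>) (\<psi> \<Gamma> A) (FC F ?E')
        (cmp D (FC F ?E') (FC F ?E) (FC F \<Gamma>) (F.fpr \<Gamma> A) (FS F ?E' ?E ?l))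
        (tmsub D (FC F ?E') (FC F ?E) ?TF (F.fvr \<Gamma> A) (FS F ?E' ?E ?l))"
    by (rule target.app_tmsub) (use in_D in \<open>simp_all add: pcalc pE\<close>)
  finally show ?thesis
    unfolding pE' Fpl .
qed

abbreviation Fctx :: "nat \<Rightarrow> 'd" where
  "Fctx n \<equiv> FC F (N n)"

abbreviation Gctx :: "nat \<Rightarrow> 'd" where
  "Gctx n \<equiv> FC G (N n)"

abbreviation Fty :: "nat \<Rightarrow> 'v" where
  "Fty n \<equiv> FT F (N n) (T n)"

abbreviation Gty :: "nat \<Rightarrow> 'v" where
  "Gty n \<equiv> FT G (N n) (T n)"

text \<open>Induction on the length of the context. For A = o and \<gamma> = ! the right side of
  \<open>transformation_tysub\<close> involves only \<phi> at the two contexts and \<psi> at o, so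
  \<phi> at n determines \<psi> at n. Both together determine \<phi> at n + 1.\<close>

lemma transformation_unique:
  assumes cell: "pseudo_cwf_transformation C D F G \<phi> \<psi>" "pseudo_cwf_transformation C D F G \<phi>' \<psi>'"
    and base: "\<psi> (N 0) (T 0) = \<psi>' (N 0) (T 0)"
  shows "\<phi> = \<phi>' \<and> \<psi> = \<psi>'"
proof -
  have \<phi>: "\<phi> X \<in> Sub D (FC F X) (FC G X)" "\<phi>' X \<in> Sub D (FC F X) (FC G X)" if "X \<in> Ctx C" for X
    using cell that unfolding transformation_iff by blast+
  have \<psi>: "\<psi> X B \<in> ty_hom D (FC F X) (FT F X B) (tysub D (FC F X) (FC G X) (FT G X B) (\<phi> X))"
    "\<psi>' X B \<in> ty_hom D (FC F X) (FT F X B) (tysub D (FC F X) (FC G X) (FT G X B) (\<phi>' X))"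
    if "X \<in> Ctx C" "B \<in> Ty C X" for X B
    using cell that unfolding transformation_iff by (blast intro: target.iso_hom)+
  have bang: "bang (N n) \<in> Sub C (N n) (N 0)" for n
    using bang_in[of "N n"] by (simp add: emp_N)
  have \<phi>0: "\<phi> (N 0) = \<phi>' (N 0)"
    using target.terminal_unique[OF G.FC_terminal, of "Fctx 0"] \<phi>[of "N 0"]
    by (simp add: emp_N pcalc)
  have \<psi>_eq: "\<psi> (N n) (T n) = \<psi>' (N n) (T n)" if "\<phi> (N n) = \<phi>' (N n)" for n
  proof (rule F.hom_eqI_fpr)
    show "\<psi> (N n) (T n) \<in> ty_hom D (Fctx n) (Fty n) (tysub D (Fctx n) (Gctx n) (Gty n) (\<phi> (N n)))"
      "\<psi>' (N n) (T n) \<in> ty_hom D (Fctx n) (Fty n) (tysub D (Fctx n) (Gctx n) (Gty n) (\<phi> (N n)))"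
      using \<psi>[of "N n" "T n"] that by simp_all
    show "cell_app (N n) (T n) (\<phi> (N n)) (\<psi> (N n) (T n)) (FC F (ext C (N n) (T n))) (F.fpr (N n) (T n)) (F.fvr (N n) (T n)) =
      cell_app (N n) (T n) (\<phi> (N n)) (\<psi>' (N n) (T n)) (FC F (ext C (N n) (T n))) (F.fpr (N n) (T n)) (F.fvr (N n) (T n))"
      using transformation_tysub[OF cell(1), of "N 0" "T 0" "N n" "bang (N n)" "T n"]
        transformation_tysub[OF cell(2), of "N 0" "T 0" "N n" "bang (N n)" "T n"] bang[of n] that base \<phi>0
      by simp
  qed (use \<phi>[of "N n"] in \<open>simp_all add: pcalc\<close>)
  have \<phi>_eq: "\<phi> (N n) = \<phi>' (N n)" for n
  proof (induction n)
    case (Suc n)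
    have "\<phi> (ext C (N n) (T n)) = \<phi>' (ext C (N n) (T n))"
      using cell \<psi>_eq[OF Suc] Suc unfolding transformation_iff by simp
    then show ?case
      by (simp add: ext_N)
  qed (rule \<phi>0)
  \<comment> \<open>The families are extensional, so agreement on the index sets gives
    equality.\<close>
  have "\<phi> = \<phi>'"
    by (rule PiE_ext[of _ "Ctx C" "\<lambda>\<Gamma>. Sub D (FC F \<Gamma>) (FC G \<Gamma>)"])
      (use cell \<phi>_eq in \<open>auto simp: transformation_iff Ctx_N\<close>)
  moreover have "\<psi> = \<psi>'"
  proof (rule PiE_ext)
    let ?I = "\<lambda>\<Gamma> A. ty_iso D (FC F \<Gamma>) (FT F \<Gamma> A) (tysub D (FC F \<Gamma>) (FC G \<Gamma>) (FT G \<Gamma> A) (\<phi> \<Gamma>))"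
    show in_Pi: "\<psi> \<in> (\<Pi>\<^sub>E \<Gamma>\<in>Ctx C. \<Pi>\<^sub>E A\<in>Ty C \<Gamma>. ?I \<Gamma> A)" "\<psi>' \<in> (\<Pi>\<^sub>E \<Gamma>\<in>Ctx C. \<Pi>\<^sub>E A\<in>Ty C \<Gamma>. ?I \<Gamma> A)"
      using cell \<open>\<phi> = \<phi>'\<close> unfolding transformation_iff by auto
    fix \<Gamma> assume \<Gamma>: "\<Gamma> \<in> Ctx C"
    show "\<psi> \<Gamma> = \<psi>' \<Gamma>"
    proof (rule PiE_ext)
      show "\<psi> \<Gamma> \<in> (\<Pi>\<^sub>E A\<in>Ty C \<Gamma>. ?I \<Gamma> A)" "\<psi>' \<Gamma> \<in> (\<Pi>\<^sub>E A\<in>Ty C \<Gamma>. ?I \<Gamma> A)"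
        using in_Pi \<Gamma> by blast+
      show "\<psi> \<Gamma> A = \<psi>' \<Gamma> A" if "A \<in> Ty C \<Gamma>" for A
        using that \<Gamma> \<psi>_eq \<phi>_eq by (auto elim!: Ctx_cases dest!: Ty_cases)
    qed
  qed
  ultimately show ?thesis ..
qed

end

subsection \<open>Existence\<close>

text \<open>\<kappa> stands for the inverse of \<alpha>_G composed with \<alpha>_F, the prescribed
  value of the component at o after reindexing along \<open>!_F\<close>.\<close>

locale parallel_arrows = parallel_morphisms C N T V D F G
  for C :: "('c, 's, 't, 'm) cwf_data" and N T V
    and D :: "('d, 'u, 'v, 'n) cwf_data"
    and F G :: "('c, 's, 't, 'm, 'd, 'u, 'v, 'n) cwf_map" +
  fixes \<kappa> :: 'u
  assumes \<kappa>_iso: "\<kappa> \<in> ty_iso D (emp D) (base_image C (T 0) D F) (base_image C (T 0) D G)"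
begin

definition cell_emp :: 'u where
  "cell_emp = (THE \<phi>. \<phi> \<in> Sub D (Fctx 0) (Gctx 0))"

abbreviation base_cod :: 'v where
  "base_cod \<equiv> tysub D (Fctx 0) (Gctx 0) (Gty 0) cell_emp"

abbreviation Fbang :: "nat \<Rightarrow> 'u" where
  "Fbang n \<equiv> FS F (N n) (N 0) (bang (N n))"

abbreviation Gbang :: "nat \<Rightarrow> 'u" where
  "Gbang n \<equiv> FS G (N n) (N 0) (bang (N n))"

text \<open>\<kappa> carried from 1 to F1 along ! : F1 -> 1, the inverse of
  \<open>!_F\<close>.\<close>

definition cell_base :: 'u where
  "cell_base = ty_reindex D (Fctx 0) (emp D) (base_image C (T 0) D F) (base_image C (T 0) D G)
     (target.bang (Fctx 0)) \<kappa>"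

text \<open>The composite \<open>F(o[!]) \<cong> Fo[F!] \<cong> Go[\<phi>\<^sub>1][F!] = Go[G!][\<phi>] \<cong> G(o[!])[\<phi>]\<close> for
  \<open>\<phi> : F\<Gamma> \<rightarrow> G\<Gamma>\<close> and \<open>! : \<Gamma> \<rightarrow> 1\<close>.\<close>

definition cell_ty :: "nat \<Rightarrow> 'u \<Rightarrow> 'u" where
  "cell_ty n \<phi> =
     (let X = Fctx n; Y = Gctx n; A = Fty n; B = Gty n;
          X0 = Fctx 0; Y0 = Gctx 0; A0 = Fty 0; B0 = Gty 0;
          s = Fbang n; t = Gbang n;
          B1 = tysub D X0 Y0 B0 cell_emp
      in ty_cmp D X A (tysub D X X0 B1 s) (tysub D X Y B \<phi>)
           (ty_reindex D X Y (tysub D Y Y0 B0 t) B \<phi> (th G (N n) (N 0) (T 0) (bang (N n))))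
           (ty_cmp D X A (tysub D X X0 A0 s) (tysub D X X0 B1 s)
             (ty_reindex D X X0 A0 B1 s cell_base)
             (ty_inv D X (tysub D X X0 A0 s) A (th F (N n) (N 0) (T 0) (bang (N n))))))"

lemma bang_N: "bang (N n) \<in> Sub C (N n) (N 0)"
  using bang_in[of "N n"] by (simp add: emp_N)

lemma bang_N_cmp: "\<gamma> \<in> Sub C (N m) (N n) \<Longrightarrow> cmp C (N m) (N n) (N 0) (bang (N n)) \<gamma> = bang (N m)"
  using bang_cmp[of "N m" "N n" \<gamma>] by (simp add: emp_N)

lemma bang_N_0: "bang (N 0) = idn C (N 0)"
  by (rule terminal_unique[OF terminal_emp N_in[of 0]]) (simp_all add: emp_N bang_N calc)

lemma cell_emp_in: "cell_emp \<in> Sub D (Fctx 0) (Gctx 0)"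
  unfolding cell_emp_def using target.terminal_the[OF G.FC_terminal, of "Fctx 0"] by (simp add: emp_N F.FC_in)

lemma G_emp_unique:
  "\<lbrakk>\<Delta> \<in> Ctx D; \<gamma> \<in> Sub D \<Delta> (Gctx 0); \<delta> \<in> Sub D \<Delta> (Gctx 0)\<rbrakk> \<Longrightarrow> \<gamma> = \<delta>"
  using target.terminal_unique[OF G.FC_terminal] by (simp add: emp_N)

lemma cell_emp_cmp:
  assumes "\<phi> \<in> Sub D (Fctx n) (Gctx n)"
  shows "cmp D (Fctx n) (Fctx 0) (Gctx 0) cell_emp (Fbang n)
    = cmp D (Fctx n) (Gctx n) (Gctx 0) (Gbang n) \<phi>"
  using assms cell_emp_in bang_N by (intro G_emp_unique[of "Fctx n"]) (simp_all add: pcalc)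

lemma bang_maps:
  "bang_map C D F \<in> Sub D (emp D) (Fctx 0)" "bang_map C D G \<in> Sub D (emp D) (Gctx 0)"
  "cmp D (emp D) (Fctx 0) (emp D) (target.bang (Fctx 0)) (bang_map C D F) = idn D (emp D)"
  "cmp D (Fctx 0) (emp D) (Fctx 0) (bang_map C D F) (target.bang (Fctx 0)) = idn D (Fctx 0)"
  using F.bang_map_in G.bang_map_in F.bang_bang_map F.bang_map_bang by (simp_all add: emp_N)

lemma base_image_N:
  "base_image C (T 0) D F = tysub D (emp D) (Fctx 0) (Fty 0) (bang_map C D F)"
  "base_image C (T 0) D G = tysub D (emp D) (Gctx 0) (Gty 0) (bang_map C D G)"
  by (simp_all add: base_image_def emp_N)

lemma base_image_in:
  "base_image C (T 0) D F \<in> Ty D (emp D)" "base_image C (T 0) D G \<in> Ty D (emp D)"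
  unfolding base_image_N using bang_maps by (simp_all add: pcalc)

lemma bang_F_0: "target.bang (Fctx 0) \<in> Sub D (Fctx 0) (emp D)"
  by (simp add: target.bang_in F.FC_in)

text \<open>F(o)[\<open>!_F\<close>][!] = F(o) because \<open>!_F\<close> o ! is the identity of F1.
  For G the composite is the only substitution F1 -> G1, that is, the component at the empty
  context.\<close>

lemma base_image_bang:
  "tysub D (Fctx 0) (emp D) (base_image C (T 0) D F) (target.bang (Fctx 0)) = Fty 0"
  "tysub D (Fctx 0) (emp D) (base_image C (T 0) D G) (target.bang (Fctx 0))
    = base_cod"
proof -
  have "cmp D (Fctx 0) (emp D) (Gctx 0) (bang_map C D G) (target.bang (Fctx 0)) = cell_emp"
    by (rule G_emp_unique[of "Fctx 0"]) (simp_all add: pcalc bang_maps bang_F_0 cell_emp_in)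
  then show "tysub D (Fctx 0) (emp D) (base_image C (T 0) D F) (target.bang (Fctx 0)) = Fty 0"
    "tysub D (Fctx 0) (emp D) (base_image C (T 0) D G) (target.bang (Fctx 0))
      = base_cod"
    unfolding base_image_N by (simp_all add: pcalc bang_maps bang_F_0)
qed

lemma cell_base_iso:
  "cell_base \<in> ty_iso D (Fctx 0) (Fty 0) (base_cod)"
  unfolding cell_base_def using \<kappa>_iso base_image_in bang_F_0
  by (intro target.ty_reindex_iso) (simp_all add: pcalc base_image_bang)

abbreviation base_app :: "'d \<Rightarrow> 'u \<Rightarrow> 'n \<Rightarrow> 'n" where
  "base_app \<equiv> cell_app (N 0) (T 0) cell_emp cell_base"

context
  fixes n \<phi>
  assumes \<phi>: "\<phi> \<in> Sub D (Fctx n) (Gctx n)"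
begin

text \<open>The three isomorphisms fit together because Go[\<phi>_1][F!] and Go[G!][\<phi>] are one
  type: both composites end in the terminal object G1.\<close>

lemma cell_ty_parts:
  defines "B' \<equiv> tysub D (Fctx n) (Fctx 0) (base_cod)
    (Fbang n)"
  defines "A' \<equiv> tysub D (Fctx n) (Fctx 0) (Fty 0) (Fbang n)"
  shows "th F (N n) (N 0) (T 0) (bang (N n)) \<in> ty_iso D (Fctx n) A' (Fty n)"
    and "ty_reindex D (Fctx n) (Fctx 0) (Fty 0)
      (base_cod) (Fbang n) cell_base
      \<in> ty_iso D (Fctx n) A' B'"
    and "ty_reindex D (Fctx n) (Gctx n) (tysub D (Gctx n) (Gctx 0) (Gty 0) (Gbang n))
      (Gty n) \<phi> (th G (N n) (N 0) (T 0) (bang (N n)))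
      \<in> ty_iso D (Fctx n) B' (tysub D (Fctx n) (Gctx n) (Gty n) \<phi>)"
    and "B' = tysub D (Fctx n) (Gctx n) (tysub D (Gctx n) (Gctx 0) (Gty 0) (Gbang n)) \<phi>"
proof -
  show "th F (N n) (N 0) (T 0) (bang (N n)) \<in> ty_iso D (Fctx n) A' (Fty n)"
    unfolding A'_def using F.th_iso[of "N n" "N 0" "bang (N n)" "T 0"] bang_N by simp
  have "th G (N n) (N 0) (T 0) (bang (N n)) \<in> ty_iso D (Gctx n)
      (tysub D (Gctx n) (Gctx 0) (Gty 0) (Gbang n)) (Gty n)"
    using G.th_iso[of "N n" "N 0" "bang (N n)" "T 0"] bang_N by simp
  moreover show B': "B' = tysub D (Fctx n) (Gctx n) (tysub D (Gctx n) (Gctx 0) (Gty 0) (Gbang n)) \<phi>"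
    unfolding B'_def using bang_N cell_emp_in \<phi> by (simp add: pcalc cell_emp_cmp)
  ultimately show "ty_reindex D (Fctx n) (Gctx n) (tysub D (Gctx n) (Gctx 0) (Gty 0) (Gbang n))
      (Gty n) \<phi> (th G (N n) (N 0) (T 0) (bang (N n)))
      \<in> ty_iso D (Fctx n) B' (tysub D (Fctx n) (Gctx n) (Gty n) \<phi>)"
    using \<phi> bang_N by (intro target.ty_reindex_iso) (simp_all add: F.FC_in G.FC_in F.FS_in G.FS_in F.FT_in G.FT_in target.tysub_in)
  show "ty_reindex D (Fctx n) (Fctx 0) (Fty 0)
      (base_cod) (Fbang n) cell_base
      \<in> ty_iso D (Fctx n) A' B'"
    using cell_base_iso cell_emp_in bang_N
    by (intro target.ty_reindex_iso) (simp_all add: A'_def B'_def pcalc)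
qed

lemma cell_ty_iso:
  "cell_ty n \<phi> \<in> ty_iso D (Fctx n) (Fty n) (tysub D (Fctx n) (Gctx n) (Gty n) \<phi>)"
  unfolding cell_ty_def Let_def
  by (rule target.ty_cmp_iso[OF _ _ _ _ target.ty_cmp_iso[OF _ _ _ _ target.ty_inv_iso[OF _ _ _ cell_ty_parts(1)] cell_ty_parts(2)]
      cell_ty_parts(3)])
    (use \<phi> bang_N cell_emp_in in \<open>simp_all add: F.FC_in G.FC_in F.FS_in G.FS_in F.FT_in G.FT_in target.tysub_in\<close>)

text \<open>On terms the component is conjugation: undo \<theta> of F, apply the component at o,
  redo \<theta> of G.\<close>

lemma app_cell_ty:
  assumes \<Delta>: "\<Delta> \<in> Ctx D" and \<gamma>: "\<gamma> \<in> Sub D \<Delta> (Fctx n)"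
    and x: "x \<in> Tm D \<Delta> (tysub D \<Delta> (Fctx n) (Fty n) \<gamma>)"
  shows "cell_app (N n) (T n) \<phi> (cell_ty n \<phi>) \<Delta> \<gamma> x =
    G.th_app (N n) (N 0) (T 0) (bang (N n)) \<Delta> (cmp D \<Delta> (Fctx n) (Gctx n) \<phi> \<gamma>)
      (base_app \<Delta> (cmp D \<Delta> (Fctx n) (Fctx 0) (Fbang n) \<gamma>)
        (F.th_unapp (N n) (N 0) (T 0) (bang (N n)) \<Delta> \<gamma> x))"
proof -
  let ?A' = "tysub D (Fctx n) (Fctx 0) (Fty 0) (Fbang n)"
  let ?oB = "base_cod"
  let ?B' = "tysub D (Fctx n) (Fctx 0) ?oB (Fbang n)"
  let ?C' = "tysub D (Gctx n) (Gctx 0) (Gty 0) (Gbang n)"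
  let ?r = "ty_reindex D (Fctx n) (Fctx 0) (Fty 0) ?oB (Fbang n) cell_base"
  let ?i = "ty_inv D (Fctx n) ?A' (Fty n) (th F (N n) (N 0) (T 0) (bang (N n)))"
  let ?t = "ty_reindex D (Fctx n) (Gctx n) ?C' (Gty n) \<phi> (th G (N n) (N 0) (T 0) (bang (N n)))"
  have mem: "Fctx n \<in> Ctx D" "Fctx 0 \<in> Ctx D" "Gctx n \<in> Ctx D" "Gctx 0 \<in> Ctx D"
    "Fty n \<in> Ty D (Fctx n)" "Fty 0 \<in> Ty D (Fctx 0)" "Gty n \<in> Ty D (Gctx n)"
    "Fbang n \<in> Sub D (Fctx n) (Fctx 0)"
    "Gbang n \<in> Sub D (Gctx n) (Gctx 0)"
    "?A' \<in> Ty D (Fctx n)" "?oB \<in> Ty D (Fctx 0)" "?B' \<in> Ty D (Fctx n)" "?C' \<in> Ty D (Gctx n)"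
    "tysub D (Fctx n) (Gctx n) (Gty n) \<phi> \<in> Ty D (Fctx n)"
    using bang_N cell_emp_in \<phi> by (simp_all add: F.FC_in G.FC_in F.FS_in G.FS_in F.FT_in G.FT_in target.tysub_in)
  note parts = cell_ty_parts
  have i: "?i \<in> ty_hom D (Fctx n) (Fty n) ?A'"
    using mem parts(1) by (intro target.ty_inv_hom)
  have r: "?r \<in> ty_hom D (Fctx n) ?A' ?B'"
    by (rule target.iso_hom[OF parts(2)])
  have t: "?t \<in> ty_hom D (Fctx n) ?B' (tysub D (Fctx n) (Gctx n) (Gty n) \<phi>)"
    by (rule target.iso_hom[OF parts(3)])
  have thG: "th G (N n) (N 0) (T 0) (bang (N n)) \<in> ty_hom D (Gctx n) ?C' (Gty n)"
    using G.th_iso[of "N n" "N 0" "bang (N n)" "T 0"] bang_N by (intro target.iso_hom) simp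
  have app_i: "target.app (Fctx n) (Fty n) ?A' \<Delta> ?i \<gamma> x = F.th_unapp (N n) (N 0) (T 0) (bang (N n)) \<Delta> \<gamma> x"
    using bang_N by (simp add: F.th_unapp_def)
  have y: "target.app (Fctx n) (Fty n) ?A' \<Delta> ?i \<gamma> x \<in> Tm D \<Delta> (tysub D \<Delta> (Fctx n) ?A' \<gamma>)" (is "?y \<in> _")
    by (rule target.app_in[OF _ _ _ _ _ x i]) (use mem \<Delta> \<gamma> in auto)
  have z: "target.app (Fctx n) ?A' ?B' \<Delta> ?r \<gamma> ?y \<in> Tm D \<Delta> (tysub D \<Delta> (Fctx n) ?B' \<gamma>)" (is "?z \<in> _")
    by (rule target.app_in[OF _ _ _ _ _ y r]) (use mem \<Delta> \<gamma> in auto)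
  have app_r: "?z = base_app \<Delta> (cmp D \<Delta> (Fctx n) (Fctx 0) (Fbang n) \<gamma>) ?y"
    using mem \<Delta> \<gamma> y target.iso_hom[OF cell_base_iso] by (intro target.app_ty_reindex) (simp_all add: target.calc)
  have "cell_app (N n) (T n) \<phi> (cell_ty n \<phi>) \<Delta> \<gamma> x =
      target.app (Fctx n) ?B' (tysub D (Fctx n) (Gctx n) (Gty n) \<phi>) \<Delta> ?t \<gamma>
        (target.app (Fctx n) (Fty n) ?B' \<Delta> (ty_cmp D (Fctx n) (Fty n) ?A' ?B' ?r ?i) \<gamma> x)"
    unfolding cell_ty_def Let_def
    by (rule target.app_ty_cmp[OF _ _ _ _ target.ty_cmp_hom[OF _ _ _ _ i r] t]) (use mem \<Delta> \<gamma> x in auto)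
  also have "target.app (Fctx n) (Fty n) ?B' \<Delta> (ty_cmp D (Fctx n) (Fty n) ?A' ?B' ?r ?i) \<gamma> x = ?z"
    by (rule target.app_ty_cmp[OF _ _ _ _ i r]) (use mem \<Delta> \<gamma> x in auto)
  also have "target.app (Fctx n) ?B' (tysub D (Fctx n) (Gctx n) (Gty n) \<phi>) \<Delta> ?t \<gamma> ?z
      = target.app (Gctx n) ?C' (Gty n) \<Delta> (th G (N n) (N 0) (T 0) (bang (N n))) (cmp D \<Delta> (Fctx n) (Gctx n) \<phi> \<gamma>) ?z"
  proof (rule target.app_ty_reindex)
    show "?z \<in> Tm D \<Delta> (tysub D \<Delta> (Gctx n) ?C' (cmp D \<Delta> (Fctx n) (Gctx n) \<phi> \<gamma>))"
      using z mem \<Delta> \<gamma> \<phi> unfolding parts(4) by (simp add: target.tysub_cmp)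
  qed (use mem thG \<phi> \<Delta> \<gamma> parts(4) in auto)
  also have "\<dots> = G.th_app (N n) (N 0) (T 0) (bang (N n)) \<Delta> (cmp D \<Delta> (Fctx n) (Gctx n) \<phi> \<gamma>) ?z"
    using bang_N by (simp add: G.th_app_def)
  finally show ?thesis
    unfolding app_i app_r[unfolded app_i] .
qed

end

lemma app_cell_ty_th_app:
  assumes \<phi>: "\<phi> \<in> Sub D (Fctx n) (Gctx n)" and \<Delta>: "\<Delta> \<in> Ctx D" and \<gamma>: "\<gamma> \<in> Sub D \<Delta> (Fctx n)"
    and w: "w \<in> Tm D \<Delta> (tysub D \<Delta> (Fctx 0) (Fty 0)
      (cmp D \<Delta> (Fctx n) (Fctx 0) (Fbang n) \<gamma>))"
  shows "cell_app (N n) (T n) \<phi> (cell_ty n \<phi>) \<Delta> \<gamma> (F.th_app (N n) (N 0) (T 0) (bang (N n)) \<Delta> \<gamma> w) =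
    G.th_app (N n) (N 0) (T 0) (bang (N n)) \<Delta> (cmp D \<Delta> (Fctx n) (Gctx n) \<phi> \<gamma>)
      (base_app \<Delta> (cmp D \<Delta> (Fctx n) (Fctx 0) (Fbang n) \<gamma>) w)"
proof -
  have "F.th_app (N n) (N 0) (T 0) (bang (N n)) \<Delta> \<gamma> w \<in> Tm D \<Delta> (tysub D \<Delta> (Fctx n) (Fty n) \<gamma>)"
    using bang_N \<Delta> \<gamma> w by (intro F.th_app_in) simp_all
  moreover have "F.th_unapp (N n) (N 0) (T 0) (bang (N n)) \<Delta> \<gamma> (F.th_app (N n) (N 0) (T 0) (bang (N n)) \<Delta> \<gamma> w) = w"
    using bang_N \<Delta> \<gamma> w by (intro F.th_unapp_th_app) simp_all
  ultimately show ?thesis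
    using app_cell_ty[OF \<phi> \<Delta> \<gamma>] by simp
qed

lemma base_app_in:
  assumes "\<Delta> \<in> Ctx D" "\<gamma> \<in> Sub D \<Delta> (Fctx 0)" "w \<in> Tm D \<Delta> (tysub D \<Delta> (Fctx 0) (Fty 0) \<gamma>)"
  shows "base_app \<Delta> \<gamma> w \<in> Tm D \<Delta> (tysub D \<Delta> (Gctx 0) (Gty 0) (cmp D \<Delta> (Fctx 0) (Gctx 0) cell_emp \<gamma>))"
  using assms cell_emp_in target.iso_hom[OF cell_base_iso] by (intro target.app_in) (simp_all add: pcalc)

text \<open>Naturality at \<open>\<gamma>\<close> makes the components compatible with the isomorphisms \<open>\<theta>\<close> at \<open>\<gamma>\<close>.\<close>

lemma cell_ty_coherent:
  assumes \<gamma>: "\<gamma> \<in> Sub C (N m) (N n)"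
    and \<phi>: "\<phi> \<in> Sub D (Fctx n) (Gctx n)" and \<phi>': "\<phi>' \<in> Sub D (Fctx m) (Gctx m)"
    and nat: "cmp D (Fctx m) (Fctx n) (Gctx n) \<phi> (FS F (N m) (N n) \<gamma>)
      = cmp D (Fctx m) (Gctx m) (Gctx n) (FS G (N m) (N n) \<gamma>) \<phi>'"
    and \<Delta>: "\<Delta> \<in> Ctx D" and \<delta>: "\<delta> \<in> Sub D \<Delta> (Fctx m)"
    and x: "x \<in> Tm D \<Delta> (tysub D \<Delta> (Fctx n) (Fty n) (cmp D \<Delta> (Fctx m) (Fctx n) (FS F (N m) (N n) \<gamma>) \<delta>))"
  shows "cell_app (N m) (T m) \<phi>' (cell_ty m \<phi>') \<Delta> \<delta> (F.th_app (N m) (N n) (T n) \<gamma> \<Delta> \<delta> x) =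
    G.th_app (N m) (N n) (T n) \<gamma> \<Delta> (cmp D \<Delta> (Fctx m) (Gctx m) \<phi>' \<delta>)
      (cell_app (N n) (T n) \<phi> (cell_ty n \<phi>) \<Delta> (cmp D \<Delta> (Fctx m) (Fctx n) (FS F (N m) (N n) \<gamma>) \<delta>) x)"
proof -
  let ?\<gamma> = "cmp D \<Delta> (Fctx m) (Fctx n) (FS F (N m) (N n) \<gamma>) \<delta>"
  let ?\<phi> = "cmp D \<Delta> (Fctx m) (Gctx m) \<phi>' \<delta>"
  let ?\<beta> = "cmp D \<Delta> (Fctx n) (Fctx 0) (Fbang n) ?\<gamma>"
  have mem: "Fctx k \<in> Ctx D" "Gctx k \<in> Ctx D" "FS F (N m) (N n) \<gamma> \<in> Sub D (Fctx m) (Fctx n)"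
    "FS G (N m) (N n) \<gamma> \<in> Sub D (Gctx m) (Gctx n)"
    "Fbang k \<in> Sub D (Fctx k) (Fctx 0)"
    "Gbang k \<in> Sub D (Gctx k) (Gctx 0)" for k
    using \<gamma> bang_N by (simp_all add: pcalc)
  have \<gamma>\<delta>: "?\<gamma> \<in> Sub D \<Delta> (Fctx n)" "?\<phi> \<in> Sub D \<Delta> (Gctx m)"
    using mem \<Delta> \<delta> \<phi>' by (simp_all add: target.calc)
  \<comment> \<open>As the type of x comes from o by !, x is \<theta> of a term w of type F(o). In
    terms of w, \<theta> at ! followed by \<theta> at \<gamma> is \<theta> at ! o \<gamma> = !, for
    F and for G, and both sides of the claim become the same expression.\<close>
  define w where "w = F.th_unapp (N n) (N 0) (T 0) (bang (N n)) \<Delta> ?\<gamma> x"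
  have w: "w \<in> Tm D \<Delta> (tysub D \<Delta> (Fctx 0) (Fty 0) ?\<beta>)"
    unfolding w_def using bang_N \<Delta> \<gamma>\<delta> x by (intro F.th_unapp_in) simp_all
  have xw: "x = F.th_app (N n) (N 0) (T 0) (bang (N n)) \<Delta> ?\<gamma> w"
    unfolding w_def using bang_N \<Delta> \<gamma>\<delta> x by (intro F.th_app_th_unapp[symmetric]) simp_all
  have F_bang: "cmp D \<Delta> (Fctx m) (Fctx 0) (Fbang m) \<delta> = ?\<beta>"
    using F.FS_cmp[of "N m" "N n" "N 0" \<gamma> "bang (N n)"] \<gamma> bang_N mem \<Delta> \<delta>
    by (simp add: bang_N_cmp target.cmp_assoc)
  have \<phi>\<gamma>: "cmp D \<Delta> (Fctx n) (Gctx n) \<phi> ?\<gamma> = cmp D \<Delta> (Gctx m) (Gctx n) (FS G (N m) (N n) \<gamma>) ?\<phi>"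
    using mem \<Delta> \<delta> \<phi> \<phi>' nat by (simp flip: target.cmp_assoc)
  have v: "base_app \<Delta> ?\<beta> w \<in> Tm D \<Delta> (tysub D \<Delta> (Gctx 0) (Gty 0)
      (cmp D \<Delta> (Gctx m) (Gctx 0) (Gbang m) ?\<phi>))"
  proof -
    have "?\<beta> \<in> Sub D \<Delta> (Fctx 0)"
      using mem \<Delta> \<gamma>\<delta> by (simp add: target.calc)
    moreover from this have "cmp D \<Delta> (Fctx 0) (Gctx 0) cell_emp ?\<beta>
        = cmp D \<Delta> (Gctx m) (Gctx 0) (Gbang m) ?\<phi>"
      using mem \<Delta> \<gamma>\<delta> cell_emp_in by (intro G_emp_unique[of \<Delta>]) (simp_all add: target.cmp_in)
    ultimately show ?thesis
      using base_app_in[of \<Delta> ?\<beta> w] \<Delta> w by simp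
  qed
  have "F.th_app (N m) (N n) (T n) \<gamma> \<Delta> \<delta> x = F.th_app (N m) (N 0) (T 0) (bang (N m)) \<Delta> \<delta> w"
    using F.th_app_cmp[of "N m" "N n" "N 0" \<gamma> "bang (N n)" "T 0" \<Delta> \<delta> w "T n"] \<gamma> bang_N \<Delta> \<delta> w
    by (simp add: bang_N_cmp F_bang xw)
  then have "cell_app (N m) (T m) \<phi>' (cell_ty m \<phi>') \<Delta> \<delta> (F.th_app (N m) (N n) (T n) \<gamma> \<Delta> \<delta> x) =
      G.th_app (N m) (N 0) (T 0) (bang (N m)) \<Delta> ?\<phi> (base_app \<Delta> ?\<beta> w)"
    using app_cell_ty_th_app[OF \<phi>' \<Delta> \<delta>, of w] w by (simp add: F_bang)
  also have "\<dots> = G.th_app (N m) (N n) (T n) \<gamma> \<Delta> ?\<phi>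
      (G.th_app (N n) (N 0) (T 0) (bang (N n)) \<Delta> (cmp D \<Delta> (Gctx m) (Gctx n) (FS G (N m) (N n) \<gamma>) ?\<phi>) (base_app \<Delta> ?\<beta> w))"
    using G.th_app_cmp[of "N m" "N n" "N 0" \<gamma> "bang (N n)" "T 0" \<Delta> ?\<phi> "base_app \<Delta> ?\<beta> w" "T n"] \<gamma> bang_N \<Delta> \<gamma>\<delta> v
    by (simp add: bang_N_cmp)
  also have "G.th_app (N n) (N 0) (T 0) (bang (N n)) \<Delta> (cmp D \<Delta> (Gctx m) (Gctx n) (FS G (N m) (N n) \<gamma>) ?\<phi>) (base_app \<Delta> ?\<beta> w)
      = cell_app (N n) (T n) \<phi> (cell_ty n \<phi>) \<Delta> ?\<gamma> x"
    using app_cell_ty_th_app[OF \<phi> \<Delta> \<gamma>\<delta>(1) w] by (simp only: xw[symmetric] \<phi>\<gamma>)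
  finally show ?thesis .
qed

section \<open>Components at all contexts and their naturality\<close>

primrec cell_ctx :: "nat \<Rightarrow> 'u" where
  "cell_ctx 0 = cell_emp"
| "cell_ctx (Suc n) = ext_cell (N n) (T n) (cell_ctx n) (cell_ty n (cell_ctx n))"

lemma cell_ctx_in: "cell_ctx n \<in> Sub D (Fctx n) (Gctx n)"
proof (induction n)
  case (Suc n)
  then show ?case
    using ext_cell_in[OF _ _ Suc target.iso_hom[OF cell_ty_iso[OF Suc]]] by (simp add: ext_N)
qed (simp add: cell_emp_in)

abbreviation cell_ty_app :: "nat \<Rightarrow> 'd \<Rightarrow> 'u \<Rightarrow> 'n \<Rightarrow> 'n" where
  "cell_ty_app n \<equiv> cell_app (N n) (T n) (cell_ctx n) (cell_ty n (cell_ctx n))"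

lemma cell_ty_hom: "cell_ty n (cell_ctx n) \<in> ty_hom D (Fctx n) (Fty n)
    (tysub D (Fctx n) (Gctx n) (Gty n) (cell_ctx n))"
  by (rule target.iso_hom[OF cell_ty_iso[OF cell_ctx_in]])

lemma fpr_cell_ctx:
  "cmp D (Fctx (Suc n)) (Gctx (Suc n)) (Gctx n) (G.fpr (N n) (T n)) (cell_ctx (Suc n))
    = cmp D (Fctx (Suc n)) (Fctx n) (Gctx n) (cell_ctx n) (F.fpr (N n) (T n))"
  using fpr_ext_cell[OF _ _ cell_ctx_in cell_ty_hom, of n] by (simp add: ext_N)

lemma fvr_cell_ctx:
  "tmsub D (Fctx (Suc n)) (Gctx (Suc n))
      (tysub D (Gctx (Suc n)) (Gctx n) (Gty n) (G.fpr (N n) (T n))) (G.fvr (N n) (T n)) (cell_ctx (Suc n))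
    = cell_ty_app n (Fctx (Suc n)) (F.fpr (N n) (T n)) (F.fvr (N n) (T n))"
  using fvr_ext_cell[OF _ _ cell_ctx_in cell_ty_hom, of n] by (simp add: ext_N)

lemma fpr_N: "F.fpr (N n) (T n) = FS F (N (Suc n)) (N n) (pr C (N n) (T n))"
    "G.fpr (N n) (T n) = FS G (N (Suc n)) (N n) (pr C (N n) (T n))"
  by (simp_all add: F.fpr_def G.fpr_def ext_N)

lemma fpr_fvr_N_in:
  "F.fpr (N n) (T n) \<in> Sub D (Fctx (Suc n)) (Fctx n)"
  "G.fpr (N n) (T n) \<in> Sub D (Gctx (Suc n)) (Gctx n)"
  "F.fvr (N n) (T n) \<in> Tm D (Fctx (Suc n)) (tysub D (Fctx (Suc n)) (Fctx n) (Fty n) (F.fpr (N n) (T n)))"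
  "G.fvr (N n) (T n) \<in> Tm D (Gctx (Suc n)) (tysub D (Gctx (Suc n)) (Gctx n) (Gty n) (G.fpr (N n) (T n)))"
  using F.fpr_in[of "N n" "T n"] G.fpr_in[of "N n" "T n"] F.fvr_in[of "N n" "T n"] G.fvr_in[of "N n" "T n"]
  by (simp_all add: ext_N)

text \<open>Compatibility with variables, the case from which full naturality follows. A variable
  over n + 1 is q or a weakened variable. For q the claim is \<open>fvr_cell_ctx\<close>, for the
  others the induction hypothesis. Naturality enters only at p, where \<open>fpr_cell_ctx\<close>
  provides it.\<close>

lemma cell_tm:
  assumes "i < n"
  shows "tmsub D (Fctx n) (Gctx n) (Gty n) (FM G (N n) (T n) (V n i)) (cell_ctx n)
    = cell_ty_app n (Fctx n) (idn D (Fctx n)) (FM F (N n) (T n) (V n i))"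
  using assms
proof (induction n arbitrary: i)
  case (Suc n)
  let ?p = "pr C (N n) (T n)" and ?FE = "Fctx (Suc n)" and ?GE = "Gctx (Suc n)"
  let ?\<phi> = "cell_ctx (Suc n)" and ?Fp = "F.fpr (N n) (T n)" and ?Gp = "G.fpr (N n) (T n)"
  let ?TF = "tysub D ?FE (Fctx n) (Fty n) ?Fp" and ?TG = "tysub D ?GE (Gctx n) (Gty n) ?Gp"
  note [simp] = pr_N cell_ctx_in fpr_fvr_N_in
  have [simp]: "Fctx k \<in> Ctx D" "Gctx k \<in> Ctx D" "Fty k \<in> Ty D (Fctx k)" "Gty k \<in> Ty D (Gctx k)" for k
    by (simp_all add: pcalc)
  \<comment> \<open>Both kinds of variables reach the new context through \<theta> at p. By
    coherence at p this isomorphism can be stripped from both sides.\<close>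
  have step: "tmsub D ?FE ?GE (Gty (Suc n))
        (G.th_app (N (Suc n)) (N n) (T n) ?p ?GE (idn D ?GE) z) ?\<phi>
      = cell_ty_app (Suc n) ?FE (idn D ?FE) (F.th_app (N (Suc n)) (N n) (T n) ?p ?FE (idn D ?FE) y)"
    if y: "y \<in> Tm D ?FE ?TF" and z: "z \<in> Tm D ?GE ?TG" and zy: "tmsub D ?FE ?GE ?TG z ?\<phi> = cell_ty_app n ?FE ?Fp y" for y z
  proof -
    have "tmsub D ?FE ?GE (Gty (Suc n)) (G.th_app (N (Suc n)) (N n) (T n) ?p ?GE (idn D ?GE) z) ?\<phi>
      = G.th_app (N (Suc n)) (N n) (T n) ?p ?FE (cmp D ?FE ?GE ?GE (idn D ?GE) ?\<phi>) (tmsub D ?FE ?GE ?TG z ?\<phi>)"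
      using z by (intro G.th_app_tmsub) (simp_all add: target.calc fpr_N[symmetric] del: cell_ctx.simps)
    also have "\<dots> = cell_ty_app (Suc n) ?FE (idn D ?FE) (F.th_app (N (Suc n)) (N n) (T n) ?p ?FE (idn D ?FE) y)"
      using y cell_ty_coherent[of ?p "Suc n" n "cell_ctx n" ?\<phi> ?FE "idn D ?FE" y] fpr_cell_ctx[of n]
      by (simp add: target.calc fpr_N[symmetric] zy del: cell_ctx.simps)
    finally show ?thesis .
  qed
  show ?case
  proof (cases i)
    case 0
    have "FM F (N (Suc n)) (T (Suc n)) (V (Suc n) 0) = F.th_app (N (Suc n)) (N n) (T n) ?p ?FE (idn D ?FE) (F.fvr (N n) (T n))"
      "FM G (N (Suc n)) (T (Suc n)) (V (Suc n) 0) = G.th_app (N (Suc n)) (N n) (T n) ?p ?GE (idn D ?GE) (G.fvr (N n) (T n))"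
      using F.th_app_fvr[of "N n" "T n"] G.th_app_fvr[of "N n" "T n"] by (simp_all add: ext_N vr_N)
    then show ?thesis
      using step[OF _ _ fvr_cell_ctx] 0 by simp
  next
    case (Suc j)
    then have j: "j < n"
      using Suc.prems by simp
    let ?a = "FM F (N n) (T n) (V n j)" and ?b = "FM G (N n) (T n) (V n j)"
    have a: "?a \<in> Tm D (Fctx n) (Fty n)" and b: "?b \<in> Tm D (Gctx n) (Gty n)"
      using V_in[OF j] by (simp_all add: pcalc)
    have "FM F (N (Suc n)) (T (Suc n)) (V (Suc n) i) =
        F.th_app (N (Suc n)) (N n) (T n) ?p ?FE (idn D ?FE) (tmsub D ?FE (Fctx n) (Fty n) ?a ?Fp)"
      "FM G (N (Suc n)) (T (Suc n)) (V (Suc n) i) =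
        G.th_app (N (Suc n)) (N n) (T n) ?p ?GE (idn D ?GE) (tmsub D ?GE (Gctx n) (Gty n) ?b ?Gp)"
      using F.FM_tmsub'[of "N (Suc n)" "N n" ?p "T n" "V n j" "T (Suc n)"]
        G.FM_tmsub'[of "N (Suc n)" "N n" ?p "T n" "V n j" "T (Suc n)"] V_in[OF j] V_pr[OF j]
      by (simp_all add: Suc fpr_N)
    moreover have "tmsub D ?FE ?GE ?TG (tmsub D ?GE (Gctx n) (Gty n) ?b ?Gp) ?\<phi> =
        cell_ty_app n ?FE ?Fp (tmsub D ?FE (Fctx n) (Fty n) ?a ?Fp)"
    proof -
      have "tmsub D ?FE ?GE ?TG (tmsub D ?GE (Gctx n) (Gty n) ?b ?Gp) ?\<phi>
          = tmsub D ?FE (Gctx n) (Gty n) ?b (cmp D ?FE (Fctx n) (Gctx n) (cell_ctx n) ?Fp)"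
        using b by (simp add: target.tmsub_tmsub fpr_cell_ctx del: cell_ctx.simps)
      also have "\<dots> = tmsub D ?FE (Fctx n) (tysub D (Fctx n) (Gctx n) (Gty n) (cell_ctx n))
          (tmsub D (Fctx n) (Gctx n) (Gty n) ?b (cell_ctx n)) ?Fp"
        using b by (intro target.tmsub_cmp) simp_all
      also have "\<dots> = cell_ty_app n ?FE (cmp D ?FE (Fctx n) (Fctx n) (idn D (Fctx n)) ?Fp)
          (tmsub D ?FE (Fctx n) (tysub D (Fctx n) (Fctx n) (Fty n) (idn D (Fctx n))) ?a ?Fp)"
        unfolding Suc.IH[OF j] using a cell_ty_hom
        by (intro target.app_tmsub) (simp_all add: target.calc)
      finally show ?thesis
        by (simp add: target.calc)
    qed
    ultimately show ?thesis
      using step a b by (simp add: target.calc del: cell_ctx.simps)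
  qed
qed simp

text \<open>Substitutions into G(\<Gamma>.A) are compared by their projections. The first is the
  induction hypothesis at p o \<gamma>. The second concerns q[\<gamma>], a variable of the source,
  and follows from \<open>cell_tm\<close>.\<close>

lemma cell_natural:
  "\<gamma> \<in> Sub C (N m) (N n) \<Longrightarrow>
    cmp D (Fctx m) (Fctx n) (Gctx n) (cell_ctx n) (FS F (N m) (N n) \<gamma>)
      = cmp D (Fctx m) (Gctx m) (Gctx n) (FS G (N m) (N n) \<gamma>) (cell_ctx m)"
proof (induction n arbitrary: \<gamma>)
  case 0
  then show ?case
    using cell_ctx_in[of m] cell_emp_in by (intro G_emp_unique[of "Fctx m"]) (simp_all add: pcalc)
next
  case (Suc n)
  let ?p = "pr C (N n) (T n)" and ?F\<gamma> = "FS F (N m) (N (Suc n)) \<gamma>" and ?G\<gamma> = "FS G (N m) (N (Suc n)) \<gamma>"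
  let ?FE = "Fctx (Suc n)" and ?GE = "Gctx (Suc n)" and ?Fp = "F.fpr (N n) (T n)" and ?Gp = "G.fpr (N n) (T n)"
  let ?\<delta> = "cmp C (N m) (N (Suc n)) (N n) ?p \<gamma>"
  let ?TF = "tysub D ?FE (Fctx n) (Fty n) ?Fp" and ?TG = "tysub D ?GE (Gctx n) (Gty n) ?Gp"
  note [simp] = pr_N cell_ctx_in fpr_fvr_N_in Suc.prems
  have [simp]: "Fctx k \<in> Ctx D" "Gctx k \<in> Ctx D" "Fty k \<in> Ty D (Fctx k)" "Gty k \<in> Ty D (Gctx k)"
    "?F\<gamma> \<in> Sub D (Fctx m) ?FE" "?G\<gamma> \<in> Sub D (Gctx m) ?GE" for k
    by (simp_all add: pcalc)
  have \<delta> [simp]: "?\<delta> \<in> Sub C (N m) (N n)"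
    by (simp add: calc)
  have IH: "cmp D (Fctx m) (Fctx n) (Gctx n) (cell_ctx n) (FS F (N m) (N n) ?\<delta>)
      = cmp D (Fctx m) (Gctx m) (Gctx n) (FS G (N m) (N n) ?\<delta>) (cell_ctx m)"
    by (rule Suc.IH[OF \<delta>])
  have F\<delta>: "cmp D (Fctx m) ?FE (Fctx n) ?Fp ?F\<gamma> = FS F (N m) (N n) ?\<delta>"
    and G\<delta>: "cmp D (Gctx m) ?GE (Gctx n) ?Gp ?G\<gamma> = FS G (N m) (N n) ?\<delta>"
    by (simp_all add: fpr_N F.FS_cmp G.FS_cmp)
  define a where "a = tmsub C (N m) (N (Suc n)) (T (Suc n)) (V (Suc n) 0) \<gamma>"
  define y where "y = tmsub D (Fctx m) ?FE ?TF (F.fvr (N n) (T n)) ?F\<gamma>"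
  define z where "z = tmsub D (Gctx m) ?GE ?TG (G.fvr (N n) (T n)) ?G\<gamma>"
  have y: "y \<in> Tm D (Fctx m) (tysub D (Fctx m) (Fctx n) (Fty n) (FS F (N m) (N n) ?\<delta>))"
    and z: "z \<in> Tm D (Gctx m) (tysub D (Gctx m) (Gctx n) (Gty n) (FS G (N m) (N n) ?\<delta>))"
    unfolding y_def z_def by (simp_all add: target.calc F\<delta> G\<delta>)
  have th: "F.th_app (N m) (N n) (T n) ?\<delta> (Fctx m) (idn D (Fctx m)) y = FM F (N m) (T m) a"
    "G.th_app (N m) (N n) (T n) ?\<delta> (Gctx m) (idn D (Gctx m)) z = FM G (N m) (T m) a"
    using F.th_app_fvr_FS[of "N n" "T n" "N m" \<gamma>] G.th_app_fvr_FS[of "N n" "T n" "N m" \<gamma>]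
    by (simp_all add: ext_N vr_N y_def z_def a_def)
  have F\<delta>_in [simp]: "FS F (N m) (N n) ?\<delta> \<in> Sub D (Fctx m) (Fctx n)" "FS G (N m) (N n) ?\<delta> \<in> Sub D (Gctx m) (Gctx n)"
    by (simp_all add: F.FS_in G.FS_in del: cmp_assoc)
  let ?TGm = "tysub D (Gctx m) (Gctx n) (Gty n) (FS G (N m) (N n) ?\<delta>)"
  let ?w = "cell_ty_app n (Fctx m) (FS F (N m) (N n) ?\<delta>) y"
  have a: "a \<in> Tm C (N m) (T m)"
    unfolding a_def using V_in[of 0 "Suc n"] by (simp add: tmsub_in_eq)
  have "G.th_app (N m) (N n) (T n) ?\<delta> (Fctx m) (cell_ctx m) (tmsub D (Fctx m) (Gctx m) ?TGm z (cell_ctx m))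
      = tmsub D (Fctx m) (Gctx m) (Gty m) (FM G (N m) (T m) a) (cell_ctx m)"
    using G.th_app_tmsub[of "N m" "N n" ?\<delta> "T n" "Gctx m" "idn D (Gctx m)" z "Fctx m" "cell_ctx m"] z th(2)
    by (simp add: target.calc)
  \<comment> \<open>The term q[\<gamma>] is a variable, as every term is here.\<close>
  also have "\<dots> = cell_ty_app m (Fctx m) (idn D (Fctx m)) (FM F (N m) (T m) a)"
    using a by (elim Tm_cases) (simp add: cell_tm)
  also have "\<dots> = G.th_app (N m) (N n) (T n) ?\<delta> (Fctx m) (cell_ctx m) ?w"
    using cell_ty_coherent[OF \<delta> cell_ctx_in cell_ctx_in IH, of "Fctx m" "idn D (Fctx m)" y] y th(1)
    by (simp add: target.calc)
  finally have eq: "G.th_app (N m) (N n) (T n) ?\<delta> (Fctx m) (cell_ctx m) (tmsub D (Fctx m) (Gctx m) ?TGm z (cell_ctx m))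
    = G.th_app (N m) (N n) (T n) ?\<delta> (Fctx m) (cell_ctx m) ?w" .
  have w_in: "?w \<in> Tm D (Fctx m) (tysub D (Fctx m) (Gctx n) (Gty n)
      (cmp D (Fctx m) (Gctx m) (Gctx n) (FS G (N m) (N n) ?\<delta>) (cell_ctx m)))"
    unfolding IH[symmetric] using y cell_ty_hom by (intro target.app_in) (simp_all add: target.calc)
  have z_in: "tmsub D (Fctx m) (Gctx m) ?TGm z (cell_ctx m) \<in> Tm D (Fctx m) (tysub D (Fctx m) (Gctx n) (Gty n)
      (cmp D (Fctx m) (Gctx m) (Gctx n) (FS G (N m) (N n) ?\<delta>) (cell_ctx m)))"
    using z by (simp add: target.calc)
  have inj: "G.th_unapp (N m) (N n) (T n) ?\<delta> (Fctx m) (cell_ctx m) (G.th_app (N m) (N n) (T n) ?\<delta> (Fctx m) (cell_ctx m) u) = u"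
    if "u \<in> Tm D (Fctx m) (tysub D (Fctx m) (Gctx n) (Gty n)
      (cmp D (Fctx m) (Gctx m) (Gctx n) (FS G (N m) (N n) ?\<delta>) (cell_ctx m)))" for u
    using that by (intro G.th_unapp_th_app) simp_all
  \<comment> \<open>So far the two terms agree only after \<theta> of G at p o \<gamma>, which is
    invertible.\<close>
  have zw: "tmsub D (Fctx m) (Gctx m) ?TGm z (cell_ctx m) = ?w"
    using inj[OF z_in] inj[OF w_in] eq by metis
  let ?\<phi> = "cell_ctx (Suc n)"
  show ?case
  proof (rule G.funique[of "N n" "T n" "Fctx m", unfolded ext_N])
    have "cmp D (Fctx m) ?GE (Gctx n) ?Gp (cmp D (Fctx m) ?FE ?GE ?\<phi> ?F\<gamma>)
        = cmp D (Fctx m) ?FE (Gctx n) (cmp D ?FE ?GE (Gctx n) ?Gp ?\<phi>) ?F\<gamma>"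
      by (simp add: target.cmp_assoc del: cell_ctx.simps)
    also have "\<dots> = cmp D (Fctx m) (Fctx n) (Gctx n) (cell_ctx n) (FS F (N m) (N n) ?\<delta>)"
      unfolding fpr_cell_ctx F\<delta>[symmetric] by (simp add: target.cmp_assoc)
    also have "\<dots> = cmp D (Fctx m) ?GE (Gctx n) ?Gp (cmp D (Fctx m) (Gctx m) ?GE ?G\<gamma> (cell_ctx m))"
      unfolding IH G\<delta>[symmetric] by (simp add: target.cmp_assoc)
    finally show "cmp D (Fctx m) ?GE (Gctx n) ?Gp (cmp D (Fctx m) ?FE ?GE ?\<phi> ?F\<gamma>)
      = cmp D (Fctx m) ?GE (Gctx n) ?Gp (cmp D (Fctx m) (Gctx m) ?GE ?G\<gamma> (cell_ctx m))" .
    have "tmsub D (Fctx m) ?GE ?TG (G.fvr (N n) (T n)) (cmp D (Fctx m) ?FE ?GE ?\<phi> ?F\<gamma>)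
      = tmsub D (Fctx m) ?FE (tysub D ?FE ?GE ?TG ?\<phi>) (tmsub D ?FE ?GE ?TG (G.fvr (N n) (T n)) ?\<phi>) ?F\<gamma>"
      by (intro target.tmsub_cmp) (simp_all add: target.calc del: cell_ctx.simps)
    also have "\<dots> = ?w"
      unfolding fvr_cell_ctx F\<delta>[symmetric] y_def using cell_ty_hom
      by (intro target.app_tmsub) (simp_all add: target.calc fpr_cell_ctx del: cell_ctx.simps)
    also have "\<dots> = tmsub D (Fctx m) ?GE ?TG (G.fvr (N n) (T n)) (cmp D (Fctx m) (Gctx m) ?GE ?G\<gamma> (cell_ctx m))"
      unfolding zw[symmetric] z_def by (simp add: target.tmsub_tmsub target.calc G\<delta>)
    finally show "tmsub D (Fctx m) ?GE ?TG (G.fvr (N n) (T n)) (cmp D (Fctx m) ?FE ?GE ?\<phi> ?F\<gamma>)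
      = tmsub D (Fctx m) ?GE ?TG (G.fvr (N n) (T n)) (cmp D (Fctx m) (Gctx m) ?GE ?G\<gamma> (cell_ctx m))" .
  qed (simp_all add: target.cmp_in del: cell_ctx.simps)
qed

text \<open>Over the empty context o and o[!] are the same type, so the general formula must
  reproduce the prescribed component. It does because ! is the identity there and \<theta> at an
  identity is trivial.\<close>

lemma cell_ty_0: "cell_ty 0 cell_emp = cell_base"
proof (rule target.hom_eqI)
  have mem: "Fctx 0 \<in> Ctx D" "Fty 0 \<in> Ty D (Fctx 0)" "Gctx 0 \<in> Ctx D" "Gty 0 \<in> Ty D (Gctx 0)"
    by (simp_all add: pcalc)
  let ?E = "ext D (Fctx 0) (Fty 0)" and ?p = "pr D (Fctx 0) (Fty 0)" and ?q = "vr D (Fctx 0) (Fty 0)"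
  have E: "?E \<in> Ctx D" "?p \<in> Sub D ?E (Fctx 0)" "?q \<in> Tm D ?E (tysub D ?E (Fctx 0) (Fty 0) ?p)"
    using mem by (simp_all add: target.calc target.vr_in)
  have v: "base_app ?E ?p ?q \<in> Tm D ?E (tysub D ?E (Gctx 0) (Gty 0) (cmp D ?E (Fctx 0) (Gctx 0) cell_emp ?p))"
    using E by (rule base_app_in)
  have "F.th_app (N 0) (N 0) (T 0) (idn C (N 0)) ?E ?p ?q = ?q"
    using E by (intro F.th_app_idn) simp_all
  moreover have "G.th_app (N 0) (N 0) (T 0) (idn C (N 0)) ?E (cmp D ?E (Fctx 0) (Gctx 0) cell_emp ?p) (base_app ?E ?p ?q) = base_app ?E ?p ?q"
    using E v mem cell_emp_in by (intro G.th_app_idn) (simp_all add: target.cmp_in)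
  ultimately show "cell_app (N 0) (T 0) cell_emp (cell_ty 0 cell_emp) ?E ?p ?q = base_app ?E ?p ?q"
    using app_cell_ty_th_app[OF cell_emp_in E(1,2), of ?q] E mem
    by (simp add: bang_N_0 F.FS_idn target.calc)
qed (use cell_emp_in target.iso_hom[OF cell_ty_iso[OF cell_emp_in]] target.iso_hom[OF cell_base_iso] in \<open>simp_all add: pcalc\<close>)

text \<open>Going from 1 to F1 and back is reindexing along ! o \<open>!_F\<close>, the identity of
  1.\<close>

lemma reindex_cell_base:
  "ty_reindex D (emp D) (Fctx 0) (Fty 0) (base_cod)
    (bang_map C D F) cell_base = \<kappa>"
proof -
  let ?B = "base_cod"
  let ?oA = "base_image C (T 0) D F" and ?oB = "base_image C (T 0) D G"
  have mem: "Fctx 0 \<in> Ctx D" "Fty 0 \<in> Ty D (Fctx 0)" "?B \<in> Ty D (Fctx 0)"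
    using cell_emp_in by (simp_all add: pcalc)
  have tys: "?oA = tysub D (emp D) (Fctx 0) (Fty 0) (bang_map C D F)"
    "?oB = tysub D (emp D) (Fctx 0) ?B (bang_map C D F)"
  proof -
    have "cmp D (emp D) (Fctx 0) (Gctx 0) cell_emp (bang_map C D F) = bang_map C D G"
      using cell_emp_in bang_maps by (intro G_emp_unique[of "emp D"]) (simp_all add: pcalc)
    then show "?oB = tysub D (emp D) (Fctx 0) ?B (bang_map C D F)"
      unfolding base_image_N using cell_emp_in bang_maps by (simp add: pcalc)
  qed (rule base_image_N)
  have hom: "ty_reindex D (emp D) (Fctx 0) (Fty 0) ?B (bang_map C D F) cell_base \<in> ty_hom D (emp D) ?oA ?oB"
    using mem tys bang_maps target.iso_hom[OF cell_base_iso] by (intro target.ty_reindex_hom) (simp_all add: target.emp_in)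
  let ?E = "ext D (emp D) ?oA" and ?p = "pr D (emp D) ?oA" and ?q = "vr D (emp D) ?oA"
  have E: "?E \<in> Ctx D" "?p \<in> Sub D ?E (emp D)" "?q \<in> Tm D ?E (tysub D ?E (emp D) ?oA ?p)"
    using base_image_in by (simp_all add: target.calc target.vr_in)
  let ?bp = "cmp D ?E (emp D) (Fctx 0) (bang_map C D F) ?p"
  have bp: "?bp \<in> Sub D ?E (Fctx 0)" "cmp D ?E (Fctx 0) (emp D) (target.bang (Fctx 0)) ?bp = ?p"
    using E bang_maps mem bang_F_0 by (simp_all add: target.cmp_in target.emp_in target.cmp_idn_left flip: target.cmp_assoc)
  show ?thesis
  proof (rule target.hom_eqI[OF _ _ _ hom target.iso_hom[OF \<kappa>_iso]])
    have "tysub D ?E (Fctx 0) (Fty 0) ?bp =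
        tysub D ?E (emp D) (tysub D (emp D) (Fctx 0) (Fty 0) (bang_map C D F)) ?p"
      using E bang_maps mem by (intro target.tysub_cmp) (simp_all add: target.emp_in)
    then have q: "?q \<in> Tm D ?E (tysub D ?E (Fctx 0) (Fty 0) ?bp)"
      using E(3) by (simp only: tys(1)[symmetric])
    have "target.app (emp D) ?oA ?oB ?E (ty_reindex D (emp D) (Fctx 0) (Fty 0) ?B (bang_map C D F) cell_base) ?p ?q
      = base_app ?E ?bp ?q"
      using mem tys bang_maps target.iso_hom[OF cell_base_iso] E q
      by (intro target.app_ty_reindex) (simp_all add: target.emp_in)
    also have "\<dots> = target.app (emp D) ?oA ?oB ?E \<kappa> ?p ?q"
      unfolding cell_base_def using target.app_ty_reindex[of "emp D" ?oA ?oB \<kappa> "Fctx 0" "target.bang (Fctx 0)"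
          "Fty 0" ?B ?E ?bp ?q] base_image_in target.iso_hom[OF \<kappa>_iso] bang_F_0 base_image_bang E bp mem
      by (simp add: target.emp_in)
    finally show "target.app (emp D) ?oA ?oB ?E (ty_reindex D (emp D) (Fctx 0) (Fty 0) ?B (bang_map C D F) cell_base) ?p ?q
      = target.app (emp D) ?oA ?oB ?E \<kappa> ?p ?q" .
  qed (use base_image_in in \<open>simp_all add: target.emp_in\<close>)
qed

text \<open>The opposite composite \<open>!_F\<close> o ! is the identity of F1, so reindexing along
  \<open>!_F\<close> loses nothing: the action of a morphism on the generic term can be read off its
  reindexing.\<close>

lemma cell_base_unique:
  assumes "\<psi> \<in> ty_hom D (Fctx 0) (Fty 0) (base_cod)"
    and "ty_reindex D (emp D) (Fctx 0) (Fty 0) (base_cod)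
      (bang_map C D F) \<psi> = \<kappa>"
  shows "\<psi> = cell_base"
proof -
  let ?X = "Fctx 0" and ?A = "Fty 0" and ?b = "target.bang (Fctx 0)"
  let ?B = "base_cod"
  let ?E = "ext D ?X ?A" and ?p = "pr D ?X ?A" and ?q = "vr D ?X ?A"
  let ?oA = "tysub D (emp D) ?X ?A (bang_map C D F)" and ?oB = "tysub D (emp D) ?X ?B (bang_map C D F)"
  have mem: "?X \<in> Ctx D" "?A \<in> Ty D ?X" "?B \<in> Ty D ?X"
    using cell_emp_in by (simp_all add: pcalc)
  have E: "?E \<in> Ctx D" "?p \<in> Sub D ?E ?X" "?q \<in> Tm D ?E (tysub D ?E ?X ?A ?p)"
    using mem by (simp_all add: target.calc target.vr_in)
  have bp: "cmp D ?E ?X (emp D) ?b ?p \<in> Sub D ?E (emp D)"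
    "cmp D ?E (emp D) ?X (bang_map C D F) (cmp D ?E ?X (emp D) ?b ?p) = ?p"
    using E bang_maps mem bang_F_0 by (simp_all add: target.cmp_in target.emp_in target.cmp_idn_left flip: target.cmp_assoc)
  have "target.app ?X ?A ?B ?E h ?p ?q =
      target.app (emp D) ?oA ?oB ?E (ty_reindex D (emp D) ?X ?A ?B (bang_map C D F) h) (cmp D ?E ?X (emp D) ?b ?p) ?q"
    if "h \<in> ty_hom D ?X ?A ?B" for h
    using target.app_ty_reindex[OF mem that, of "emp D" "bang_map C D F" ?oA ?oB ?E "cmp D ?E ?X (emp D) ?b ?p" ?q]
      bang_maps E bp by (simp add: target.emp_in)
  from this[OF assms(1)] this[OF target.iso_hom[OF cell_base_iso]] show ?thesis
    using mem assms target.iso_hom[OF cell_base_iso] reindex_cell_base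
    by (intro target.hom_eqI[of ?X ?A ?B]) simp_all
qed

section \<open>The unique 2-cell between two arrows\<close>

definition cell :: "('c \<Rightarrow> 'u) \<times> ('c \<Rightarrow> 't \<Rightarrow> 'u)" where
  "cell = (\<lambda>\<Gamma>\<in>Ctx C. cell_ctx (ctx_len \<Gamma>), \<lambda>\<Gamma>\<in>Ctx C. \<lambda>A\<in>Ty C \<Gamma>. cell_ty (ctx_len \<Gamma>) (cell_ctx (ctx_len \<Gamma>)))"

lemma cell_transformation: "pseudo_cwf_transformation C D F G (fst cell) (snd cell)"
  unfolding transformation_iff cell_def using cell_ctx_in cell_ty_iso[OF cell_ctx_in] cell_natural
  by (auto elim!: Ctx_cases dest!: Ty_cases simp: ext_N N_inj)

lemma transformation_base:
  assumes "pseudo_cwf_transformation C D F G \<phi> \<psi>"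
  shows "\<phi> (N 0) = cell_emp"
    and "\<psi> (N 0) (T 0) \<in> ty_hom D (Fctx 0) (Fty 0) (base_cod)"
proof -
  have "\<phi> (N 0) \<in> Sub D (Fctx 0) (Gctx 0)"
    using assms unfolding transformation_iff by (auto simp: PiE_iff)
  then show \<phi>: "\<phi> (N 0) = cell_emp"
    using cell_emp_in by (intro G_emp_unique[of "Fctx 0"]) (simp_all add: pcalc)
  show "\<psi> (N 0) (T 0) \<in> ty_hom D (Fctx 0) (Fty 0) (base_cod)"
    using assms unfolding transformation_iff \<phi>[symmetric] by (auto simp: PiE_iff intro: target.iso_hom)
qed

text \<open>The condition on the base type pins down the component at o, by
  \<open>cell_base_unique\<close>, and \<open>transformation_unique\<close> then pins down
  everything else.\<close>

lemma ex1_transformation: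
  "\<exists>!c. pseudo_cwf_transformation C D F G (fst c) (snd c) \<and>
    ty_reindex D (emp D) (Fctx 0) (Fty 0)
      (tysub D (Fctx 0) (Gctx 0) (Gty 0) (fst c (N 0))) (bang_map C D F) (snd c (N 0) (T 0)) = \<kappa>"
proof (rule ex1I[of _ cell], intro conjI)
  show "pseudo_cwf_transformation C D F G (fst cell) (snd cell)"
    by (rule cell_transformation)
  have cell_0: "fst cell (N 0) = cell_emp" "snd cell (N 0) (T 0) = cell_base"
    by (simp_all add: cell_def cell_ty_0)
  then show "ty_reindex D (emp D) (Fctx 0) (Fty 0)
      (tysub D (Fctx 0) (Gctx 0) (Gty 0) (fst cell (N 0))) (bang_map C D F) (snd cell (N 0) (T 0)) = \<kappa>"
    by (simp add: reindex_cell_base)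
  fix c
  assume c: "pseudo_cwf_transformation C D F G (fst c) (snd c) \<and>
    ty_reindex D (emp D) (Fctx 0) (Fty 0)
      (tysub D (Fctx 0) (Gctx 0) (Gty 0) (fst c (N 0))) (bang_map C D F) (snd c (N 0) (T 0)) = \<kappa>"
  then have "snd c (N 0) (T 0) = cell_base"
    using transformation_base[of "fst c" "snd c"] by (intro cell_base_unique) auto
  then show "c = cell"
    using transformation_unique[of "fst c" "snd c" "fst cell" "snd cell"] c cell_transformation cell_0
    by (simp add: prod_eq_iff)
qed

end

context variable_cwf
begin

lemma cell_unique_exists:
  assumes "pointed_cwf D oD" "f \<in> cwfo_arr (C, T 0) (D, oD)" "g \<in> cwfo_arr (C, T 0) (D, oD)"
  shows "\<exists>!c. c \<in> cwfo_cell (C, T 0) (D, oD) f g"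
proof -
  interpret D: pointed_cwf D oD by fact
  obtain F \<alpha> G \<beta> where fg: "f = (F, \<alpha>)" "g = (G, \<beta>)"
    by fastforce
  have F: "pseudo_cwf_morphism C D F" "\<alpha> \<in> ty_iso D (emp D) (base_image C (T 0) D F) oD"
    and G: "pseudo_cwf_morphism C D G" "\<beta> \<in> ty_iso D (emp D) (base_image C (T 0) D G) oD"
    using assms(2,3) by (auto simp: fg cwfo_arr_def)
  interpret F: pseudo_cwf_morphism C D F by fact
  interpret G: pseudo_cwf_morphism C D G by fact
  interpret parallel_morphisms C N T V D F G
    by unfold_locales
  \<comment> \<open>The right side of the 2-cell condition, an isomorphism because \<alpha> and
    \<beta> are.\<close>
  let ?\<kappa> = "ty_cmp D (emp D) (base_image C (T 0) D F) oD (base_image C (T 0) D G)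
    (ty_inv D (emp D) (base_image C (T 0) D G) oD \<beta>) \<alpha>"
  have "base_image C (T 0) D F \<in> Ty D (emp D)" "base_image C (T 0) D G \<in> Ty D (emp D)"
    using F.bang_map_in G.bang_map_in by (simp_all add: base_image_def emp_N pcalc)
  then have "?\<kappa> \<in> ty_iso D (emp D) (base_image C (T 0) D F) (base_image C (T 0) D G)"
    using F(2) G(2) D.base_in_emp by (intro D.ty_cmp_iso D.ty_inv_iso) (simp_all add: D.emp_in)
  then interpret parallel_arrows C N T V D F G ?\<kappa>
    by unfold_locales
  show ?thesis
    using ex1_transformation by (simp add: cwfo_cell_def fg emp_N case_prod_beta' split_beta mem_Collect_eq)
qed

end

theorem theorem3p10:
  shows "syn_cwfo \<in> cwfo_obj \<and>
    bi_initial (cwfo_obj :: ('c, 's, 't, 'm) cwfo set) cwfo_arr cwfo_cell syn_cwfo"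
proof
  show "syn_cwfo \<in> cwfo_obj"
    using cwf_syn by (simp add: cwfo_obj_def syn_cwfo_def syn_base_eq emp_syn Ty_syn)
  interpret variable_cwf syn_cwf syn_ctx syn_ty syn_tm
    by (rule variable_cwf_syn)
  show "bi_initial (cwfo_obj :: ('c, 's, 't, 'm) cwfo set) cwfo_arr cwfo_cell syn_cwfo"
    unfolding bi_initial_def
  proof
    fix X :: "('c, 's, 't, 'm) cwfo"
    assume "X \<in> cwfo_obj"
    then obtain D oD where X: "X = (D, oD)" and "cwf D" "oD \<in> Ty D (emp D)"
      by (auto simp: cwfo_obj_def)
    then have D: "pointed_cwf D oD"
      by (simp add: pointed_cwf_def pointed_cwf_axioms_def)
    show "(\<exists>f. f \<in> cwfo_arr syn_cwfo X) \<and>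
        (\<forall>f\<in>cwfo_arr syn_cwfo X. \<forall>g\<in>cwfo_arr syn_cwfo X. \<exists>!c. c \<in> cwfo_cell syn_cwfo X f g)"
      unfolding X syn_cwfo_def syn_base_eq
      by (intro conjI ballI exI) (rule arrow_exists[OF D], rule cell_unique_exists[OF D])
  qed
qed

end
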